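(* Let $(M,\varphi)$ be an integrable $G_2$ manifold, i.e. $d{*\varphi}=\theta\wedge *\varphi$ with $\theta$ the Lee form, and let $\nabla$ be its characteristic connection, with torsion 3-form $T$ and curvature $R$. Suppose that the Lee form is $\nabla$-parallel, $\nabla\theta=0$, and that $R$ is a $G_2$-instanton. Then the torsion 3-form is parallel with respect to the characteristic connection, $\nabla T=0$. In particular, the $G_2$ manifold is of constant type, the characteristic Ricci tensor $Ric$ (the Ricci tensor of $\nabla$) is symmetric and $\nabla$-parallel, and $\nabla dT=0$.
   Context: Manifolds are smooth and connected. A $G_2$ manifold $(M,\varphi)$ is a 7-manifold with a 3-form $\varphi$ that near each point can be written, in a local coframe $e_1,\dots,e_7$, as $\varphi=e_{127}+e_{135}-e_{146}-e_{236}-e_{245}+e_{347}+e_{567}$, where $e_{ijk}=e_i\wedge e_j\wedge e_k$. It induces the metric $g$ and orientation for which such coframes are oriented orthonormal; $*$ is the Hodge star, $(\cdot,\cdot)$ the induced scalar product on forms. Vectors and covectors are identified via $g$, indices refer to a local orthonormal frame, and repeated indices are summed. The Lee form is $\theta=-\frac13*( *d\varphi\wedge\varphi)$. The $G_2$ structure is integrable if $d{*\varphi}=\theta\wedge*\varphi$. It is of constant type if it is integrable and the function $(d\varphi,*\varphi)$ is constant. On an integrable $G_2$ manifold there is a unique linear connection $\nabla$ (the characteristic connection) with $\nabla g=0$, $\nabla\varphi=0$ and totally skew-symmetric torsion, i.e. $T(X,Y,Z)=g(\nabla_XY-\nabla_YX-[X,Y],Z)$ is a 3-form; explicitly $T=-*d\varphi+*(\theta\wedge\varphi)+\frac16(d\varphi,*\varphi)\varphi$.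 Curvature: $R(X,Y)Z=[\nabla_X,\nabla_Y]Z-\nabla_{[X,Y]}Z$, $R(X,Y,Z,V)=g(R(X,Y)Z,V)$, and $Ric(X,Y)=\sum_a R(e_a,X,Y,e_a)$. $R$ is a $G_2$-instanton if $R_{abij}\varphi_{abk}=0$ for all $i,j,k$, i.e. the curvature 2-form lies in $\mathfrak g_2\cong\{\alpha\in\Lambda^2: *(\alpha\wedge\varphi)=-\alpha\}$; equivalently (since $\nabla\varphi=0$) $R\in\mathfrak g_2\otimes\mathfrak g_2$. *)

theory Defs
  imports "HOL-Analysis.Analysis"
begin

section \<open>Smooth functions on open subsets of Euclidean 7-space\<close>

definition pd :: "7 \<Rightarrow> (real^7 \<Rightarrow> real) \<Rightarrow> real^7 \<Rightarrow> real" where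
  "pd i f x = frechet_derivative f (at x) (axis i 1)"

text \<open>Only used for open \<open>S\<close>.\<close>

primrec Ck_on :: "nat \<Rightarrow> (real^7) set \<Rightarrow> (real^7 \<Rightarrow> real) \<Rightarrow> bool" where
  "Ck_on 0 S f \<longleftrightarrow> continuous_on S f"
| "Ck_on (Suc k) S f \<longleftrightarrow> (\<forall>x\<in>S. f differentiable (at x)) \<and> (\<forall>i. Ck_on k S (pd i f))"

definition smooth_on :: "(real^7) set \<Rightarrow> (real^7 \<Rightarrow> real) \<Rightarrow> bool" where
  "smooth_on S f \<longleftrightarrow> (\<forall>k. Ck_on k S f)"


section \<open>Smooth 7-manifolds\<close>

text \<open>A manifold is given by an atlas; its underlying space is the union of the chart domains,
  with the topology of the (Hausdorff, second countable) ambient type.\<close>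

type_synonym 'm chart = "'m set \<times> ('m \<Rightarrow> real^7)"

abbreviation chart_dom :: "'m chart \<Rightarrow> 'm set" where
  "chart_dom c \<equiv> fst c"

definition chart_img :: "'m chart \<Rightarrow> (real^7) set" where
  "chart_img c = snd c ` chart_dom c"

definition chart_inv :: "'m chart \<Rightarrow> real^7 \<Rightarrow> 'm" where
  "chart_inv c = inv_into (chart_dom c) (snd c)"

definition transition :: "'m chart \<Rightarrow> 'm chart \<Rightarrow> real^7 \<Rightarrow> real^7" where
  "transition c d = snd d \<circ> chart_inv c"

definition overlap :: "'m chart \<Rightarrow> 'm chart \<Rightarrow> (real^7) set" where
  "overlap c d = snd c ` (chart_dom c \<inter> chart_dom d)"

definition smooth_manifold7 :: "('m::{t2_space,second_countable_topology}) chart set \<Rightarrow> bool" where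
  "smooth_manifold7 A \<longleftrightarrow>
     (\<forall>c\<in>A. open (chart_dom c) \<and> open (chart_img c) \<and>
            homeomorphism (chart_dom c) (chart_img c) (snd c) (chart_inv c)) \<and>
     (\<forall>c\<in>A. \<forall>d\<in>A. \<forall>i. smooth_on (overlap c d) (\<lambda>x. transition c d x $ i)) \<and>
     connected (\<Union>c\<in>A. chart_dom c)"


section \<open>Covariant tensors and differential forms in coordinates\<close>

text \<open>A covariant \<open>p\<close>-tensor at a point is given by its components with respect to the coordinate
  frame, indexed by lists of length \<open>p\<close>; values on lists of other lengths carry no meaning and are
  never used.  The index type \<open>7\<close> has the elements 1, ..., 7 (the numeral 7 equals 0 there).
  A tensor field on a manifold has a component field in every chart.\<close>

type_synonym tensor = "7 list \<Rightarrow> real"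
type_synonym tensor_field = "real^7 \<Rightarrow> tensor"
type_synonym 'm manifold_tensor = "'m chart \<Rightarrow> tensor_field"

definition alternating :: "nat \<Rightarrow> tensor \<Rightarrow> bool" where
  "alternating p \<alpha> \<longleftrightarrow>
     (\<forall>I j k. length I = p \<and> j < k \<and> k < p \<longrightarrow> \<alpha> (I[j := I ! k, k := I ! j]) = - \<alpha> I)"

definition tensor_on :: "'m chart set \<Rightarrow> nat \<Rightarrow> 'm manifold_tensor \<Rightarrow> bool" where
  "tensor_on A p S \<longleftrightarrow>
     (\<forall>c\<in>A. \<forall>I. length I = p \<longrightarrow> smooth_on (chart_img c) (\<lambda>x. S c x I)) \<and>
     (\<forall>c\<in>A. \<forall>d\<in>A. \<forall>x\<in>overlap c d. \<forall>I. length I = p \<longrightarrow>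
        S c x I = (\<Sum>J | length J = p. S d (transition c d x) J *
                     (\<Prod>k<p. pd (I ! k) (\<lambda>y. transition c d y $ (J ! k)) x)))"

definition form_on :: "'m chart set \<Rightarrow> nat \<Rightarrow> 'm manifold_tensor \<Rightarrow> bool" where
  "form_on A p \<omega> \<longleftrightarrow> tensor_on A p \<omega> \<and> (\<forall>c\<in>A. \<forall>x\<in>chart_img c. alternating p (\<omega> c x))"

definition wedge :: "nat \<Rightarrow> nat \<Rightarrow> tensor \<Rightarrow> tensor \<Rightarrow> tensor" where
  "wedge p q \<alpha> \<beta> I = 1 / (fact p * fact q) *
     (\<Sum>\<pi> | \<pi> permutes {..<p+q}. of_int (sign \<pi>) *
        \<alpha> (map (\<lambda>k. I ! \<pi> k) [0..<p]) * \<beta> (map (\<lambda>k. I ! \<pi> k) [p..<p+q]))"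

text \<open>Exterior product of a list of 1-forms.\<close>

primrec wedge_list :: "tensor list \<Rightarrow> tensor" where
  "wedge_list [] = (\<lambda>_. 1)"
| "wedge_list (e # es) = wedge 1 (length es) e (wedge_list es)"

definition ext_d :: "tensor_field \<Rightarrow> tensor_field" where
  "ext_d \<alpha> x I = (\<Sum>k<length I. (-1) ^ k * pd (I ! k) (\<lambda>y. \<alpha> y (take k I @ drop (Suc k) I)) x)"


section \<open>Metric operations\<close>

text \<open>Here \<open>G\<close> is the metric at a point and \<open>v\<close> its volume form (as a 7-form), which
  encodes the orientation.\<close>

definition inv_metric :: "tensor \<Rightarrow> 7 \<Rightarrow> 7 \<Rightarrow> real" where
  "inv_metric G i j = matrix_inv (\<chi> a b. G [a, b]) $ i $ j"

text \<open>Normalised so that \<open>e\<^sub>i\<^sub>j\<^sub>k\<close> (with distinct indices) has norm one for an orthonormal coframe.\<close>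

definition form_inner :: "tensor \<Rightarrow> nat \<Rightarrow> tensor \<Rightarrow> tensor \<Rightarrow> real" where
  "form_inner G p \<alpha> \<beta> = 1 / fact p *
     (\<Sum>I | length I = p. \<Sum>K | length K = p.
        (\<Prod>k<p. inv_metric G (I ! k) (K ! k)) * \<alpha> I * \<beta> K)"

text \<open>The convention is \<open>\<alpha> \<and> *\<beta> = (\<alpha>, \<beta>) v\<close> for \<open>p\<close>-forms.\<close>

definition hodge :: "tensor \<Rightarrow> tensor \<Rightarrow> nat \<Rightarrow> tensor \<Rightarrow> tensor" where
  "hodge G v p \<alpha> J = 1 / fact p *
     (\<Sum>I | length I = p. \<Sum>K | length K = p.
        (\<Prod>k<p. inv_metric G (I ! k) (K ! k)) * \<alpha> K * v (I @ J))"


section \<open>Linear connections\<close>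

text \<open>\<open>\<Gamma> x i j l\<close> is the \<open>l\<close>-th component of the covariant derivative of the
  \<open>j\<close>-th coordinate vector field along the \<open>i\<close>-th one.\<close>

type_synonym christoffel = "real^7 \<Rightarrow> 7 \<Rightarrow> 7 \<Rightarrow> 7 \<Rightarrow> real"

definition connection_on :: "'m chart set \<Rightarrow> ('m chart \<Rightarrow> christoffel) \<Rightarrow> bool" where
  "connection_on A \<Gamma> \<longleftrightarrow>
     (\<forall>c\<in>A. \<forall>i j l. smooth_on (chart_img c) (\<lambda>x. \<Gamma> c x i j l)) \<and>
     (\<forall>c\<in>A. \<forall>d\<in>A. \<forall>x\<in>overlap c d. \<forall>i j r.
        (let \<tau> = (\<lambda>q y. transition c d y $ q) in
          (\<Sum>l\<in>UNIV. \<Gamma> c x i j l * pd l (\<tau> r) x) =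
          pd i (pd j (\<tau> r)) x +
          (\<Sum>p\<in>UNIV. \<Sum>q\<in>UNIV. \<Gamma> d (transition c d x) p q r * pd i (\<tau> p) x * pd j (\<tau> q) x)))"

definition cov_deriv :: "christoffel \<Rightarrow> tensor_field \<Rightarrow> real^7 \<Rightarrow> 7 \<Rightarrow> tensor" where
  "cov_deriv \<Gamma> S x i I = pd i (\<lambda>y. S y I) x -
     (\<Sum>k<length I. \<Sum>m\<in>UNIV. \<Gamma> x i (I ! k) m * S x (I[k := m]))"

definition parallel :: "'m chart set \<Rightarrow> ('m chart \<Rightarrow> christoffel) \<Rightarrow> nat \<Rightarrow> 'm manifold_tensor \<Rightarrow> bool" where
  "parallel A \<Gamma> p S \<longleftrightarrow>
     (\<forall>c\<in>A. \<forall>x\<in>chart_img c. \<forall>i I. length I = p \<longrightarrow> cov_deriv (\<Gamma> c) (S c) x i I = 0)"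

text \<open>\<open>T(X,Y,Z) = g(\<nabla>\<^sub>X Y - \<nabla>\<^sub>Y X - [X,Y], Z)\<close> on coordinate vector fields, which commute.\<close>

definition torsion :: "tensor_field \<Rightarrow> christoffel \<Rightarrow> tensor_field" where
  "torsion g \<Gamma> x I =
     (\<Sum>l\<in>UNIV. (\<Gamma> x (I ! 0) (I ! 1) l - \<Gamma> x (I ! 1) (I ! 0) l) * g x [l, I ! 2])"

text \<open>\<open>curvature_op \<Gamma> x i j k l\<close> is the \<open>l\<close>-th component of \<open>R(\<partial>\<^sub>i, \<partial>\<^sub>j) \<partial>\<^sub>k\<close>, where
  \<open>R(X,Y) = [\<nabla>\<^sub>X, \<nabla>\<^sub>Y] - \<nabla>\<^bsub>[X,Y]\<^esub>\<close>.\<close>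

definition curvature_op :: "christoffel \<Rightarrow> real^7 \<Rightarrow> 7 \<Rightarrow> 7 \<Rightarrow> 7 \<Rightarrow> 7 \<Rightarrow> real" where
  "curvature_op \<Gamma> x i j k l =
     pd i (\<lambda>y. \<Gamma> y j k l) x - pd j (\<lambda>y. \<Gamma> y i k l) x +
     (\<Sum>m\<in>UNIV. \<Gamma> x j k m * \<Gamma> x i m l - \<Gamma> x i k m * \<Gamma> x j m l)"

definition curvature :: "tensor_field \<Rightarrow> christoffel \<Rightarrow> real^7 \<Rightarrow> 7 \<Rightarrow> 7 \<Rightarrow> 7 \<Rightarrow> 7 \<Rightarrow> real" where
  "curvature g \<Gamma> x i j k l = (\<Sum>m\<in>UNIV. curvature_op \<Gamma> x i j k m * g x [m, l])"

text \<open>\<open>Ric(X,Y) = \<Sum>\<^sub>a R(e\<^sub>a, X, Y, e\<^sub>a)\<close> for an orthonormal frame, i.e. a metric contraction of the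
  first and the last slot.\<close>

definition ricci :: "tensor_field \<Rightarrow> christoffel \<Rightarrow> tensor_field" where
  "ricci g \<Gamma> x I = (\<Sum>a\<in>UNIV. \<Sum>b\<in>UNIV.
     inv_metric (g x) a b * curvature g \<Gamma> x a (I ! 0) (I ! 1) b)"


section \<open>\<open>G\<^sub>2\<close> structures\<close>

definition coframe_on :: "(real^7) set \<Rightarrow> (7 \<Rightarrow> tensor_field) \<Rightarrow> bool" where
  "coframe_on V e \<longleftrightarrow>
     (\<forall>a i. smooth_on V (\<lambda>x. e a x [i])) \<and> (\<forall>x\<in>V. det (\<chi> a i. e a x [i]) \<noteq> 0)"

definition std_phi :: "(7 \<Rightarrow> tensor) \<Rightarrow> tensor" where
  "std_phi e I =
     (let w = (\<lambda>i j k. wedge_list [e i, e j, e k] I) in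
        w 1 2 7 + w 1 3 5 - w 1 4 6 - w 2 3 6 - w 2 4 5 + w 3 4 7 + w 5 6 7)"

definition adapted_coframe ::
    "'m chart \<Rightarrow> 'm manifold_tensor \<Rightarrow> (real^7) set \<Rightarrow> (7 \<Rightarrow> tensor_field) \<Rightarrow> bool" where
  "adapted_coframe c \<phi> V e \<longleftrightarrow> open V \<and> V \<subseteq> chart_img c \<and> coframe_on V e \<and>
     (\<forall>x\<in>V. \<forall>I. length I = 3 \<longrightarrow> \<phi> c x I = std_phi (\<lambda>a. e a x) I)"

definition g2_structure :: "'m chart set \<Rightarrow> 'm manifold_tensor \<Rightarrow> bool" where
  "g2_structure A \<phi> \<longleftrightarrow> form_on A 3 \<phi> \<and>
     (\<forall>c\<in>A. \<forall>x\<in>chart_img c. \<exists>V e. x \<in> V \<and> adapted_coframe c \<phi> V e)"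

text \<open>\<open>g\<close> and \<open>vol\<close> are the metric and volume form for which adapted coframes are oriented
  orthonormal.  They exist and are determined by \<open>\<phi>\<close>, since the stabiliser of the standard
  3-form is contained in \<open>SO(7)\<close>.\<close>

definition induced_metric_vol ::
    "'m chart set \<Rightarrow> 'm manifold_tensor \<Rightarrow> 'm manifold_tensor \<Rightarrow> 'm manifold_tensor \<Rightarrow> bool" where
  "induced_metric_vol A \<phi> g vol \<longleftrightarrow>
     (\<forall>c\<in>A. \<forall>V e. adapted_coframe c \<phi> V e \<longrightarrow>
        (\<forall>x\<in>V. (\<forall>i j. g c x [i, j] = (\<Sum>a\<in>UNIV. e a x [i] * e a x [j])) \<and>
               (\<forall>I. length I = 7 \<longrightarrow>
                  vol c x I = wedge_list (map (\<lambda>a. e a x) [1, 2, 3, 4, 5, 6, 7]) I)))"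

definition star_phi :: "tensor_field \<Rightarrow> tensor_field \<Rightarrow> tensor_field \<Rightarrow> tensor_field" where
  "star_phi g vol \<phi> x = hodge (g x) (vol x) 3 (\<phi> x)"

definition lee_form :: "tensor_field \<Rightarrow> tensor_field \<Rightarrow> tensor_field \<Rightarrow> tensor_field" where
  "lee_form g vol \<phi> x I = - (1 / 3) *
     hodge (g x) (vol x) 6 (wedge 3 3 (hodge (g x) (vol x) 4 (ext_d \<phi> x)) (\<phi> x)) I"

definition integrable_g2 ::
    "'m chart set \<Rightarrow> 'm manifold_tensor \<Rightarrow> 'm manifold_tensor \<Rightarrow> 'm manifold_tensor \<Rightarrow> bool" where
  "integrable_g2 A \<phi> g vol \<longleftrightarrow>
     (\<forall>c\<in>A. \<forall>x\<in>chart_img c. \<forall>I. length I = 5 \<longrightarrow>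
        ext_d (star_phi (g c) (vol c) (\<phi> c)) x I =
        wedge 1 4 (lee_form (g c) (vol c) (\<phi> c) x) (star_phi (g c) (vol c) (\<phi> c) x) I)"

definition constant_type ::
    "'m chart set \<Rightarrow> 'm manifold_tensor \<Rightarrow> 'm manifold_tensor \<Rightarrow> 'm manifold_tensor \<Rightarrow> bool" where
  "constant_type A \<phi> g vol \<longleftrightarrow> integrable_g2 A \<phi> g vol \<and>
     (\<exists>\<kappa>. \<forall>c\<in>A. \<forall>x\<in>chart_img c.
        form_inner (g c x) 4 (ext_d (\<phi> c) x) (star_phi (g c) (vol c) (\<phi> c) x) = \<kappa>)"

definition characteristic_connection ::
    "'m chart set \<Rightarrow> 'm manifold_tensor \<Rightarrow> 'm manifold_tensor \<Rightarrow> ('m chart \<Rightarrow> christoffel) \<Rightarrow> bool" where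
  "characteristic_connection A \<phi> g \<Gamma> \<longleftrightarrow> connection_on A \<Gamma> \<and>
     parallel A \<Gamma> 2 g \<and> parallel A \<Gamma> 3 \<phi> \<and>
     (\<forall>c\<in>A. \<forall>x\<in>chart_img c. alternating 3 (torsion (g c) (\<Gamma> c) x))"

text \<open>\<open>R\<^sub>a\<^sub>b\<^sub>i\<^sub>j \<phi>\<^sub>a\<^sub>b\<^sub>k = 0\<close>, the contraction being taken with respect to the metric.\<close>

definition g2_instanton ::
    "'m chart set \<Rightarrow> 'm manifold_tensor \<Rightarrow> 'm manifold_tensor \<Rightarrow> ('m chart \<Rightarrow> christoffel) \<Rightarrow> bool" where
  "g2_instanton A \<phi> g \<Gamma> \<longleftrightarrow>
     (\<forall>c\<in>A. \<forall>x\<in>chart_img c. \<forall>i j k.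
        (\<Sum>a\<in>UNIV. \<Sum>b\<in>UNIV. \<Sum>p\<in>UNIV. \<Sum>q\<in>UNIV.
           inv_metric (g c x) a p * inv_metric (g c x) b q *
           curvature (g c) (\<Gamma> c) x a b i j * \<phi> c x [p, q, k]) = 0)"

definition symmetric2 :: "'m chart set \<Rightarrow> 'm manifold_tensor \<Rightarrow> bool" where
  "symmetric2 A S \<longleftrightarrow> (\<forall>c\<in>A. \<forall>x\<in>chart_img c. \<forall>i j. S c x [i, j] = S c x [j, i])"

end

theory Submission
  imports Defs
begin

text \<open>
  In an adapted frame put \<open>M\<^sub>a\<^sub>b = T\<^sub>a\<^sub>i\<^sub>j \<phi>\<^sub>b\<^sub>i\<^sub>j\<close>; the 3-form \<open>T\<close> is determined by \<open>M\<close>. Integrability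
  identifies the skew part of \<open>M\<close> with a multiple of the contraction of \<open>\<phi>\<close> with \<open>\<theta>\<close>, which is
  parallel, so it suffices to show \<open>B = \<nabla>H = 0\<close> for the symmetric part \<open>H\<^sub>a\<^sub>b = M\<^sub>a\<^sub>b + M\<^sub>b\<^sub>a\<close>.

  By the first Bianchi identity the failure of the pair symmetry of \<open>R\<close> is linear in \<open>\<nabla>T\<close>, and as
  \<open>R\<close> has both pairs of indices in \<open>g\<^sub>2\<close>, its contraction with \<open>\<phi>\<close> vanishes. This linear relation
  forces \<open>B\<close> to be totally symmetric and traceless. The Ricci identity for \<open>H\<close>, contracted with \<open>\<phi>\<close>,
  then gives \<open>H\<^sub>m\<^sub>k B\<^sub>m\<^sub>k\<^sub>l = 0\<close>, and the divergence of this equation is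
  \<open>\<bar>B\<bar>\<^sup>2 + (H, \<nabla>\<^sub>i\<nabla>\<^sub>i H) = 0\<close>. The contraction of the Ricci identity with \<open>*\<phi>\<close> shows that the second
  term is zero, hence \<open>B = 0\<close>.

  Once \<open>\<nabla>T = 0\<close>, let \<open>\<sigma>\<^sub>i\<^sub>j\<^sub>k\<^sub>l\<close> be the cyclic sum of \<open>T\<^sub>i\<^sub>j\<^sub>a T\<^sub>a\<^sub>k\<^sub>l\<close> over \<open>i, j, k\<close>. Then \<open>dT = 2\<sigma>\<close>, the
  Ricci tensor is a multiple of the contraction \<open>\<sigma>\<^sub>i\<^sub>j\<^sub>k\<^sub>l (*\<phi>)\<^sub>i\<^sub>j\<^sub>k\<^sub>p\<close>, and \<open>(d\<phi>, *\<phi>)\<close> is the trace of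
  \<open>M\<close>, so that all of them are parallel.
\<close>

section \<open>Partial derivatives and smooth functions\<close>

text \<open>The argument is pointwise; nothing is integrated over the manifold, which need not be
  compact. The norm of \<open>B\<close> appears because an algebraic identity that holds at every
  point may be differentiated. What makes this work is the choice of frame: in an adapted frame the
  metric, \<open>\<phi>\<close> and \<open>*\<phi>\<close> have constant components, so the
  connection coefficients lie in g2, every contraction with these tensors commutes with
  \<open>\<nabla>\<close>, and the geometry reduces to identities between components at one point.
  Replacing \<open>T\<close> by \<open>M\<close> takes the place of splitting the 3-forms into
  G2-irreducible parts of dimensions 1, 7 and 27: the symmetric part of \<open>M\<close> carries 1
  and 27, the skew part carries 7. Hence \<open>\<nabla>\<theta> = 0\<close> disposes of the 7, and
  the instanton condition has to control the rest. Global reasoning enters only at the end: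
  parallelism is a local condition, whereas the constancy of the type function also needs its
  independence of the chart and the connectedness of the manifold.\<close>

lemma pd_eq: "(f has_derivative D) (at x) \<Longrightarrow> pd i f x = D (axis i 1)"
  unfolding pd_def by (simp add: frechet_derivative_at[symmetric])

text \<open>\<open>pd\<close> rests on a choice among the maps satisfying
  \<open>has_derivative\<close>. The two predicates agree for every \<open>D\<close>, so equality
  holds even where no derivative exists.\<close>

lemma pd_cong_open:
  assumes "open S" "x \<in> S" "\<And>y. y \<in> S \<Longrightarrow> f y = g y"
  shows "pd i f x = pd i g x"
proof -
  have "(f has_derivative D) (at x) \<longleftrightarrow> (g has_derivative D) (at x)" for D
    using has_derivative_transform_within_open[of f D x UNIV S g]
      has_derivative_transform_within_open[of g D x UNIV S f] assms by auto
  then show ?thesis unfolding pd_def frechet_derivative_def by simp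
qed

lemma pd_const [simp]: "pd i (\<lambda>x. c) x = 0"
  using pd_eq[OF has_derivative_const] .

lemma pd_add:
  assumes "f differentiable (at x)" "g differentiable (at x)"
  shows "pd i (\<lambda>y. f y + g y) x = pd i f x + pd i g x"
  using has_derivative_add[OF assms[unfolded frechet_derivative_works]]
  by (rule pd_eq[THEN trans]) (simp add: pd_def)

lemma pd_minus:
  assumes "f differentiable (at x)"
  shows "pd i (\<lambda>y. - f y) x = - pd i f x"
  using has_derivative_minus[OF assms[unfolded frechet_derivative_works]]
  by (rule pd_eq[THEN trans]) (simp add: pd_def)

lemma pd_diff:
  assumes "f differentiable (at x)" "g differentiable (at x)"
  shows "pd i (\<lambda>y. f y - g y) x = pd i f x - pd i g x"
  using has_derivative_diff[OF assms[unfolded frechet_derivative_works]]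
  by (rule pd_eq[THEN trans]) (simp add: pd_def)

lemma pd_mult:
  assumes "f differentiable (at x)" "g differentiable (at x)"
  shows "pd i (\<lambda>y. f y * g y) x = pd i f x * g x + f x * pd i g x"
  using has_derivative_mult[OF assms[unfolded frechet_derivative_works]]
  by (rule pd_eq[THEN trans]) (simp add: pd_def)

lemma pd_sum:
  assumes "finite A" "\<And>a. a \<in> A \<Longrightarrow> f a differentiable (at x)"
  shows "pd i (\<lambda>y. \<Sum>a\<in>A. f a y) x = (\<Sum>a\<in>A. pd i (f a) x)"
proof -
  have "((\<lambda>y. \<Sum>a\<in>A. f a y) has_derivative (\<lambda>h. \<Sum>a\<in>A. frechet_derivative (f a) (at x) h)) (at x)"
    by (rule has_derivative_sum) (use assms frechet_derivative_works in blast)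
  then show ?thesis by (rule pd_eq[THEN trans]) (simp add: pd_def)
qed

lemma pd_inverse:
  assumes "f differentiable (at x)" "f x \<noteq> 0"
  shows "pd i (\<lambda>y. inverse (f y)) x = - (inverse (f x) * pd i f x * inverse (f x))"
  using Deriv.has_derivative_inverse[OF assms(2) assms(1)[unfolded frechet_derivative_works]]
  by (rule pd_eq[THEN trans]) (simp add: pd_def)

lemma differentiable_sum_fun [intro]:
  fixes f :: "'a \<Rightarrow> 'b::real_normed_vector \<Rightarrow> real"
  assumes "\<And>a. a \<in> A \<Longrightarrow> f a differentiable (at x)"
  shows "(\<lambda>y. \<Sum>a\<in>A. f a y) differentiable (at x)"
  using assms by (induction A rule: infinite_finite_induct) auto

lemma Ck_on_cong:
  assumes "open S" "\<And>y. y \<in> S \<Longrightarrow> f y = g y"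
  shows "Ck_on k S f \<longleftrightarrow> Ck_on k S g"
  using assms(2)
proof (induction k arbitrary: f g)
  case 0
  then show ?case by (simp cong: continuous_on_cong)
next
  case (Suc k)
  have "(f differentiable (at x)) = (g differentiable (at x))" if "x \<in> S" for x
    unfolding differentiable_def
    using has_derivative_transform_within_open[of f _ x UNIV S g]
      has_derivative_transform_within_open[of g _ x UNIV S f] Suc.prems that assms(1) by fastforce
  moreover have "Ck_on k S (pd i f) = Ck_on k S (pd i g)" for i
    by (rule Suc.IH) (rule pd_cong_open[OF assms(1)], auto simp: Suc.prems)
  ultimately show ?case by simp
qed

lemma Ck_on_subset: "Ck_on k S f \<Longrightarrow> S' \<subseteq> S \<Longrightarrow> Ck_on k S' f"
proof (induction k arbitrary: f)
  case 0
  then show ?case by (auto intro: continuous_on_subset)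
qed auto

lemma Ck_on_continuous: "Ck_on k S f \<Longrightarrow> continuous_on S f"
  by (cases k)
    (auto intro!: continuous_at_imp_continuous_on differentiable_imp_continuous_within)

lemma Ck_on_Suc: "Ck_on (Suc k) S f \<Longrightarrow> Ck_on k S f"
proof (induction k arbitrary: f)
  case 0
  then show ?case using Ck_on_continuous[OF 0] by simp
next
  case (Suc k)
  have "(\<forall>x\<in>S. f differentiable (at x)) \<and> (\<forall>i. Ck_on (Suc k) S (pd i f))"
    using Suc.prems unfolding Ck_on.simps(2)[of "Suc k"] .
  with Suc.IH show ?case unfolding Ck_on.simps(2)[of k] by blast
qed

lemma Ck_on_const: "Ck_on k S (\<lambda>x. c)"
proof (induction k arbitrary: c)
  case (Suc k)
  have "pd i (\<lambda>x. c) = (\<lambda>x. 0)" for i by (rule ext) simp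
  with Suc show ?case by simp
qed simp

lemma Ck_on_add:
  assumes "open S"
  shows "Ck_on k S f \<Longrightarrow> Ck_on k S g \<Longrightarrow> Ck_on k S (\<lambda>x. f x + g x)"
proof (induction k arbitrary: f g)
  case 0
  then show ?case by (simp add: continuous_on_add)
next
  case (Suc k)
  have "Ck_on k S (pd i (\<lambda>x. f x + g x))" for i
    by (subst Ck_on_cong[OF assms, where g = "\<lambda>x. pd i f x + pd i g x"])
      (use Suc in \<open>auto simp: pd_add\<close>)
  with Suc.prems show ?case by auto
qed

lemma Ck_on_mult:
  assumes "open S"
  shows "Ck_on k S f \<Longrightarrow> Ck_on k S g \<Longrightarrow> Ck_on k S (\<lambda>x. f x * g x)"
proof (induction k arbitrary: f g)
  case 0
  then show ?case by (simp add: continuous_on_mult)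
next
  case (Suc k)
  have "Ck_on k S (pd i (\<lambda>x. f x * g x))" for i
    by (subst Ck_on_cong[OF assms, where g = "\<lambda>x. pd i f x * g x + f x * pd i g x"])
      (use Suc.prems Suc.prems[THEN Ck_on_Suc] in \<open>auto simp: pd_mult intro!: Suc.IH Ck_on_add assms\<close>)
  with Suc.prems show ?case by auto
qed

lemma Ck_on_minus: "open S \<Longrightarrow> Ck_on k S f \<Longrightarrow> Ck_on k S (\<lambda>x. - f x)"
  using Ck_on_mult[OF _ Ck_on_const, of S k f "-1"] by simp

lemma Ck_on_inverse:
  assumes "open S"
  shows "Ck_on k S f \<Longrightarrow> (\<And>x. x \<in> S \<Longrightarrow> f x \<noteq> 0) \<Longrightarrow> Ck_on k S (\<lambda>x. inverse (f x))"
proof (induction k)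
  case 0
  then show ?case by (simp add: continuous_on_inverse)
next
  case (Suc k)
  have 1: "Ck_on k S (\<lambda>x. inverse (f x))" using Suc Ck_on_Suc by blast
  have "Ck_on k S (pd i (\<lambda>x. inverse (f x)))" for i
    by (subst Ck_on_cong[OF assms, where g = "\<lambda>x. - (inverse (f x) * pd i f x * inverse (f x))"])
      (use Suc.prems 1 in \<open>auto simp: pd_inverse intro!: Ck_on_mult Ck_on_minus assms\<close>)
  with Suc.prems show ?case by (auto intro!: differentiable_inverse)
qed

lemma smooth_on_cong:
  "open S \<Longrightarrow> (\<And>y. y \<in> S \<Longrightarrow> f y = g y) \<Longrightarrow> smooth_on S f \<longleftrightarrow> smooth_on S g"
  unfolding smooth_on_def using Ck_on_cong by blast

lemma smooth_on_subset: "smooth_on S f \<Longrightarrow> S' \<subseteq> S \<Longrightarrow> smooth_on S' f"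
  unfolding smooth_on_def using Ck_on_subset by blast

lemma smooth_on_const [intro]: "smooth_on S (\<lambda>x. c)"
  unfolding smooth_on_def using Ck_on_const by blast

lemma smooth_on_add:
  "open S \<Longrightarrow> smooth_on S f \<Longrightarrow> smooth_on S g \<Longrightarrow> smooth_on S (\<lambda>x. f x + g x)"
  unfolding smooth_on_def using Ck_on_add by blast

lemma smooth_on_mult:
  "open S \<Longrightarrow> smooth_on S f \<Longrightarrow> smooth_on S g \<Longrightarrow> smooth_on S (\<lambda>x. f x * g x)"
  unfolding smooth_on_def using Ck_on_mult by blast

lemma smooth_on_inverse:
  "open S \<Longrightarrow> smooth_on S f \<Longrightarrow> (\<And>x. x \<in> S \<Longrightarrow> f x \<noteq> 0) \<Longrightarrow> smooth_on S (\<lambda>x. inverse (f x))"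
  unfolding smooth_on_def using Ck_on_inverse by blast

lemma smooth_on_minus: "open S \<Longrightarrow> smooth_on S f \<Longrightarrow> smooth_on S (\<lambda>x. - f x)"
  using smooth_on_mult[of S "\<lambda>_. -1" f] by auto

lemma smooth_on_diff:
  "open S \<Longrightarrow> smooth_on S f \<Longrightarrow> smooth_on S g \<Longrightarrow> smooth_on S (\<lambda>x. f x - g x)"
  using smooth_on_add[of S f "\<lambda>x. - g x"] smooth_on_minus[of S g] by auto

lemma smooth_on_sum:
  "open S \<Longrightarrow> (\<And>a. a \<in> A \<Longrightarrow> smooth_on S (f a)) \<Longrightarrow> smooth_on S (\<lambda>x. \<Sum>a\<in>A. f a x)"
  by (induction A rule: infinite_finite_induct) (auto intro: smooth_on_add)

lemma smooth_on_prod: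
  "open S \<Longrightarrow> (\<And>a. a \<in> A \<Longrightarrow> smooth_on S (f a)) \<Longrightarrow> smooth_on S (\<lambda>x. \<Prod>a\<in>A. f a x)"
  by (induction A rule: infinite_finite_induct) (auto intro: smooth_on_mult)

lemma smooth_on_pd: "smooth_on S f \<Longrightarrow> smooth_on S (pd i f)"
  unfolding smooth_on_def using Ck_on.simps(2) by blast

lemma smooth_on_differentiable: "smooth_on S f \<Longrightarrow> x \<in> S \<Longrightarrow> f differentiable (at x)"
  unfolding smooth_on_def using Ck_on.simps(2) by blast

lemma smooth_on_continuous: "smooth_on S f \<Longrightarrow> continuous_on S f"
  unfolding smooth_on_def using Ck_on_continuous by blast

lemmas smooth_intros = smooth_on_const smooth_on_add smooth_on_mult smooth_on_minus
  smooth_on_diff smooth_on_sum smooth_on_prod smooth_on_pd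

section \<open>Symmetry of mixed partial derivatives\<close>

lemma has_real_derivative_pd:
  assumes "f differentiable (at (a + s *\<^sub>R axis i 1))"
  shows "((\<lambda>s. f (a + s *\<^sub>R axis i 1)) has_real_derivative pd i f (a + s *\<^sub>R axis i 1)) (at s)"
proof -
  let ?p = "a + s *\<^sub>R axis i (1::real)"
  let ?D = "frechet_derivative f (at ?p)"
  have D: "(f has_derivative ?D) (at ?p)" using assms frechet_derivative_works by blast
  have "((\<lambda>s. a + s *\<^sub>R axis i (1::real)) has_derivative (\<lambda>h. h *\<^sub>R axis i 1)) (at s)"
    by (auto intro!: derivative_eq_intros)
  from diff_chain_at[OF this D]
  have "((\<lambda>s. f (a + s *\<^sub>R axis i 1)) has_derivative (\<lambda>h. ?D (h *\<^sub>R axis i 1))) (at s)"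
    by (simp add: o_def)
  moreover have "?D (h *\<^sub>R axis i 1) = pd i f ?p * h" for h
    using linear_scale[OF has_derivative_linear[OF D]] by (simp add: pd_def)
  ultimately show ?thesis by (simp add: has_field_derivative_def)
qed

text \<open>The mean value theorem twice: along \<open>i\<close> for the difference of
  \<open>f\<close> between two parallel segments, then along \<open>j\<close> for
  \<open>pd i f\<close>. The left-hand side is symmetric in \<open>i\<close> and \<open>j\<close>,
  the right-hand side is not; this is what \<open>pd_commute\<close> exploits.\<close>

lemma second_difference:
  assumes S: "open S" "cball x r \<subseteq> S" "0 < h" "2 * h \<le> r"
    and f: "\<forall>y\<in>S. f differentiable (at y)" "\<forall>y\<in>S. pd i f differentiable (at y)"
  shows "\<exists>y. dist x y \<le> 2 * h \<and> f (x + h *\<^sub>R axis i 1 + h *\<^sub>R axis j 1) - f (x + h *\<^sub>R axis i 1)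
     - f (x + h *\<^sub>R axis j 1) + f x = h * h * pd j (pd i f) y"
proof -
  have near: "x + s *\<^sub>R axis i 1 + t *\<^sub>R axis j 1 \<in> S"
    "dist x (x + s *\<^sub>R axis i 1 + t *\<^sub>R axis j 1) \<le> 2 * h"
    if "0 \<le> s" "s \<le> h" "0 \<le> t" "t \<le> h" for s t
  proof -
    have "norm (s *\<^sub>R axis i (1::real) + t *\<^sub>R axis j 1 :: real^7) \<le> s + t"
      using norm_triangle_ineq[of "s *\<^sub>R axis i (1::real) :: real^7" "t *\<^sub>R axis j 1"] that by simp
    moreover have "dist x (x + u) = norm u" for u :: "real^7"
    proof -
      have "x - (x + u) = - u" by simp
      then show ?thesis unfolding dist_norm by (simp only: norm_minus_cancel)
    qed
    ultimately have "dist x (x + (s *\<^sub>R axis i 1 + t *\<^sub>R axis j 1)) \<le> s + t" by (simp only:)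
    then show le: "dist x (x + s *\<^sub>R axis i 1 + t *\<^sub>R axis j 1) \<le> 2 * h"
      using that unfolding add.assoc by linarith
    then show "x + s *\<^sub>R axis i 1 + t *\<^sub>R axis j 1 \<in> S" using S by auto
  qed
  have near0: "x + s *\<^sub>R axis i 1 \<in> S" if "0 \<le> s" "s \<le> h" for s
    using near(1)[of s 0] that S by auto
  let ?u = "\<lambda>s. f (x + s *\<^sub>R axis i 1 + h *\<^sub>R axis j 1) - f (x + s *\<^sub>R axis i 1)"
  let ?u' = "\<lambda>s. pd i f (x + s *\<^sub>R axis i 1 + h *\<^sub>R axis j 1) - pd i f (x + s *\<^sub>R axis i 1)"
  have u: "(?u has_real_derivative ?u' s) (at s)" if "0 \<le> s" "s \<le> h" for s
  proof (rule DERIV_diff)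
    have e: "x + s *\<^sub>R axis i 1 + h *\<^sub>R axis j 1 = (x + h *\<^sub>R axis j 1) + s *\<^sub>R axis i 1" for s
      by simp
    show "((\<lambda>s. f (x + s *\<^sub>R axis i 1 + h *\<^sub>R axis j 1)) has_real_derivative
        pd i f (x + s *\<^sub>R axis i 1 + h *\<^sub>R axis j 1)) (at s)"
      unfolding e by (rule has_real_derivative_pd) (use near(1)[of s h] that S f in \<open>auto simp: e\<close>)
    show "((\<lambda>s. f (x + s *\<^sub>R axis i 1)) has_real_derivative pd i f (x + s *\<^sub>R axis i 1)) (at s)"
      by (rule has_real_derivative_pd) (use near0 that f in auto)
  qed
  from MVT2[OF S(3) u] obtain s where s: "0 < s" "s < h" "?u h - ?u 0 = (h - 0) * ?u' s" by metis
  let ?p = "x + s *\<^sub>R axis i 1"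
  have v: "((\<lambda>t. pd i f (?p + t *\<^sub>R axis j 1)) has_real_derivative pd j (pd i f) (?p + t *\<^sub>R axis j 1)) (at t)"
    if "0 \<le> t" "t \<le> h" for t
    by (rule has_real_derivative_pd) (use near(1)[of s t] that s f in auto)
  from MVT2[OF S(3) v] obtain t where t: "0 < t" "t < h"
    "pd i f (?p + h *\<^sub>R axis j 1) - pd i f (?p + 0 *\<^sub>R axis j 1) = (h - 0) * pd j (pd i f) (?p + t *\<^sub>R axis j 1)"
    by metis
  show ?thesis
    by (rule exI[of _ "?p + t *\<^sub>R axis j 1"]) (use s t near(2)[of s t] in auto)
qed

lemma pd_commute:
  assumes S: "open S" "x \<in> S" and f: "smooth_on S f"
  shows "pd i (pd j f) x = pd j (pd i f) x"
proof (rule ccontr)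
  let ?a = "pd i (pd j f)" and ?b = "pd j (pd i f)"
  assume ne: "?a x \<noteq> ?b x"
  define e where "e = \<bar>?a x - ?b x\<bar> / 2"
  have e: "e > 0" using ne by (simp add: e_def)
  have c: "continuous (at x) ?a" "continuous (at x) ?b"
    using smooth_on_differentiable[OF smooth_on_pd[OF smooth_on_pd[OF f]] S(2)]
      differentiable_imp_continuous_within by blast+
  obtain d1 d2 where d: "d1 > 0" "\<And>y. dist y x < d1 \<Longrightarrow> dist (?a y) (?a x) < e"
    "d2 > 0" "\<And>y. dist y x < d2 \<Longrightarrow> dist (?b y) (?b x) < e"
    using c e unfolding continuous_at_eps_delta dist_norm by metis
  obtain r where r: "r > 0" "cball x r \<subseteq> S" using S open_contains_cball by blast
  define h where "h = min r (min d1 d2) / 3"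
  have h: "0 < h" "2 * h \<le> r" "2 * h < d1" "2 * h < d2" using r d by (auto simp: h_def)
  have df: "\<forall>y\<in>S. f differentiable (at y)" "\<forall>y\<in>S. pd k f differentiable (at y)" for k
    using smooth_on_differentiable smooth_on_pd f by blast+
  obtain y where y: "dist x y \<le> 2 * h" "f (x + h *\<^sub>R axis j 1 + h *\<^sub>R axis i 1) - f (x + h *\<^sub>R axis j 1)
     - f (x + h *\<^sub>R axis i 1) + f x = h * h * ?a y"
    using second_difference[OF S(1) r(2) h(1,2) df(1) df(2)] by blast
  obtain z where z: "dist x z \<le> 2 * h" "f (x + h *\<^sub>R axis i 1 + h *\<^sub>R axis j 1) - f (x + h *\<^sub>R axis i 1)
     - f (x + h *\<^sub>R axis j 1) + f x = h * h * ?b z"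
    using second_difference[OF S(1) r(2) h(1,2) df(1) df(2)] by blast
  \<comment> \<open>The second difference is the same for both orders, so the two mixed derivatives
    agree at intermediate points, although \<open>y\<close> and \<open>z\<close> differ. Continuity
    at \<open>x\<close> does the rest.\<close>
  have "h * h * ?a y = h * h * ?b z" using y(2) z(2) by (simp add: algebra_simps)
  then have "?a y = ?b z" using h by simp
  moreover have "dist (?a y) (?a x) < e" "dist (?b z) (?b x) < e"
    using d(2)[of y] d(4)[of z] y(1) z(1) h by (simp_all add: dist_commute)
  ultimately show False unfolding e_def dist_real_def by argo
qed

section \<open>Components with respect to a frame\<close>

text \<open>\<open>frl E S\<close> lists the components of \<open>S\<close> with respect to the vectors with components \<open>E a\<close>, and
  \<open>derl m\<close> is the action of the endomorphism \<open>m\<close> as a derivation, so that \<open>\<nabla>\<^sub>i = \<partial>\<^sub>i - derl (\<Gamma> i)\<close>.\<close>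

primrec frl :: "(7 \<Rightarrow> 7 \<Rightarrow> real) \<Rightarrow> tensor \<Rightarrow> tensor" where
  "frl E S [] = S []"
| "frl E S (a # J) = (\<Sum>i\<in>UNIV. E a i * frl E (\<lambda>I. S (i # I)) J)"

primrec derl :: "(7 \<Rightarrow> 7 \<Rightarrow> real) \<Rightarrow> tensor \<Rightarrow> tensor" where
  "derl m S [] = 0"
| "derl m S (k # I) = (\<Sum>l\<in>UNIV. m k l * S (l # I)) + derl m (\<lambda>I. S (k # I)) I"

lemma sum_length_Suc:
  fixes f :: "7 list \<Rightarrow> 'a::comm_monoid_add"
  shows "(\<Sum>I | length I = Suc p. f I) = (\<Sum>i\<in>UNIV. \<Sum>I | length I = p. f (i # I))"
proof -
  have "(\<Sum>I | length I = Suc p. f I) = (\<Sum>(i, I)\<in>UNIV \<times> {I. length I = p}. f (i # I))"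
    by (rule sum.reindex_bij_witness[where j = "\<lambda>I. (hd I, tl I)" and i = "\<lambda>(i, I). i # I"])
      (auto simp: length_Suc_conv)
  then show ?thesis by (simp add: sum.cartesian_product)
qed

lemma sum_length_0: "(\<Sum>I | length I = 0. f I) = f []"
proof -
  have "{I. length I = 0} = {[]}" by auto
  then show ?thesis by simp
qed

lemma sum_mult_assoc:
  fixes f :: "'a \<Rightarrow> real"
  shows "(\<Sum>b\<in>B. f b * (\<Sum>i\<in>A. g b i * s i)) = (\<Sum>i\<in>A. (\<Sum>b\<in>B. f b * g b i) * s i)"
  by (simp add: sum_distrib_left sum_distrib_right mult.assoc) (rule sum.swap)

lemma frl_cong:
  "(\<And>I. length I = length J \<Longrightarrow> S I = S' I) \<Longrightarrow> frl E S J = frl E S' J"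
proof (induction J arbitrary: S S')
  case (Cons a J)
  have "frl E (\<lambda>I. S (i # I)) J = frl E (\<lambda>I. S' (i # I)) J" for i
    by (rule Cons.IH) (simp add: Cons.prems)
  then show ?case by simp
qed simp

lemma frl_add: "frl E (\<lambda>I. S I + S' I) J = frl E S J + frl E S' J"
  by (induction J arbitrary: S S') (auto simp: sum.distrib distrib_left)

lemma frl_cmult: "frl E (\<lambda>I. c * S I) J = c * frl E S J"
  by (induction J arbitrary: S) (auto simp: sum_distrib_left algebra_simps)

lemma frl_0: "frl E (\<lambda>I. 0) J = 0"
  using frl_cmult[of E 0 "\<lambda>_. 0" J] by simp

lemma frl_diff: "frl E (\<lambda>I. S I - S' I) J = frl E S J - frl E S' J"
  using frl_add[of E S "\<lambda>I. -1 * S' I" J] unfolding frl_cmult by simp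

lemma frl_sum: "frl E (\<lambda>I. \<Sum>a\<in>A. S a I) J = (\<Sum>a\<in>A. frl E (S a) J)"
  by (induction A rule: infinite_finite_induct) (auto simp: frl_add frl_0)

lemma frl_frl: "frl E (frl F S) J = frl (\<lambda>a i. \<Sum>b\<in>UNIV. E a b * F b i) S J"
proof (induction J arbitrary: S)
  case (Cons a J)
  have "frl E (frl F S) (a # J) = (\<Sum>b\<in>UNIV. \<Sum>i\<in>UNIV. E a b * (F b i * frl E (frl F (\<lambda>I. S (i # I))) J))"
    by (simp add: frl_sum frl_cmult sum_distrib_left)
  also have "\<dots> = (\<Sum>i\<in>UNIV. \<Sum>b\<in>UNIV. E a b * (F b i * frl E (frl F (\<lambda>I. S (i # I))) J))"
    by (rule sum.swap)
  finally show ?case by (simp add: Cons sum_distrib_right mult.assoc)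
qed simp

lemma frl_id: "frl (\<lambda>a i. if a = i then 1 else 0) S J = S J"
  by (induction J arbitrary: S) (auto simp: if_distrib[of "\<lambda>x. x * _"] cong: if_cong)

lemma frl_inverse:
  assumes "\<And>i j. (\<Sum>a\<in>UNIV. F i a * E a j) = (if i = j then 1 else 0)"
  shows "frl F (frl E S) I = S I"
  unfolding frl_frl assms frl_id ..

text \<open>Bridge from the multi-index sums of products in the definitions (transformation law,
  Hodge star, scalar product) to the recursive \<open>frl\<close>, which allows induction over the
  slots.\<close>

lemma sum_prod_frl:
  "length J = p \<Longrightarrow> (\<Sum>I | length I = p. (\<Prod>k<p. M (J ! k) (I ! k)) * S I) = frl M S J"
proof (induction J arbitrary: S p)
  case Nil
  then show ?case by (auto simp: sum_length_0[simplified])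
next
  case (Cons a J)
  then obtain q where q: "p = Suc q" "length J = q" by auto
  show ?case
    unfolding q(1) sum_length_Suc prod.lessThan_Suc_shift
    using Cons.IH[OF q(2)] by (simp add: mult.assoc flip: sum_distrib_left)
qed

lemma derl_add: "derl m (\<lambda>I. S I + S' I) J = derl m S J + derl m S' J"
  by (induction J arbitrary: S S') (auto simp: sum.distrib distrib_left)

lemma derl_cmult: "derl m (\<lambda>I. c * S I) J = c * derl m S J"
  by (induction J arbitrary: S) (auto simp: sum_distrib_left algebra_simps)

lemma derl_0: "derl m (\<lambda>I. 0) J = 0"
  using derl_cmult[of m 0 "\<lambda>_. 0" J] by simp

lemma derl_diff: "derl m (\<lambda>I. S I - S' I) J = derl m S J - derl m S' J"
  using derl_add[of m S "\<lambda>I. -1 * S' I" J] unfolding derl_cmult by simp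

lemma derl_sum: "derl m (\<lambda>I. \<Sum>a\<in>A. S a I) J = (\<Sum>a\<in>A. derl m (S a) J)"
  by (induction A rule: infinite_finite_induct) (auto simp: derl_add derl_0)

lemma derl_cong:
  "(\<And>I. length I = length J \<Longrightarrow> S I = S' I) \<Longrightarrow> derl m S J = derl m S' J"
proof (induction J arbitrary: S S')
  case (Cons a J)
  have "derl m (\<lambda>I. S (a # I)) J = derl m (\<lambda>I. S' (a # I)) J"
    by (rule Cons.IH) (simp add: Cons.prems)
  with Cons.prems show ?case by simp
qed simp

lemma derl_eq_sum:
  "derl m S I = (\<Sum>k<length I. \<Sum>l\<in>UNIV. m (I ! k) l * S (I[k := l]))"
proof (induction I arbitrary: S)
  case (Cons a I)
  then show ?case by (simp add: sum.lessThan_Suc_shift del: sum.lessThan_Suc)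
qed simp

text \<open>The hypothesis says that \<open>n\<close> and \<open>m\<close> are one endomorphism,
  written in the frame and in coordinates. It is used for the curvature operator in
  \<open>Rf_derl\<close>.\<close>

lemma derl_frl:
  assumes "\<And>a i. (\<Sum>b\<in>UNIV. n a b * E b i) = (\<Sum>j\<in>UNIV. E a j * m j i)"
  shows "derl n (frl E S) J = frl E (derl m S) J"
proof (induction J arbitrary: S)
  case (Cons a J)
  have "(\<Sum>b\<in>UNIV. n a b * (\<Sum>i\<in>UNIV. E b i * frl E (\<lambda>I. S (i # I)) J))
      = (\<Sum>i\<in>UNIV. (\<Sum>b\<in>UNIV. n a b * E b i) * frl E (\<lambda>I. S (i # I)) J)"
    by (rule sum_mult_assoc)
  also have "\<dots> = (\<Sum>i\<in>UNIV. (\<Sum>j\<in>UNIV. E a j * m j i) * frl E (\<lambda>I. S (i # I)) J)"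
    by (simp add: assms)
  also have "\<dots> = (\<Sum>j\<in>UNIV. E a j * (\<Sum>i\<in>UNIV. m j i * frl E (\<lambda>I. S (i # I)) J))"
    by (rule sum_mult_assoc[symmetric])
  finally show ?case
    by (simp add: derl_sum derl_cmult Cons frl_add frl_sum frl_cmult distrib_left sum.distrib)
qed (simp)

lemma cov_deriv_derl:
  "cov_deriv \<Gamma> S x i I = pd i (\<lambda>y. S y I) x - derl (\<Gamma> x i) (S x) I"
  unfolding cov_deriv_def derl_eq_sum ..

text \<open>With the first slot read as a parameter, what remains is a family of tensors of lower
  rank. The inductions over index lists peel off one slot at a time in this way.\<close>

lemma cov_deriv_Cons:
  "cov_deriv \<Gamma> S x i (k # I) =
     cov_deriv \<Gamma> (\<lambda>y I. S y (k # I)) x i I - (\<Sum>m\<in>UNIV. \<Gamma> x i k m * S x (m # I))"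
  unfolding cov_deriv_derl by simp

lemma cov_deriv_diff:
  assumes "(\<lambda>y. S y I) differentiable (at x)" "(\<lambda>y. S' y I) differentiable (at x)"
  shows "cov_deriv \<Gamma> (\<lambda>y I. S y I - S' y I) x i I = cov_deriv \<Gamma> S x i I - cov_deriv \<Gamma> S' x i I"
  using assms unfolding cov_deriv_derl by (simp add: pd_diff derl_diff)

lemma cov_deriv_sum_mult:
  fixes f :: "7 \<Rightarrow> real^7 \<Rightarrow> real"
  assumes "\<And>m. (\<lambda>y. S m y I) differentiable (at x)" "\<And>m. f m differentiable (at x)"
  shows "cov_deriv \<Gamma> (\<lambda>y I. \<Sum>m\<in>UNIV. f m y * S m y I) x i I =
    (\<Sum>m\<in>UNIV. pd i (f m) x * S m x I + f m x * cov_deriv \<Gamma> (S m) x i I)"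
proof -
  have "pd i (\<lambda>y. \<Sum>m\<in>UNIV. f m y * S m y I) x =
    (\<Sum>m\<in>UNIV. pd i (f m) x * S m x I + f m x * pd i (\<lambda>y. S m y I) x)"
    by (subst pd_sum[OF finite]) (use assms in \<open>auto simp: pd_mult differentiable_mult\<close>)
  then show ?thesis
    unfolding cov_deriv_derl by (simp add: derl_sum derl_cmult algebra_simps sum.distrib sum_subtractf)
qed

lemma smooth_frl:
  assumes "open U" "\<And>a i. smooth_on U (\<lambda>y. E y a i)"
    "\<And>I. length I = length J \<Longrightarrow> smooth_on U (\<lambda>y. S y I)"
  shows "smooth_on U (\<lambda>y. frl (E y) (S y) J)"
  using assms(3)
proof (induction J arbitrary: S)
  case (Cons a J)
  then show ?case by (auto intro!: smooth_intros assms Cons.IH)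
qed simp

lemma smooth_derl:
  assumes "open U" "\<And>a i. smooth_on U (\<lambda>y. m y a i)"
    "\<And>I. length I = length J \<Longrightarrow> smooth_on U (\<lambda>y. S y I)"
  shows "smooth_on U (\<lambda>y. derl (m y) (S y) J)"
  using assms(3)
proof (induction J arbitrary: S)
  case (Cons a J)
  then show ?case by (auto intro!: smooth_intros assms Cons.IH)
qed auto

lemma smooth_cov_deriv:
  assumes "open U" "\<And>i j k. smooth_on U (\<lambda>y. \<Gamma> y i j k)"
    "\<And>J. length J = length I \<Longrightarrow> smooth_on U (\<lambda>y. S y J)"
  shows "smooth_on U (\<lambda>y. cov_deriv \<Gamma> S y i I)"
  unfolding cov_deriv_derl
  by (intro smooth_on_diff smooth_on_pd smooth_derl assms refl)

lemma frl_differentiable: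
  assumes "\<And>a i. (\<lambda>y. E y a i) differentiable (at x)"
    "\<And>I. length I = length J \<Longrightarrow> (\<lambda>y. S y I) differentiable (at x)"
  shows "(\<lambda>y. frl (E y) (S y) J) differentiable (at x)"
  using assms(2)
proof (induction J arbitrary: S)
  case (Cons a J)
  then show ?case by (auto intro!: assms Cons.IH differentiable_mult)
qed simp

text \<open>Hypothesis \<open>W\<close> says that the derivative of the frame vector
  \<open>E a\<close> along \<open>i\<close> is the combination of the \<open>E b\<close> with
  coefficients \<open>W x i a b\<close>; that is, \<open>W\<close> is the connection form in the
  frame.\<close>

lemma cov_deriv_frl:
  assumes E: "\<And>a i. (\<lambda>y. E y a i) differentiable (at x)"
    and S: "\<And>I. length I = length J \<Longrightarrow> (\<lambda>y. S y I) differentiable (at x)"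
    and W: "\<And>a j. (\<Sum>b\<in>UNIV. W x i a b * E x b j) =
       pd i (\<lambda>y. E y a j) x + (\<Sum>k\<in>UNIV. E x a k * \<Gamma> x i k j)"
  shows "cov_deriv W (\<lambda>y. frl (E y) (S y)) x i J = frl (E x) (cov_deriv \<Gamma> S x i) J"
  using S
proof (induction J arbitrary: S)
  case (Cons a J)
  let ?S = "\<lambda>k y I. S y (k # I)"
  let ?f = "\<lambda>k. frl (E x) (?S k x) J"
  have d: "(\<lambda>y. ?S k y I) differentiable (at x)" if "length I = length J" for k I
    using Cons.prems that by simp
  have "cov_deriv W (\<lambda>y I. frl (E y) (S y) (a # I)) x i J =
     (\<Sum>j\<in>UNIV. pd i (\<lambda>y. E y a j) x * ?f j + E x a j * cov_deriv W (\<lambda>y. frl (E y) (?S j y)) x i J)"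
    unfolding frl.simps by (rule cov_deriv_sum_mult) (auto intro!: frl_differentiable E d)
  also have "\<dots> = (\<Sum>j\<in>UNIV. pd i (\<lambda>y. E y a j) x * ?f j + E x a j * frl (E x) (cov_deriv \<Gamma> (?S j) x i) J)"
    using Cons.IH[OF d] by simp
  finally have 1: "cov_deriv W (\<lambda>y I. frl (E y) (S y) (a # I)) x i J =
     (\<Sum>j\<in>UNIV. pd i (\<lambda>y. E y a j) x * ?f j) + (\<Sum>j\<in>UNIV. E x a j * frl (E x) (cov_deriv \<Gamma> (?S j) x i) J)"
    by (simp add: sum.distrib)
  have "(\<Sum>b\<in>UNIV. W x i a b * (\<Sum>j\<in>UNIV. E x b j * ?f j)) = (\<Sum>j\<in>UNIV. (\<Sum>b\<in>UNIV. W x i a b * E x b j) * ?f j)"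
    by (rule sum_mult_assoc)
  also have "\<dots> = (\<Sum>j\<in>UNIV. pd i (\<lambda>y. E y a j) x * ?f j) + (\<Sum>j\<in>UNIV. \<Sum>k\<in>UNIV. E x a k * \<Gamma> x i k j * ?f j)"
    unfolding W by (simp add: sum.distrib distrib_right sum_distrib_right)
  also have "(\<Sum>j\<in>UNIV. \<Sum>k\<in>UNIV. E x a k * \<Gamma> x i k j * ?f j) = (\<Sum>k\<in>UNIV. E x a k * (\<Sum>j\<in>UNIV. \<Gamma> x i k j * ?f j))"
    by (subst sum.swap) (simp add: sum_distrib_left mult.assoc)
  finally have 2: "(\<Sum>b\<in>UNIV. W x i a b * (\<Sum>j\<in>UNIV. E x b j * ?f j)) =
    (\<Sum>j\<in>UNIV. pd i (\<lambda>y. E y a j) x * ?f j) + (\<Sum>k\<in>UNIV. E x a k * (\<Sum>j\<in>UNIV. \<Gamma> x i k j * ?f j))" .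
  show ?case
    unfolding cov_deriv_Cons[of W] 1 unfolding frl.simps 2 cov_deriv_Cons
    by (simp add: frl_diff frl_sum frl_cmult right_diff_distrib sum_subtractf)
qed (simp add: cov_deriv_derl)

text \<open>The directions \<open>i\<close> and \<open>j\<close> are fixed coordinate fields and not
  tensor slots. These fields commute, so no torsion term appears; it arises in
  \<open>frame_commutator\<close>, where the direction becomes a slot.\<close>

lemma Ricci_identity:
  assumes U: "open U" "x \<in> U" and G: "\<And>i j k. smooth_on U (\<lambda>y. \<Gamma> y i j k)"
    and S: "\<And>J. length J = length I \<Longrightarrow> smooth_on U (\<lambda>y. S y J)"
  shows "cov_deriv \<Gamma> (\<lambda>y. cov_deriv \<Gamma> S y j) x i I - cov_deriv \<Gamma> (\<lambda>y. cov_deriv \<Gamma> S y i) x j I =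
    - derl (curvature_op \<Gamma> x i j) (S x) I"
  using S
proof (induction I arbitrary: S)
  case Nil
  have "smooth_on U (\<lambda>y. S y [])" using Nil by simp
  from pd_commute[OF U this, of i j] show ?case by (simp add: cov_deriv_derl)
next
  case (Cons k I)
  let ?S = "\<lambda>k y I. S y (k # I)"
  have d: "smooth_on U (\<lambda>y. ?S k y J)" if "length J = length I" for k J
    using Cons.prems that by simp
  have dG: "(\<lambda>y. \<Gamma> y i j k) differentiable (at x)" for i j k
    using smooth_on_differentiable[OF G U(2)] .
  have dS: "(\<lambda>y. ?S m y I) differentiable (at x)" for m
    using smooth_on_differentiable[OF d U(2)] by simp
  have dC: "(\<lambda>y. cov_deriv \<Gamma> (?S k) y j I) differentiable (at x)" for k j
    using smooth_on_differentiable[OF smooth_cov_deriv[OF U(1) G d] U(2)] by simp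
  have *: "cov_deriv \<Gamma> (\<lambda>y. cov_deriv \<Gamma> S y j) x i (k # I) =
     cov_deriv \<Gamma> (\<lambda>y. cov_deriv \<Gamma> (?S k) y j) x i I
     - (\<Sum>m\<in>UNIV. pd i (\<lambda>y. \<Gamma> y j k m) x * S x (m # I) + \<Gamma> x j k m * cov_deriv \<Gamma> (?S m) x i I)
     - (\<Sum>m\<in>UNIV. \<Gamma> x i k m * (cov_deriv \<Gamma> (?S m) x j I - (\<Sum>n\<in>UNIV. \<Gamma> x j m n * S x (n # I))))" for i j
    unfolding cov_deriv_Cons[of \<Gamma> "\<lambda>y. cov_deriv \<Gamma> S y j"] cov_deriv_Cons[of \<Gamma> S]
    by (subst cov_deriv_diff) (auto intro!: differentiable_mult dC dG dS cov_deriv_sum_mult)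
  have **: "(\<Sum>m\<in>UNIV. \<Gamma> x i k m * (\<Sum>n\<in>UNIV. \<Gamma> x j m n * S x (n # I))) =
     (\<Sum>n\<in>UNIV. (\<Sum>m\<in>UNIV. \<Gamma> x i k m * \<Gamma> x j m n) * S x (n # I))" for i j
    by (rule sum_mult_assoc)
  have "curvature_op \<Gamma> x i j k l = pd i (\<lambda>y. \<Gamma> y j k l) x - pd j (\<lambda>y. \<Gamma> y i k l) x +
     ((\<Sum>m\<in>UNIV. \<Gamma> x j k m * \<Gamma> x i m l) - (\<Sum>m\<in>UNIV. \<Gamma> x i k m * \<Gamma> x j m l))" for l
    unfolding curvature_op_def by (simp add: sum_subtractf)
  then show ?case
    unfolding * derl.simps using Cons.IH[of "?S k", OF d]
    by (simp add: right_diff_distrib left_diff_distrib distrib_right sum.distrib sum_subtractf **)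
qed

section \<open>Algebra of the standard 3-form\<close>

abbreviation sum7 :: "(7 \<Rightarrow> real) \<Rightarrow> real" (binder "\<Sum>\<^sub>7" 10) where
  "sum7 f \<equiv> sum f UNIV"

lemma exhaust_7: "(x::7) = 1 \<or> x = 2 \<or> x = 3 \<or> x = 4 \<or> x = 5 \<or> x = 6 \<or> x = 7"
proof (induct x)
  case (of_int z)
  hence "z = 0 | z = 1 | z = 2 | z = 3 | z = 4 | z = 5 | z = 6" by fastforce
  thus ?case by auto
qed

lemma UNIV_7: "(UNIV :: 7 set) = {1, 2, 3, 4, 5, 6, 7}"
  using exhaust_7 by auto

lemma forall_7: "(\<forall>i::7. P i) \<longleftrightarrow> P 1 \<and> P 2 \<and> P 3 \<and> P 4 \<and> P 5 \<and> P 6 \<and> P 7"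
  by (metis exhaust_7)

lemma sum_7: "sum f (UNIV :: 7 set) = f 1 + (f 2 + (f 3 + (f 4 + (f 5 + (f 6 + f 7)))))"
  unfolding UNIV_7 by simp

definition kd :: "7 \<Rightarrow> 7 \<Rightarrow> real" where
  "kd i j = (if i = j then 1 else 0)"

definition wedge3 :: "7 \<Rightarrow> 7 \<Rightarrow> 7 \<Rightarrow> 7 \<Rightarrow> 7 \<Rightarrow> 7 \<Rightarrow> real" where
  "wedge3 a b c i j k = kd a i * (kd b j * kd c k - kd b k * kd c j)
     - kd a j * (kd b i * kd c k - kd b k * kd c i) + kd a k * (kd b i * kd c j - kd b j * kd c i)"

definition ph :: "7 \<Rightarrow> 7 \<Rightarrow> 7 \<Rightarrow> real" where
  "ph i j k = wedge3 1 2 7 i j k + wedge3 1 3 5 i j k - wedge3 1 4 6 i j k - wedge3 2 3 6 i j k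
     - wedge3 2 4 5 i j k + wedge3 3 4 7 i j k + wedge3 5 6 7 i j k"

text \<open>The components of \<open>*\<phi>\<close> in an adapted frame, see \<open>star_ph\<close>. With the contraction identity as the
  definition, only its skew symmetry has to be computed from the table of \<open>\<phi>\<close>.\<close>

definition ps :: "7 \<Rightarrow> 7 \<Rightarrow> 7 \<Rightarrow> 7 \<Rightarrow> real" where
  "ps i j k l = (\<Sum>\<^sub>7p. ph p i j * ph p k l) - kd i k * kd j l + kd i l * kd j k"

lemma kd_simps [simp]:
  "kd 1 1 = 1" "kd 1 2 = 0" "kd 1 3 = 0" "kd 1 4 = 0" "kd 1 5 = 0" "kd 1 6 = 0" "kd 1 7 = 0"
  "kd 2 1 = 0" "kd 2 2 = 1" "kd 2 3 = 0" "kd 2 4 = 0" "kd 2 5 = 0" "kd 2 6 = 0" "kd 2 7 = 0"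
  "kd 3 1 = 0" "kd 3 2 = 0" "kd 3 3 = 1" "kd 3 4 = 0" "kd 3 5 = 0" "kd 3 6 = 0" "kd 3 7 = 0"
  "kd 4 1 = 0" "kd 4 2 = 0" "kd 4 3 = 0" "kd 4 4 = 1" "kd 4 5 = 0" "kd 4 6 = 0" "kd 4 7 = 0"
  "kd 5 1 = 0" "kd 5 2 = 0" "kd 5 3 = 0" "kd 5 4 = 0" "kd 5 5 = 1" "kd 5 6 = 0" "kd 5 7 = 0"
  "kd 6 1 = 0" "kd 6 2 = 0" "kd 6 3 = 0" "kd 6 4 = 0" "kd 6 5 = 0" "kd 6 6 = 1" "kd 6 7 = 0"
  "kd 7 1 = 0" "kd 7 2 = 0" "kd 7 3 = 0" "kd 7 4 = 0" "kd 7 5 = 0" "kd 7 6 = 0" "kd 7 7 = 1"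
  by (simp_all add: kd_def)

lemma ph_skew12: "ph j i k = - ph i j k"
  by (simp add: ph_def wedge3_def algebra_simps)

lemma ph_skew23: "ph i k j = - ph i j k"
  by (simp add: ph_def wedge3_def algebra_simps)

lemma ph_row:
  "ph 1 i j = kd 2 i * kd 7 j - kd 2 j * kd 7 i + (kd 3 i * kd 5 j - kd 3 j * kd 5 i) - (kd 4 i * kd 6 j - kd 4 j * kd 6 i)"
  "ph 2 i j = - (kd 1 i * kd 7 j - kd 1 j * kd 7 i) - (kd 3 i * kd 6 j - kd 3 j * kd 6 i) - (kd 4 i * kd 5 j - kd 4 j * kd 5 i)"
  "ph 3 i j = - (kd 1 i * kd 5 j - kd 1 j * kd 5 i) + (kd 2 i * kd 6 j - kd 2 j * kd 6 i) + (kd 4 i * kd 7 j - kd 4 j * kd 7 i)"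
  "ph 4 i j = kd 1 i * kd 6 j - kd 1 j * kd 6 i + (kd 2 i * kd 5 j - kd 2 j * kd 5 i) - (kd 3 i * kd 7 j - kd 3 j * kd 7 i)"
  "ph 5 i j = kd 1 i * kd 3 j - kd 1 j * kd 3 i - (kd 2 i * kd 4 j - kd 2 j * kd 4 i) + (kd 6 i * kd 7 j - kd 6 j * kd 7 i)"
  "ph 6 i j = - (kd 1 i * kd 4 j - kd 1 j * kd 4 i) - (kd 2 i * kd 3 j - kd 2 j * kd 3 i) - (kd 5 i * kd 7 j - kd 5 j * kd 7 i)"
  "ph 7 i j = kd 1 i * kd 2 j - kd 1 j * kd 2 i + (kd 3 i * kd 4 j - kd 3 j * kd 4 i) + (kd 5 i * kd 6 j - kd 5 j * kd 6 i)"
  by (simp_all add: ph_def wedge3_def)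

text \<open>Makes the Kronecker deltas in \<open>ps\<close> polynomials in the same unknowns
  \<open>kd p i\<close> in which \<open>ph_row\<close> expresses \<open>ph\<close>. Symmetries of
  \<open>ps\<close> then become polynomial identities with generic \<open>i\<close>,
  \<open>j\<close>, \<open>k\<close>, \<open>l\<close>, without a case split over their
  values.\<close>

lemma kd_sum: "kd i j = (\<Sum>\<^sub>7p. kd p i * kd p j)"
  by (simp add: kd_def if_distrib[of "\<lambda>x. x * _"] cong: if_cong)

lemma ps_skew12: "ps j i k l = - ps i j k l"
  unfolding ps_def by (subst ph_skew23) (simp add: sum_negf)

lemma ps_skew34: "ps i j l k = - ps i j k l"
  unfolding ps_def by (subst ph_skew23) (simp add: sum_negf)

lemma ps_pair: "ps k l i j = ps i j k l"
  unfolding ps_def by (simp add: kd_def mult.commute)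

lemma ps_skew23: "ps i k j l = - ps i j k l"
  unfolding ps_def kd_sum[of i] kd_sum[of k l] kd_sum[of j l] kd_sum[of j k] kd_sum[of k j]  sum_7 ph_row by algebra

lemma sum7_kd [simp]:
  "(\<Sum>\<^sub>7j. kd i j * f j) = f i" "(\<Sum>\<^sub>7j. kd j i * f j) = f i"
  "(\<Sum>\<^sub>7j. f j * kd i j) = f i" "(\<Sum>\<^sub>7j. f j * kd j i) = f i"
  by (simp_all add: kd_def if_distrib[of "\<lambda>x. x * _"] if_distrib[of "\<lambda>x. _ * x"] cong: if_cong)

lemma kd_same [simp]: "kd i i = 1" by (simp add: kd_def)

lemma kd_commute: "kd i j = kd j i" by (simp add: kd_def)

lemma sum7_kd2: "(\<Sum>\<^sub>7i j. X i j * (kd i k * kd j l)) = X k l"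
  by (simp flip: mult.assoc)

lemma sum7_into:
  "(\<Sum>\<^sub>7a. (\<Sum>\<^sub>7i j. X i j * f a i j) * g a) = (\<Sum>\<^sub>7i j. X i j * (\<Sum>\<^sub>7a. f a i j * g a))"
  unfolding sum_distrib_left sum_distrib_right mult.assoc
  by (subst sum.swap, rule sum.cong, rule refl, rule sum.swap)

lemma sum7_assoc:
  "(\<Sum>\<^sub>7b. f b * (\<Sum>\<^sub>7i. g b i * s i)) = (\<Sum>\<^sub>7i. (\<Sum>\<^sub>7b. f b * g b i) * s i)"
  unfolding sum_distrib_left sum_distrib_right mult.assoc by (rule sum.swap)

lemma sum7_skew:
  assumes "\<And>i j. s j i = s i j" "\<And>i j. a j i = - a i j"
  shows "(\<Sum>\<^sub>7i j. s i j * a i j) = 0"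
proof -
  have "(\<Sum>\<^sub>7i j. s i j * a i j) = (\<Sum>\<^sub>7i j. s j i * a j i)" by (rule sum.swap)
  also have "\<dots> = (\<Sum>\<^sub>7i j. - (s i j * a i j))"
    by (rule sum.cong[OF refl], rule sum.cong[OF refl]) (metis assms mult_minus_right)
  also have "\<dots> = - (\<Sum>\<^sub>7i j. s i j * a i j)" by (simp only: sum_negf)
  finally show ?thesis by simp
qed

lemma sum7_skew':
  assumes "\<And>i j. s j i = s i j" "\<And>i j. a j i = - a i j"
  shows "(\<Sum>\<^sub>7i j. a i j * s i j) = 0"
  using sum7_skew[of s a, OF assms] by (simp only: mult.commute)

lemma ph_cyc: "ph j k i = ph i j k"
  using ph_skew12[of j i k] ph_skew23[of j k i] by simp

lemma ph_skew13: "ph k j i = - ph i j k"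
  using ph_skew23[of i k j] ph_cyc[of k j i] by simp

lemma ps_cyc: "ps j k i l = ps i j k l"
  using ps_skew12[of j i k l] ps_skew23[of j k i l] by simp

lemma ps_rot: "ps j k l i = - ps i j k l"
  using ps_cyc[of j k i l] ps_skew34[of j k l i] by simp

lemma ps_skew24: "ps i l k j = - ps i j k l"
  using ps_skew23[of i l k j] ps_skew34[of i k l j] ps_skew23[of i k j l] by simp

lemma ps_skew13: "ps k j i l = - ps i j k l"
  using ps_skew23[of k j i l] ps_skew12[of k i j l] ps_skew23[of i k j l] by simp

lemma ph_diag [simp]: "ph i i k = 0" "ph k i i = 0" "ph i k i = 0"
  using ph_skew12[of i i k] ph_skew23[of k i i] ph_skew13[of i k i] by auto

lemma ps_diag [simp]: "ps i i k l = 0" "ps k i i l = 0" "ps k l i i = 0" "ps i k i l = 0" "ps k i l i = 0"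
  using ps_skew12[of i i k l] ps_skew23[of k i i l] ps_skew34[of k l i i] ps_skew13[of i k i l]
    ps_skew24[of k i l i] by auto

lemma ph_ph: "(\<Sum>\<^sub>7p. ph p i j * ph p k l) = kd i k * kd j l - kd i l * kd j k + ps i j k l"
  unfolding ps_def by simp

lemma ph_ph_12: "(\<Sum>\<^sub>7i j. X i j * (\<Sum>\<^sub>7p. ph p i j * ph p k l)) = X k l - X l k + (\<Sum>\<^sub>7i j. X i j * ps i j k l)"
  unfolding ph_ph distrib_left right_diff_distrib sum.distrib sum_subtractf sum7_kd2 ..

lemma ph_ph_13: "(\<Sum>\<^sub>7i k. X i k * (\<Sum>\<^sub>7p. ph p i j * ph p k l)) =
    (\<Sum>\<^sub>7i. X i i) * kd j l - X l j + (\<Sum>\<^sub>7i k. X i k * ps i j k l)"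
proof -
  have 1: "(\<Sum>\<^sub>7i k. X i k * (kd i k * kd j l)) = (\<Sum>\<^sub>7i. X i i) * kd j l"
    by (simp add: sum_distrib_right flip: mult.assoc) (simp flip: sum_distrib_right)
  have 2: "(\<Sum>\<^sub>7i k. X i k * (kd i l * kd j k)) = X l j"
    using sum7_kd2[of X l j] by (simp add: kd_commute)
  show ?thesis
    unfolding ph_ph distrib_left right_diff_distrib sum.distrib sum_subtractf 1 2 ..
qed

lemma ph_norm: "(\<Sum>\<^sub>7i j. ph a i j * ph b i j) = 6 * kd a b"
proof -
  have "ph a i j = ph i j a" for i j a by (simp add: ph_cyc)
  then have "(\<Sum>\<^sub>7i j. ph a i j * ph b i j) = (\<Sum>\<^sub>7j. \<Sum>\<^sub>7i. ph i j a * ph i j b)"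
    by (subst sum.swap) simp
  also have "\<dots> = (\<Sum>\<^sub>7j. kd a b - kd j b * kd a j)"
    unfolding ph_ph by simp
  also have "\<dots> = 6 * kd a b"
    by (simp add: sum_subtractf)
  finally show ?thesis .
qed

text \<open>Contracting a third \<open>ph\<close> into the product of two gives 6 by
  \<open>ph_norm\<close>; the delta terms of \<open>ph_ph_12\<close> account for 2 of this, which
  leaves 4.\<close>

lemma ph_ps: "(\<Sum>\<^sub>7i j. ph a i j * ps i j k l) = 4 * ph a k l"
proof -
  have "(\<Sum>\<^sub>7i j. ph a i j * (\<Sum>\<^sub>7p. ph p i j * ph p k l)) = (\<Sum>\<^sub>7p. (\<Sum>\<^sub>7i j. ph a i j * ph p i j) * ph p k l)"
    by (rule sum7_into[symmetric])
  then have "(\<Sum>\<^sub>7i j. ph a i j * (\<Sum>\<^sub>7p. ph p i j * ph p k l)) = 6 * ph a k l"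
    by (simp add: ph_norm mult.assoc flip: sum_distrib_left)
  then show ?thesis using ph_ph_12[of "ph a" k l] ph_skew23[of a l k] by simp
qed

section \<open>Three-forms as 7 by 7 matrices\<close>

definition skew3 :: "(7 \<Rightarrow> 7 \<Rightarrow> 7 \<Rightarrow> real) \<Rightarrow> bool" where
  "skew3 T \<longleftrightarrow> (\<forall>i j k. T j i k = - T i j k) \<and> (\<forall>i j k. T i k j = - T i j k)"

lemma skew3_12: "skew3 T \<Longrightarrow> T j i k = - T i j k" and skew3_23: "skew3 T \<Longrightarrow> T i k j = - T i j k"
  unfolding skew3_def by blast+

lemma skew3_13: "skew3 T \<Longrightarrow> T k j i = - T i j k"
  using skew3_12[of T k j i] skew3_23[of T j k i] skew3_12[of T j i k] by linarith

lemma skew3_cyc: "skew3 T \<Longrightarrow> T j k i = T i j k"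
  using skew3_23[of T j k i] skew3_12[of T j i k] by linarith

text \<open>The \<open>M\<close> of the overview. The map is injective on 3-forms
  (\<open>phc_eq_0\<close>), so 3-forms may be compared as matrices.\<close>

definition phc :: "(7 \<Rightarrow> 7 \<Rightarrow> 7 \<Rightarrow> real) \<Rightarrow> 7 \<Rightarrow> 7 \<Rightarrow> real" where
  "phc T a b = (\<Sum>\<^sub>7i j. T a i j * ph b i j)"

lemma phc_ph: "(\<Sum>\<^sub>7a. phc T m a * ph a k p) = T m k p - T m p k + (\<Sum>\<^sub>7i j. T m i j * ps i j k p)"
  unfolding phc_def sum7_into ph_ph_12 ..

lemma phc_explicit:
  assumes "\<And>i j. X j i = - X i j"
  shows
  "(\<Sum>\<^sub>7i j. X i j * ph 1 i j) = 2 * (X 2 7 + X 3 5 - X 4 6)"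
  "(\<Sum>\<^sub>7i j. X i j * ph 2 i j) = 2 * (- X 1 7 - X 3 6 - X 4 5)"
  "(\<Sum>\<^sub>7i j. X i j * ph 3 i j) = 2 * (- X 1 5 + X 2 6 + X 4 7)"
  "(\<Sum>\<^sub>7i j. X i j * ph 4 i j) = 2 * (X 1 6 + X 2 5 - X 3 7)"
  "(\<Sum>\<^sub>7i j. X i j * ph 5 i j) = 2 * (X 1 3 - X 2 4 + X 6 7)"
  "(\<Sum>\<^sub>7i j. X i j * ph 6 i j) = 2 * (- X 1 4 - X 2 3 - X 5 7)"
  "(\<Sum>\<^sub>7i j. X i j * ph 7 i j) = 2 * (X 1 2 + X 3 4 + X 5 6)"
proof -
  define w where "w a b i j = kd a i * kd b j - kd a j * kd b i" for a b i j
  have w: "(\<Sum>\<^sub>7i j. X i j * w a b i j) = 2 * X a b" for a b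
  proof -
    have "(\<Sum>\<^sub>7i j. X i j * (kd a i * kd b j)) = X a b" for a b
      using sum7_kd2[of X a b] by (simp add: kd_commute)
    then have "(\<Sum>\<^sub>7i j. X i j * (kd a i * kd b j)) - (\<Sum>\<^sub>7i j. X i j * (kd b i * kd a j)) = 2 * X a b"
      using assms[of b a] by simp
    then show ?thesis unfolding w_def by (simp add: right_diff_distrib sum_subtractf mult.commute)
  qed
  have 3: "(\<Sum>\<^sub>7i j. X i j * (s * w a b i j + t * w c d i j + u * w e f i j)) =
      2 * (s * X a b + t * X c d + u * X e f)" for s t u a b c d e f
    unfolding distrib_left sum.distrib mult.left_commute[of "X _ _"] sum_distrib_left[symmetric] w by simp
  show
  "(\<Sum>\<^sub>7i j. X i j * ph 1 i j) = 2 * (X 2 7 + X 3 5 - X 4 6)"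
  "(\<Sum>\<^sub>7i j. X i j * ph 2 i j) = 2 * (- X 1 7 - X 3 6 - X 4 5)"
  "(\<Sum>\<^sub>7i j. X i j * ph 3 i j) = 2 * (- X 1 5 + X 2 6 + X 4 7)"
  "(\<Sum>\<^sub>7i j. X i j * ph 4 i j) = 2 * (X 1 6 + X 2 5 - X 3 7)"
  "(\<Sum>\<^sub>7i j. X i j * ph 5 i j) = 2 * (X 1 3 - X 2 4 + X 6 7)"
  "(\<Sum>\<^sub>7i j. X i j * ph 6 i j) = 2 * (- X 1 4 - X 2 3 - X 5 7)"
  "(\<Sum>\<^sub>7i j. X i j * ph 7 i j) = 2 * (X 1 2 + X 3 4 + X 5 6)"
    using 3[of 1 2 7 1 3 5 "-1" 4 6] 3[of "-1" 1 7 "-1" 3 6 "-1" 4 5] 3[of "-1" 1 5 1 2 6 1 4 7]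
      3[of 1 1 6 1 2 5 "-1" 3 7] 3[of 1 1 3 "-1" 2 4 1 6 7] 3[of "-1" 1 4 "-1" 2 3 "-1" 5 7]
      3[of 1 1 2 1 3 4 1 5 6]
    unfolding ph_row w_def[symmetric] by simp_all
qed

text \<open>The seven triples of \<open>ph\<close> are the lines of a Fano plane on the indices. The
  equation for \<open>m\<close>, \<open>a\<close> sums \<open>T m\<close> over the pairs that
  complete \<open>a\<close> to a line, so the 49 equations decouple: one block for the lines and
  seven blocks of four triples each.\<close>

lemma phc_eq_0:
  assumes T: "skew3 T" and M: "\<And>m a. phc T m a = 0"
  shows "T i j k = 0"
proof -
  note s12 = skew3_12[OF T] and cy = skew3_cyc[OF T]
  have dg: "T i i j = 0" "T i j i = 0" for i j
    using s12[of i i j] skew3_13[OF T, of i j i] by auto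
  have e: "T m 2 7 + T m 3 5 - T m 4 6 = 0" "- T m 1 7 - T m 3 6 - T m 4 5 = 0"
    "- T m 1 5 + T m 2 6 + T m 4 7 = 0" "T m 1 6 + T m 2 5 - T m 3 7 = 0"
    "T m 1 3 - T m 2 4 + T m 6 7 = 0" "- T m 1 4 - T m 2 3 - T m 5 7 = 0"
    "T m 1 2 + T m 3 4 + T m 5 6 = 0" for m
    using phc_explicit[of "T m", OF skew3_23[OF T], folded phc_def, unfolded M] by simp_all
  have c: "T 1 2 7 + T 1 3 5 - T 1 4 6 = 0" "T 1 2 7 - T 2 3 6 - T 2 4 5 = 0"
    "T 1 3 5 - T 2 3 6 + T 3 4 7 = 0" "T 3 4 7 - T 1 4 6 - T 2 4 5 = 0"
    "T 1 3 5 - T 2 4 5 + T 5 6 7 = 0" "T 5 6 7 - T 1 4 6 - T 2 3 6 = 0" "T 1 2 7 + T 3 4 7 + T 5 6 7 = 0"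
    using e(1)[of 1] e(2)[of 2] e(3)[of 3] e(4)[of 4] e(5)[of 5] e(6)[of 6] e(7)[of 7]
    by (simp_all add: s12[of 2 1 7] s12[of 3 1 5] s12[of 4 1 6] s12[of 3 2 6] s12[of 4 2 5]
      s12[of 4 3 7] s12[of 6 5 7] cy[of 1 3 5] cy[of 1 4 6] cy[of 2 3 6] cy[of 2 4 5] cy[of 1 2 7]
      cy[of 3 4 7] cy[of 5 6 7] flip: cy[of 3 5 1] cy[of 4 6 1] cy[of 3 6 2] cy[of 4 5 2])
  \<comment> \<open>With the signs of \<open>ph\<close>, the diagonal equation at a point says that
    the components on its three lines sum to zero. Summing over all points shows that the total over
    all lines is zero; summing over the points of one line gives twice its component plus that
    total.\<close>
  have z1: "T 1 2 7 = 0 \<and> T 1 3 5 = 0 \<and> T 1 4 6 = 0 \<and> T 2 3 6 = 0 \<and> T 2 4 5 = 0 \<and> T 3 4 7 = 0 \<and> T 5 6 7 = 0"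
  proof -
    have "T 1 2 7 + T 1 3 5 - T 1 4 6 - T 2 3 6 - T 2 4 5 + T 3 4 7 + T 5 6 7 = 0"
      using c by linarith
    then show ?thesis using c by auto
  qed
  \<comment> \<open>Each remaining triple leaves exactly one index off the lines through its pairs;
    this index labels the blocks, here 1, then 2, 7, 3, 5, 6, 4. The equation for distinct
    \<open>m\<close>, \<open>a\<close> belongs to the block of the third index on their line and
    relates two of its triples. Four equations per block suffice.\<close>
  have z2: "T 2 3 4 = 0 \<and> T 2 5 6 = 0 \<and> T 3 6 7 = 0 \<and> T 4 5 7 = 0"
    using e(7)[of 2] e(5)[of 3] e(6)[of 4] e(3)[of 5] cy[of 2 3 4] dg(2)[of 2 1] dg(2)[of 3 1] dg(2)[of 4 1] dg(2)[of 5 1] s12[of 3 2 4] s12[of 5 2 6] s12[of 5 4 7]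
    by (intro conjI) linarith+
  have z3: "T 1 3 4 = 0 \<and> T 1 5 6 = 0 \<and> T 3 5 7 = 0 \<and> T 4 6 7 = 0"
    using e(7)[of 1] e(6)[of 3] e(5)[of 4] e(4)[of 5] cy[of 1 3 4] dg(2)[of 3 2] dg(2)[of 4 2] dg(2)[of 5 2] dg(1)[of 1 2] s12[of 3 1 4] s12[of 5 1 6] s12[of 5 3 7]
    by (intro conjI) linarith+
  have z4: "T 1 3 6 = 0 \<and> T 1 4 5 = 0 \<and> T 2 3 5 = 0 \<and> T 2 4 6 = 0"
    using e(2)[of 1] e(1)[of 2] e(4)[of 3] e(6)[of 5] cy[of 1 4 5] cy[of 2 3 5] dg(1)[of 1 7] dg(1)[of 2 7] dg(1)[of 3 7] dg(1)[of 5 7] s12[of 3 1 6] s12[of 3 2 5]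
    by (intro conjI) linarith+
  have z5: "T 1 2 4 = 0 \<and> T 1 6 7 = 0 \<and> T 2 5 7 = 0 \<and> T 4 5 6 = 0"
    using e(5)[of 1] e(6)[of 2] e(7)[of 4] e(1)[of 5] cy[of 1 2 4] dg(2)[of 4 3] dg(2)[of 5 3] dg(1)[of 1 3] dg(1)[of 2 3] s12[of 2 1 4] s12[of 5 2 7] s12[of 5 4 6]
    by (intro conjI) linarith+
  have z6: "T 1 2 6 = 0 \<and> T 1 4 7 = 0 \<and> T 2 3 7 = 0 \<and> T 3 4 6 = 0"
    using e(3)[of 1] e(4)[of 2] e(1)[of 3] e(7)[of 6] cy[of 1 2 6] cy[of 3 4 6] dg(2)[of 6 5] dg(1)[of 1 5] dg(1)[of 2 5] dg(1)[of 3 5] s12[of 2 1 6] s12[of 3 2 7]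
    by (intro conjI) linarith+
  have z7: "T 1 2 5 = 0 \<and> T 1 3 7 = 0 \<and> T 2 4 7 = 0 \<and> T 3 4 5 = 0"
    using e(4)[of 1] e(3)[of 2] e(2)[of 3] e(7)[of 5] cy[of 1 2 5] cy[of 3 4 5] dg(1)[of 1 6] dg(1)[of 2 6] dg(1)[of 3 6] dg(1)[of 5 6] s12[of 2 1 5] s12[of 3 1 7]
    by (intro conjI) linarith+
  have z8: "T 1 2 3 = 0 \<and> T 1 5 7 = 0 \<and> T 2 6 7 = 0 \<and> T 3 5 6 = 0"
    using e(6)[of 1] e(5)[of 2] e(7)[of 3] e(2)[of 5] cy[of 1 2 3] dg(2)[of 5 4] dg(1)[of 1 4] dg(1)[of 2 4]
      dg(1)[of 3 4] s12[of 2 1 3] s12[of 5 1 7] s12[of 5 3 6]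
    by (intro conjI) linarith+
  have p: "(T j i k = 0) = (T i j k = 0)" "(T i k j = 0) = (T i j k = 0)" for i j k
    using s12[of j i k] skew3_23[OF T, of i k j] by auto
  have d: "T i i j = 0" "T i j i = 0" "T j i i = 0" for i j
    using dg cy[of j i i] by auto
  have "\<forall>i j k. T i j k = 0"
    unfolding forall_7 using z1 z2 z3 z4 z5 z6 z7 z8 by (simp add: p d)
  then show ?thesis by blast
qed

lemma sum7_swap3: "(\<Sum>\<^sub>7i j k. f i j k) = (\<Sum>\<^sub>7j k i. f i j k)"
  by (rule trans[OF sum.swap], rule sum.cong, rule refl, rule sum.swap)

lemma sum7_swap4: "(\<Sum>\<^sub>7k l i j. f k l i j) = (\<Sum>\<^sub>7i j k l. f k l i j)"
  by (rule trans[OF sum7_swap3[symmetric]], rule sum.cong, rule refl, rule sum7_swap3[symmetric])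

lemma sum7_out:
  "(\<Sum>\<^sub>7k l. (\<Sum>\<^sub>7a. g a * f a k l) * X k l) = (\<Sum>\<^sub>7a. g a * (\<Sum>\<^sub>7k l. f a k l * X k l))"
  unfolding sum_distrib_left sum_distrib_right mult.assoc
  by (rule sum7_swap3[symmetric])

lemma sum7_into4:
  "(\<Sum>\<^sub>7k l. (\<Sum>\<^sub>7i j. f i j k l * X i j) * Y k l) = (\<Sum>\<^sub>7i j. X i j * (\<Sum>\<^sub>7k l. f i j k l * Y k l))"
proof -
  have "(\<Sum>\<^sub>7k l. \<Sum>\<^sub>7i j. X i j * (f i j k l * Y k l)) = (\<Sum>\<^sub>7i j. \<Sum>\<^sub>7k l. X i j * (f i j k l * Y k l))"
    by (rule sum7_swap4)
  then show ?thesis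
    unfolding sum_distrib_left sum_distrib_right by (simp only: mult_ac)
qed

lemma ph_ph_sym:
  assumes "\<And>i j. X j i = X i j"
  shows "(\<Sum>\<^sub>7i k. X i k * (\<Sum>\<^sub>7p. ph p i j * ph p k l)) = (\<Sum>\<^sub>7i. X i i) * kd j l - X j l"
proof -
  have "(\<Sum>\<^sub>7i k. X i k * ps i j k l) = 0"
    by (rule sum7_skew[OF assms ps_skew13])
  then show ?thesis unfolding ph_ph_13 using assms[of j l] by simp
qed

text \<open>The matrix acting on \<open>ph\<close> as a derivation. On symmetric matrices it inverts
  \<open>phc\<close> up to a factor and a trace term, see \<open>phc_cyc3\<close>.\<close>

definition cyc3 :: "(7 \<Rightarrow> 7 \<Rightarrow> real) \<Rightarrow> 7 \<Rightarrow> 7 \<Rightarrow> 7 \<Rightarrow> real" where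
  "cyc3 M j k l = (\<Sum>\<^sub>7a. M j a * ph a k l) + (\<Sum>\<^sub>7a. M k a * ph a l j) + (\<Sum>\<^sub>7a. M l a * ph a j k)"

lemma skew3_cyc3: "skew3 (cyc3 M)"
proof -
  have *: "(\<Sum>\<^sub>7a. M i a * ph a l k) = - (\<Sum>\<^sub>7a. M i a * ph a k l)" for i k l
    by (subst ph_skew23) (simp add: sum_negf)
  have "cyc3 M j i k = - cyc3 M i j k" "cyc3 M i k j = - cyc3 M i j k" for i j k
    using *[of i k j] *[of j i k] *[of k j i] unfolding cyc3_def by linarith+
  then show ?thesis unfolding skew3_def by blast
qed

lemma phc_cyc3:
  assumes "\<And>i j. X j i = X i j"
  shows "phc (cyc3 X) j m = 4 * X j m + 2 * (\<Sum>\<^sub>7i. X i i) * kd j m"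
proof -
  have 1: "(\<Sum>\<^sub>7k l. (\<Sum>\<^sub>7a. X j a * ph a k l) * ph m k l) = 6 * X j m"
    unfolding sum7_out ph_norm by (simp add: mult.left_commute[of _ 6] flip: sum_distrib_left)
  have e: "ph a l j * ph m k l = ph l k m * ph l a j" for a k l
    unfolding ph_skew12[of a l j] ph_skew13[of m k l] by simp
  have "(\<Sum>\<^sub>7k l. (\<Sum>\<^sub>7a. X k a * ph a l j) * ph m k l)
      = (\<Sum>\<^sub>7k. \<Sum>\<^sub>7a. X k a * (\<Sum>\<^sub>7l. ph a l j * ph m k l))"
    by (simp only: sum_distrib_right sum_distrib_left mult.assoc) (rule sum.cong[OF refl], rule sum.swap)
  also have "\<dots> = (\<Sum>\<^sub>7k. \<Sum>\<^sub>7a. X k a * (\<Sum>\<^sub>7l. ph l k m * ph l a j))"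
    by (simp only: e)
  also have "\<dots> = (\<Sum>\<^sub>7i. X i i) * kd j m - X j m"
    unfolding ph_ph_sym[of X, OF assms] using assms[of j m] by (simp add: kd_commute)
  finally have 2: "(\<Sum>\<^sub>7k l. (\<Sum>\<^sub>7a. X k a * ph a l j) * ph m k l) = (\<Sum>\<^sub>7i. X i i) * kd j m - X j m" .
  have "(\<Sum>\<^sub>7k l. (\<Sum>\<^sub>7a. X l a * ph a j k) * ph m k l) = (\<Sum>\<^sub>7k l. (\<Sum>\<^sub>7a. X k a * ph a j l) * ph m l k)"
    by (rule sum.swap)
  also have "\<dots> = (\<Sum>\<^sub>7k l. (\<Sum>\<^sub>7a. X k a * ph a l j) * ph m k l)"
  proof -
    have "ph a j l * ph m l k = ph a l j * ph m k l" for a k l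
      unfolding ph_skew23[of a j l] ph_skew23[of m l k] by simp
    then show ?thesis by (simp only: sum_distrib_right mult.assoc)
  qed
  finally have 3: "(\<Sum>\<^sub>7k l. (\<Sum>\<^sub>7a. X l a * ph a j k) * ph m k l) = (\<Sum>\<^sub>7i. X i i) * kd j m - X j m"
    using 2 by simp
  show ?thesis
    unfolding phc_def cyc3_def distrib_right sum.distrib 1 2 3 by simp
qed

text \<open>The constants invert \<open>phc_cyc3\<close>: 1/4 restores \<open>phc T\<close> and
  leaves half the trace times \<open>kd\<close> in excess, which 1/12 removes because
  \<open>ph_norm\<close> contributes 6. By \<open>phc_eq_0\<close> comparing the matrices is
  enough.\<close>

lemma three_form_eq_cyc3:
  assumes T: "skew3 T" and sym: "\<And>i j. phc T j i = phc T i j"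
  shows "T j k l = 1/4 * cyc3 (phc T) j k l - 1/12 * (\<Sum>\<^sub>7i. phc T i i) * ph j k l"
proof -
  let ?t = "\<Sum>\<^sub>7i. phc T i i"
  define D where "D = (\<lambda>j k l. T j k l - (1/4 * cyc3 (phc T) j k l - 1/12 * ?t * ph j k l))"
  have "D j i k = - D i j k" "D i k j = - D i j k" for i j k
    using skew3_12[OF T, of j i k] skew3_12[OF skew3_cyc3[of "phc T"], of j i k] ph_skew12[of j i k]
      skew3_23[OF T, of i k j] skew3_23[OF skew3_cyc3[of "phc T"], of i k j] ph_skew23[of i k j]
    unfolding D_def by simp_all
  then have "skew3 D" unfolding skew3_def by blast
  moreover have "phc D m a = 0" for m a
  proof -
    have "phc D m a = phc T m a - (1/4 * phc (cyc3 (phc T)) m a - 1/12 * ?t * (\<Sum>\<^sub>7i j. ph m i j * ph a i j))"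
      unfolding phc_def D_def left_diff_distrib sum_subtractf mult.assoc sum_distrib_left ..
    then show ?thesis unfolding phc_cyc3[of "phc T", OF sym] ph_norm by (simp add: field_simps)
  qed
  ultimately have "D j k l = 0" by (rule phc_eq_0)
  then show ?thesis unfolding D_def by simp
qed

text \<open>The 3-forms \<open>A i\<close> are recovered from \<open>B\<close> by \<open>three_form_eq_cyc3\<close>. Inserted into \<open>Z\<close> this
  expresses \<open>U\<^sub>k\<^sub>l\<^sub>m = B\<^sub>k\<^sub>l\<^sub>m - B\<^sub>l\<^sub>k\<^sub>m\<close> by the symmetric traceless tensor \<open>W\<^sub>m\<^sub>a = \<phi>\<^sub>i\<^sub>j\<^sub>m B\<^sub>i\<^sub>j\<^sub>a\<close>. The cyclic
  sum of \<open>U\<close> is zero, and a symmetric traceless \<open>W\<close> with \<open>cyc3 W = 0\<close> vanishes.\<close>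

lemma symmetric_derivative:
  fixes A :: "7 \<Rightarrow> 7 \<Rightarrow> 7 \<Rightarrow> 7 \<Rightarrow> real"
  defines "B \<equiv> \<lambda>i. phc (A i)"
  assumes A: "\<And>i. skew3 (A i)" and sym: "\<And>i j k. B i k j = B i j k"
    and Z: "\<And>k l m. 2 * (\<Sum>\<^sub>7i j. A i j k l * ph i j m) = B k l m - B l k m"
  shows "B l k m = B k l m" "(\<Sum>\<^sub>7j. B i j j) = 0"
proof -
  define U where "U k l m = B k l m - B l k m" for k l m
  define W where "W m a = (\<Sum>\<^sub>7i j. ph i j m * B i j a)" for m a
  define b where "b k = (\<Sum>\<^sub>7j. B k j j)" for k
  define c where "c k = (\<Sum>\<^sub>7j. B j k j)" for k
  have phU: "(\<Sum>\<^sub>7k l. U k l m * ph n k l) = 2 * W n m" for m n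
  proof -
    have 1: "(\<Sum>\<^sub>7k l. B k l m * ph n k l) = W n m"
    proof -
      have "ph n k l = ph k l n" for k l by (rule ph_cyc[symmetric])
      then show ?thesis unfolding W_def by (simp only: mult.commute)
    qed
    have "(\<Sum>\<^sub>7k l. B l k m * ph n k l) = (\<Sum>\<^sub>7k l. B k l m * ph n l k)"
      by (rule sum.swap)
    also have "\<dots> = - W n m"
    proof -
      have "B k l m * ph n l k = - (B k l m * ph n k l)" for k l
        unfolding ph_skew23[of n l k] by simp
      then show ?thesis by (simp only: sum_negf 1)
    qed
    finally show ?thesis
      unfolding U_def left_diff_distrib sum_subtractf 1 by simp
  qed
  \<comment> \<open>Contract \<open>Z\<close> over \<open>k\<close>, \<open>l\<close> with
    \<open>ph n k l\<close>. The right-hand side is covered by \<open>phU\<close>; on the left the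
    contraction turns the 3-form \<open>A i\<close> into \<open>B i\<close>, which yields
    \<open>W\<close> with its indices exchanged.\<close>
  have Wsym: "W n m = W m n" for m n
  proof -
    have "2 * W n m = (\<Sum>\<^sub>7k l. 2 * (\<Sum>\<^sub>7i j. A i j k l * ph i j m) * ph n k l)"
      unfolding Z phU[symmetric] U_def ..
    also have "\<dots> = 2 * (\<Sum>\<^sub>7k l. (\<Sum>\<^sub>7i j. A i j k l * ph i j m) * ph n k l)"
      by (simp only: mult.assoc sum_distrib_left[symmetric])
    also have "\<dots> = 2 * W m n"
      unfolding sum7_into4 W_def B_def phc_def ..
    finally show ?thesis by simp
  qed
  have Wtr: "(\<Sum>\<^sub>7m. W m m) = 0"
    unfolding W_def
    by (subst sum7_swap3, rule sum.neutral, rule ballI, rule sum7_skew'[OF sym ph_skew23])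
  \<comment> \<open>The contraction of the symmetric \<open>W\<close> with \<open>ph\<close>
    vanishes, and expanding the product of two \<open>ph\<close> it is the difference of the two
    traces of \<open>B\<close>.\<close>
  have bc: "b k = c k" for k
  proof -
    have "(\<Sum>\<^sub>7m a. W m a * ph a k m) = 0"
      by (rule sum7_skew[OF Wsym]) (rule ph_skew13)
    moreover have "(\<Sum>\<^sub>7m a. W m a * ph a k m) = c k - b k"
    proof -
      have "(\<Sum>\<^sub>7m a. W m a * ph a k m) = (\<Sum>\<^sub>7m a. \<Sum>\<^sub>7i j. B i j a * (ph i j m * ph a k m))"
        unfolding W_def sum_distrib_right by (simp only: mult_ac)
      also have "\<dots> = (\<Sum>\<^sub>7i j. \<Sum>\<^sub>7m a. B i j a * (ph i j m * ph a k m))"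
        by (rule sum7_swap4)
      also have "\<dots> = (\<Sum>\<^sub>7i j a. B i j a * (\<Sum>\<^sub>7m. ph i j m * ph a k m))"
        unfolding sum_distrib_left
        by (rule sum.cong, rule refl, rule sum.cong, rule refl, rule sum.swap)
      also have "\<dots> = (\<Sum>\<^sub>7i. - (\<Sum>\<^sub>7j a. B i j a * (\<Sum>\<^sub>7m. ph m j i * ph m a k)))"
      proof -
        have "ph i j m * ph a k m = - (ph m j i * ph m a k)" for i j m a
          unfolding ph_skew13[of i j m] ph_cyc[of a k m] by simp
        then show ?thesis by (simp only: sum_negf mult_minus_right)
      qed
      also have "\<dots> = (\<Sum>\<^sub>7i. B i i k - b i * kd i k)"
        by (rule sum.cong[OF refl], subst ph_ph_sym) (simp_all add: sym b_def)
      also have "\<dots> = c k - b k"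
        unfolding sum_subtractf c_def using sym by simp
      finally show ?thesis .
    qed
    ultimately show ?thesis by simp
  qed
  \<comment> \<open>A second relation between the traces, from \<open>Z\<close> summed over
    \<open>l = m\<close>. Together with \<open>bc\<close> it makes both traces zero.\<close>
  have "b k = - c k" for k
  proof -
    have "(\<Sum>\<^sub>7l. 2 * (\<Sum>\<^sub>7i j. A i j k l * ph i j l)) = b k - c k"
      unfolding Z sum_subtractf b_def c_def by simp
    moreover have "(\<Sum>\<^sub>7l. (\<Sum>\<^sub>7i j. A i j k l * ph i j l)) = - c k"
    proof -
      have "(\<Sum>\<^sub>7l. (\<Sum>\<^sub>7i j. A i j k l * ph i j l)) = (\<Sum>\<^sub>7i j l. A i j k l * ph i j l)"
        by (rule sum7_swap3)
      also have "\<dots> = (\<Sum>\<^sub>7i. - (\<Sum>\<^sub>7j l. A i k j l * ph i j l))"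
      proof -
        have "A i j k l * ph i j l = - (A i k j l * ph i j l)" for i j l
          unfolding skew3_12[OF A, of i j k l] by simp
        then show ?thesis by (simp only: sum_negf)
      qed
      finally show ?thesis unfolding c_def B_def phc_def sum_negf .
    qed
    ultimately show ?thesis by (simp flip: sum_distrib_left)
  qed
  with bc have b0: "b k = 0" and c0: "c k = 0" for k by (metis equal_neg_zero)+
  show "(\<Sum>\<^sub>7j. B i j j) = 0" using b0 unfolding b_def by simp
  define X where "X k l m = (\<Sum>\<^sub>7a. W m a * ph a k l)" for k l m
  define Q where "Q k l m = (\<Sum>\<^sub>7i a. B i k a * ps i m a l)" for k l m
  have A_eq: "A i j k l = 1/4 * cyc3 (B i) j k l" for i j k l
    using three_form_eq_cyc3[OF A, of i j k l] sym[of i] b0[of i] unfolding B_def b_def by simp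
  have t1: "(\<Sum>\<^sub>7i j. (\<Sum>\<^sub>7a. B i j a * ph a k l) * ph i j m) = X k l m" for k l m
    unfolding X_def W_def sum7_into by (simp only: mult.commute)
  have t2: "(\<Sum>\<^sub>7i j. (\<Sum>\<^sub>7a. B i k a * ph a l j) * ph i j m) = B l k m - Q k l m" for k l m
  proof -
    have "(\<Sum>\<^sub>7i j. (\<Sum>\<^sub>7a. B i k a * ph a l j) * ph i j m) = (\<Sum>\<^sub>7i a. B i k a * (\<Sum>\<^sub>7j. ph a l j * ph i j m))"
      by (simp only: sum_distrib_right sum_distrib_left mult.assoc) (rule sum.cong[OF refl], rule sum.swap)
    also have "\<dots> = (\<Sum>\<^sub>7i a. B i k a * (- (\<Sum>\<^sub>7j. ph j i m * ph j a l)))"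
    proof -
      have "ph a l j * ph i j m = - (ph j i m * ph j a l)" for a i j
        unfolding ph_cyc[of a l j] ph_skew12[of i j m] by simp
      then show ?thesis by (simp only: sum_negf)
    qed
    also have "\<dots> = - (\<Sum>\<^sub>7i a. B i k a * (\<Sum>\<^sub>7j. ph j i m * ph j a l))"
      by (simp only: mult_minus_right sum_negf)
    also have "\<dots> = B l k m - Q k l m"
      unfolding ph_ph_13 Q_def using c0[of k] unfolding c_def by simp
    finally show ?thesis .
  qed
  have t3: "(\<Sum>\<^sub>7i j. (\<Sum>\<^sub>7a. B i l a * ph a j k) * ph i j m) = - (B k l m - Q l k m)" for k l m
  proof -
    have "ph a j k = - ph a k j" for a j by (rule ph_skew23)
    then show ?thesis unfolding t2[symmetric] by (simp only: mult_minus_right mult_minus_left sum_negf)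
  qed
  \<comment> \<open>\<open>Q\<close> is the contraction with \<open>ps\<close> that arises when
    \<open>A_eq\<close> is inserted in \<open>Z\<close>. It sees only the part \<open>U\<close> of
    \<open>B\<close> skew in the first two indices, so \<open>ph_ph_12\<close> and
    \<open>phU\<close> express it by \<open>W\<close> and \<open>U\<close>.\<close>
  have Q: "Q k l m = X l m k - U l m k" for k l m
  proof -
    have ps: "ps i m a l = ps i a l m" for i a
      using ps_skew34[of i a m l] ps_skew23[of i m a l] by simp
    have Q1: "Q k l m = (\<Sum>\<^sub>7i a. B i a k * ps i a l m)"
      unfolding Q_def sym[of _ k] ps ..
    have "(\<Sum>\<^sub>7i a. B a i k * ps i a l m) = (\<Sum>\<^sub>7i a. B i a k * ps a i l m)" by (rule sum.swap)
    also have "\<dots> = - Q k l m" 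
    proof -
      have "B i a k * ps a i l m = - (B i a k * ps i a l m)" for i a
        unfolding ps_skew12[of a i l m] by simp
      then show ?thesis unfolding Q1 by (simp only: sum_negf)
    qed
    finally have "(\<Sum>\<^sub>7i a. U i a k * ps i a l m) = 2 * Q k l m"
      unfolding U_def left_diff_distrib sum_subtractf Q1[symmetric] by simp
    moreover have "(\<Sum>\<^sub>7i a. U i a k * (\<Sum>\<^sub>7p. ph p i a * ph p l m)) = 2 * X l m k"
      unfolding sum7_into[symmetric] phU X_def by (simp only: Wsym[of k] mult.assoc sum_distrib_left)
    ultimately show ?thesis unfolding ph_ph_12 by (simp add: U_def)
  qed
  \<comment> \<open>Inserting \<open>A_eq\<close> in \<open>Z\<close> leaves \<open>U\<close> on
    both sides, directly and through the two \<open>Q\<close>; the cyclic identity for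
    \<open>U\<close> merges these copies into one.\<close>
  have U4: "4 * U k l m = X k l m - X l m k - X m k l" for k l m
  proof -
    have "(\<Sum>\<^sub>7i j. A i j k l * ph i j m) = 1/4 * (X k l m + (B l k m - Q k l m) - (B k l m - Q l k m))"
      unfolding A_eq cyc3_def mult.assoc sum_distrib_left[symmetric] distrib_right sum.distrib t1 t2 t3
      by simp
    with Z[of k l m] have "2 * U k l m = X k l m - U k l m - Q k l m + Q l k m"
      unfolding U_def by simp
    moreover have "X k m l = - X m k l"
      unfolding X_def by (subst ph_skew23) (simp add: sum_negf)
    moreover have "U k m l = - U m k l" unfolding U_def by simp
    moreover have "U k l m + U l m k + U m k l = 0"
      unfolding U_def using sym by simp
    ultimately show ?thesis unfolding Q by simp
  qed
  have "cyc3 W m k l = 0" for k l m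
  proof -
    have "U k l m + U l m k + U m k l = 0"
      unfolding U_def using sym by simp
    then show ?thesis
      using U4[of k l m] U4[of l m k] U4[of m k l] unfolding cyc3_def X_def by simp
  qed
  then have "phc (cyc3 W) m n = 0" for m n unfolding phc_def by simp
  then have "W m n = 0" for m n unfolding phc_cyc3[of W, OF Wsym] Wtr by simp
  then have "U k l m = 0" using U4[of k l m] unfolding X_def by simp
  then show "B l k m = B k l m" unfolding U_def by simp
qed

section \<open>Full contractions of three slots with a skew tensor\<close>

definition tr3 :: "(7 \<Rightarrow> 7 \<Rightarrow> 7 \<Rightarrow> real) \<Rightarrow> (7 \<Rightarrow> 7 \<Rightarrow> 7 \<Rightarrow> real) \<Rightarrow> real" where
  "tr3 w Y = (\<Sum>\<^sub>7k l m. w k l m * Y k l m)"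

lemma tr3_add: "tr3 w (\<lambda>k l m. Y k l m + Z k l m) = tr3 w Y + tr3 w Z"
  unfolding tr3_def distrib_left sum.distrib ..

lemma tr3_diff: "tr3 w (\<lambda>k l m. Y k l m - Z k l m) = tr3 w Y - tr3 w Z"
  unfolding tr3_def right_diff_distrib sum_subtractf ..

lemma tr3_cmult: "tr3 w (\<lambda>k l m. c * Y k l m) = c * tr3 w Y"
  unfolding tr3_def sum_distrib_left by (simp only: mult.left_commute)

lemma tr3_sum: "tr3 w (\<lambda>k l m. \<Sum>\<^sub>7a. c a * Y a k l m) = (\<Sum>\<^sub>7a. c a * tr3 w (Y a))"
proof -
  have "tr3 w (\<lambda>k l m. \<Sum>\<^sub>7a. c a * Y a k l m) = (\<Sum>\<^sub>7k l m a. c a * (w k l m * Y a k l m))"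
    unfolding tr3_def sum_distrib_left by (simp only: mult.left_commute)
  also have "\<dots> = (\<Sum>\<^sub>7k a l m. c a * (w k l m * Y a k l m))"
    by (rule sum.cong, rule refl, rule sum7_swap3[symmetric])
  also have "\<dots> = (\<Sum>\<^sub>7a k l m. c a * (w k l m * Y a k l m))"
    by (rule sum.swap)
  finally show ?thesis unfolding tr3_def sum_distrib_left .
qed

lemma tr3_swap12:
  assumes "skew3 w" shows "tr3 w (\<lambda>k l m. Y l k m) = - tr3 w Y"
proof -
  have "tr3 w (\<lambda>k l m. Y l k m) = (\<Sum>\<^sub>7k l m. w l k m * Y k l m)"
    unfolding tr3_def by (rule sum.swap)
  also have "\<dots> = - tr3 w Y"
  proof -
    have "w l k m * Y k l m = - (w k l m * Y k l m)" for k l m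
      unfolding skew3_12[OF assms, of l k m] by simp
    then show ?thesis unfolding tr3_def by (simp only: sum_negf)
  qed
  finally show ?thesis .
qed

lemma tr3_swap23:
  assumes "skew3 w" shows "tr3 w (\<lambda>k l m. Y k m l) = - tr3 w Y"
proof -
  have "tr3 w (\<lambda>k l m. Y k m l) = (\<Sum>\<^sub>7k l m. w k m l * Y k l m)"
    unfolding tr3_def by (rule sum.cong, rule refl, rule sum.swap)
  also have "\<dots> = - tr3 w Y"
  proof -
    have "w k m l * Y k l m = - (w k l m * Y k l m)" for k l m
      unfolding skew3_23[OF assms, of k m l] by simp
    then show ?thesis unfolding tr3_def by (simp only: sum_negf)
  qed
  finally show ?thesis .
qed

lemma tr3_cyc:
  assumes "skew3 w" shows "tr3 w (\<lambda>k l m. Y m k l) = tr3 w Y" "tr3 w (\<lambda>k l m. Y l m k) = tr3 w Y"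
  using tr3_swap23[OF assms, of "\<lambda>k l m. Y l k m"] tr3_swap12[OF assms, of "\<lambda>k l m. Y k m l"]
    tr3_swap12[OF assms, of Y] tr3_swap23[OF assms, of Y] by simp_all

lemma tr3_1:
  "tr3 w (\<lambda>k l m. \<Sum>\<^sub>7a. T k a * q a l m) = (\<Sum>\<^sub>7k a. T k a * (\<Sum>\<^sub>7l m. w k l m * q a l m))"
  unfolding tr3_def sum_distrib_left
  by (simp only: mult.left_commute[of "w _ _ _"]) (rule sum.cong, rule refl, rule sum7_swap3[symmetric])

lemma tr3_2:
  "tr3 w (\<lambda>k l m. \<Sum>\<^sub>7a. T k l a * q a m) = (\<Sum>\<^sub>7a m. (\<Sum>\<^sub>7k l. T k l a * w k l m) * q a m)"
proof -
  have "tr3 w (\<lambda>k l m. \<Sum>\<^sub>7a. T k l a * q a m) = (\<Sum>\<^sub>7k l m a. T k l a * w k l m * q a m)"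
    unfolding tr3_def sum_distrib_left by (simp only: mult_ac)
  also have "\<dots> = (\<Sum>\<^sub>7m a k l. T k l a * w k l m * q a m)"
    by (rule sum7_swap4)
  also have "\<dots> = (\<Sum>\<^sub>7a m k l. T k l a * w k l m * q a m)"
    by (rule sum.swap)
  finally show ?thesis unfolding sum_distrib_right .
qed

lemma skew3_ph: "skew3 ph"
  unfolding skew3_def using ph_skew12 ph_skew23 by blast

lemma skew3_ps: "skew3 (\<lambda>i j k. ps i j k f)"
  unfolding skew3_def using ps_skew12 ps_skew23 by blast

lemma ph_ps': "(\<Sum>\<^sub>7l m. ph k l m * ps a j l m) = 4 * ph k a j"
proof -
  have "ps a j l m = ps l m a j" for l m by (rule ps_pair)
  then show ?thesis by (simp only: ph_ps)
qed

lemma sum7_skew_part: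
  assumes "\<And>i j. q j i = - q i j"
  shows "(\<Sum>\<^sub>7i j. (M i j - M j i) * q i j) = 2 * (\<Sum>\<^sub>7i j. M i j * q i j)"
proof -
  have "(\<Sum>\<^sub>7i j. M j i * q i j) = (\<Sum>\<^sub>7i j. M i j * q j i)" by (rule sum.swap)
  also have "\<dots> = - (\<Sum>\<^sub>7i j. M i j * q i j)"
  proof -
    have "M i j * q j i = - (M i j * q i j)" for i j unfolding assms[of i j] by simp
    then show ?thesis by (simp only: sum_negf)
  qed
  finally show ?thesis unfolding left_diff_distrib sum_subtractf by simp
qed

text \<open>Hypothesis \<open>F\<close> is the integrability equation in frame components, with
  \<open>d*\<phi>\<close> expressed by the torsion. One contraction with \<open>ph\<close> gives a
  linear relation between the skew part of \<open>phc T\<close>, the vector \<open>v\<close> and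
  \<open>th\<close>; a second one determines \<open>v\<close>.\<close>

lemma skew_part_phc:
  fixes th :: "7 \<Rightarrow> real"
  defines "X \<equiv> \<lambda>T i j k l m. \<Sum>\<^sub>7a. T i j a * ps a k l m"
  assumes T: "skew3 T" and F: "\<And>i j k l m.
     X T i j k l m - X T i k j l m + X T i l j k m - X T i m j k l + X T j k i l m - X T j l i k m
     + X T j m i k l + X T k l i j m - X T k m i j l + X T l m i j k =
     th i * ps j k l m - th j * ps i k l m + th k * ps i j l m - th l * ps i j k m + th m * ps i j k l"
  shows "phc T i j - phc T j i = - 2 * (\<Sum>\<^sub>7k. th k * ph k i j)"
proof -
  let ?N = "\<lambda>i j. phc T i j - phc T j i"
  define v where "v p = (\<Sum>\<^sub>7a m. phc T a m * ph p a m)" for p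
  have c0: "tr3 ph (\<lambda>k l m. ps a k l m) = 0" for a
    unfolding tr3_def ph_ps' by simp
  have th: "tr3 ph (\<lambda>k l m. th k * ps i j l m) = 4 * (\<Sum>\<^sub>7k. th k * ph k i j)" for i j
    unfolding tr3_def mult.left_commute[of "ph _ _ _"] sum_distrib_left[symmetric] ph_ps'
    by (simp only: mult.left_commute[of _ 4] sum_distrib_left[symmetric])
  have X1: "tr3 ph (\<lambda>k l m. X T i j k l m) = 0" for i j
    unfolding X_def tr3_sum c0 by simp
  have X2: "tr3 ph (\<lambda>k l m. X T i k j l m) = 4 * phc T i j" for i j
  proof -
    have "ph k a j = ph j k a" for k a by (rule ph_cyc)
    then show ?thesis
      unfolding X_def tr3_1 ph_ps' phc_def by (simp only: mult.left_commute[of _ 4] sum_distrib_left[symmetric])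
  qed
  have X3: "tr3 ph (\<lambda>k l m. X T k l i j m) = (\<Sum>\<^sub>7a m. phc T a m * ps a m i j)" for i j
  proof -
    have "T k l a * ph k l m = T a k l * ph m k l" for k l a m
      using skew3_cyc[OF T, of k l a] ph_cyc[of k l m] by simp
    moreover have "ps a i j m = ps a m i j" for a m
      using ps_skew34[of a i j m] ps_skew23[of a i m j] by simp
    ultimately show ?thesis unfolding X_def tr3_2 phc_def by (simp only:)
  qed
  note w = skew3_ph
  have phc_ps: "(\<Sum>\<^sub>7a m. phc T a m * ps a m i j) = (\<Sum>\<^sub>7p. v p * ph p i j) - ?N i j" for i j
    using ph_ph_12[of "phc T" i j] unfolding sum7_into[symmetric] v_def by simp
  \<comment> \<open>The term with \<open>T i j\<close> drops out. The three terms with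
    \<open>T i\<close> and the three with \<open>T j\<close> contribute 4 each, hence the 12 in
    front of the skew part. The three terms where \<open>T\<close> carries two of \<open>k\<close>,
    \<open>l\<close>, \<open>m\<close> give equal contractions with \<open>ps\<close>, and the three
    surviving terms with \<open>th\<close> give 4 each.\<close>
  have G: "- 12 * ?N i j + 3 * ((\<Sum>\<^sub>7p. v p * ph p i j) - ?N i j) = 12 * (\<Sum>\<^sub>7k. th k * ph k i j)" for i j
  proof -
    have "tr3 ph (\<lambda>k l m. X T i j k l m - X T i k j l m + X T i l j k m - X T i m j k l + X T j k i l m - X T j l i k m
     + X T j m i k l + X T k l i j m - X T k m i j l + X T l m i j k) =
     tr3 ph (\<lambda>k l m. th i * ps j k l m - th j * ps i k l m + th k * ps i j l m - th l * ps i j k m + th m * ps i j k l)"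
      unfolding F ..
    moreover have "tr3 ph (\<lambda>k l m. X T i l j k m) = - 4 * phc T i j" for i j
      using tr3_swap12[OF w, of "\<lambda>k l m. X T i k j l m"] X2 by simp
    moreover have "tr3 ph (\<lambda>k l m. X T i m j k l) = 4 * phc T i j" for i j
      using tr3_cyc(1)[OF w, of "\<lambda>k l m. X T i k j l m"] X2 by simp
    moreover have "tr3 ph (\<lambda>k l m. X T k m i j l) = - (\<Sum>\<^sub>7a m. phc T a m * ps a m i j)" for i j
      using tr3_swap23[OF w, of "\<lambda>k l m. X T k l i j m"] X3 by simp
    moreover have "tr3 ph (\<lambda>k l m. X T l m i j k) = (\<Sum>\<^sub>7a m. phc T a m * ps a m i j)" for i j
      using tr3_cyc(2)[OF w, of "\<lambda>k l m. X T k l i j m"] X3 by simp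
    moreover have "tr3 ph (\<lambda>k l m. th l * ps i j k m) = - 4 * (\<Sum>\<^sub>7k. th k * ph k i j)" for i j
      using tr3_swap12[OF w, of "\<lambda>k l m. th k * ps i j l m"] th by simp
    moreover have "tr3 ph (\<lambda>k l m. th m * ps i j k l) = 4 * (\<Sum>\<^sub>7k. th k * ph k i j)" for i j
      using tr3_cyc(1)[OF w, of "\<lambda>k l m. th k * ps i j l m"] th by simp
    ultimately show ?thesis
      unfolding phc_ps[symmetric] tr3_add tr3_diff by (simp add: X1 X2 X3 th tr3_cmult c0)
  qed
  \<comment> \<open>\<open>G\<close> contracted with \<open>ph\<close> reads - 24 v + 18 v - 6 v =
    72 th. Put back into \<open>G\<close>, this makes - 15 times the skew part equal to 30 times the
    contraction of \<open>th\<close> with \<open>ph\<close>.\<close>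
  have v: "v q = - 6 * th q" for q
  proof -
    have N: "(\<Sum>\<^sub>7i j. ?N i j * ph q i j) = 2 * v q"
      unfolding v_def by (rule sum7_skew_part) (rule ph_skew23)
    have P: "(\<Sum>\<^sub>7i j. (\<Sum>\<^sub>7p. u p * ph p i j) * ph q i j) = 6 * u q" for u :: "7 \<Rightarrow> real"
      unfolding sum7_out ph_norm by (simp add: mult.left_commute[of _ 6] flip: sum_distrib_left)
    have "(\<Sum>\<^sub>7i j. (- 12 * ?N i j + 3 * ((\<Sum>\<^sub>7p. v p * ph p i j) - ?N i j)) * ph q i j) =
        (\<Sum>\<^sub>7i j. (12 * (\<Sum>\<^sub>7k. th k * ph k i j)) * ph q i j)"
      unfolding G ..
    then have "- 12 * (2 * v q) + 3 * (6 * v q - 2 * v q) = 12 * (6 * th q)"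
      unfolding distrib_right left_diff_distrib[of "_ * _" "_ - _"] mult.assoc sum.distrib
        sum_distrib_left[symmetric] P
        left_diff_distrib[of "\<Sum>\<^sub>7p. v p * ph p _ _"] sum_subtractf N by simp
    then show ?thesis by simp
  qed
  show ?thesis using G[of i j] unfolding v mult.assoc sum_distrib_left[symmetric] by simp
qed

text \<open>Contracting the hypothesis with \<open>ps\<close> over \<open>c\<close>,
  \<open>d\<close>, \<open>e\<close> turns each of its three terms into -4 times the contraction of
  \<open>X\<close> with \<open>ph\<close>. It is applied to the curvature, which annihilates
  \<open>\<phi>\<close>.\<close>

lemma stabilizer_ph:
  assumes D: "\<And>c d e. (\<Sum>\<^sub>7a. X c a * ph a d e) + (\<Sum>\<^sub>7a. X d a * ph c a e) + (\<Sum>\<^sub>7a. X e a * ph c d a) = 0"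
  shows "(\<Sum>\<^sub>7c a. X c a * ph k c a) = 0"
proof -
  let ?Y = "\<lambda>c d e. \<Sum>\<^sub>7a. X c a * ph a d e"
  let ?w = "\<lambda>c d e. ps c d e k"
  have Y: "tr3 ?w ?Y = - 4 * (\<Sum>\<^sub>7c a. X c a * ph k c a)"
  proof -
    have "(\<Sum>\<^sub>7d e. ps c d e k * ph a d e) = - (4 * ph k c a)" for c a
    proof -
      have "ps c d e k * ph a d e = ph a d e * ps d e c k" for d e
        using ps_cyc[of d e c k] by simp
      then have "(\<Sum>\<^sub>7d e. ps c d e k * ph a d e) = 4 * ph a c k"
        by (simp only: ph_ps)
      then show ?thesis using ph_skew13[of a c k] by simp
    qed
    then show ?thesis
      unfolding tr3_1 by (simp add: sum_negf mult.left_commute[of _ 4] flip: sum_distrib_left)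
  qed
  have "tr3 ?w (\<lambda>c d e. ?Y c d e + (\<Sum>\<^sub>7a. X d a * ph c a e) + (\<Sum>\<^sub>7a. X e a * ph c d a)) = 0"
    unfolding D by (simp add: tr3_def)
  moreover have "tr3 ?w (\<lambda>c d e. \<Sum>\<^sub>7a. X d a * ph c a e) = tr3 ?w ?Y"
  proof -
    have "(\<Sum>\<^sub>7a. X d a * ph c a e) = - ?Y d c e" for c d e
      by (subst ph_skew12) (simp add: sum_negf)
    then have "tr3 ?w (\<lambda>c d e. \<Sum>\<^sub>7a. X d a * ph c a e) = - tr3 ?w (\<lambda>c d e. ?Y d c e)"
      using tr3_cmult[of ?w "-1" "\<lambda>c d e. ?Y d c e"] by simp
    then show ?thesis unfolding tr3_swap12[OF skew3_ps, of k ?Y] by simp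
  qed
  moreover have "tr3 ?w (\<lambda>c d e. \<Sum>\<^sub>7a. X e a * ph c d a) = tr3 ?w ?Y"
  proof -
    have "ph c d a = ph a c d" for c d a using ph_cyc[of c d a] by simp
    then show ?thesis using tr3_cyc(1)[OF skew3_ps, of k ?Y] by simp
  qed
  ultimately show ?thesis unfolding tr3_add Y by simp
qed

definition sigma4 :: "(7 \<Rightarrow> 7 \<Rightarrow> 7 \<Rightarrow> real) \<Rightarrow> 7 \<Rightarrow> 7 \<Rightarrow> 7 \<Rightarrow> 7 \<Rightarrow> real" where
  "sigma4 T i j k l = (\<Sum>\<^sub>7a. T i j a * T a k l) + (\<Sum>\<^sub>7a. T j k a * T a i l) + (\<Sum>\<^sub>7a. T k i a * T a j l)"

text \<open>The products \<open>P\<close> are skew within each pair of indices and symmetric under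
  exchange of the pairs. Up to these symmetries only three products remain, and the cyclic shift
  changes the sign of their sum.\<close>

lemma sigma4_rot:
  assumes T: "skew3 T"
  shows "sigma4 T j k l i = - sigma4 T i j k l"
proof -
  define P where "P i j k l = (\<Sum>\<^sub>7a. T i j a * T a k l)" for i j k l
  have P12: "P j i k l = - P i j k l" for i j k l
    unfolding P_def by (subst skew3_12[OF T]) (simp add: sum_negf)
  have P34: "P i j l k = - P i j k l" for i j k l
    unfolding P_def by (subst (2) skew3_23[OF T]) (simp add: sum_negf)
  have Pp: "P k l i j = P i j k l" for i j k l
  proof -
    have "T k l a * T a i j = T i j a * T a k l" for a
      using skew3_cyc[OF T, of k l a] skew3_cyc[OF T, of i j a] by simp
    then show ?thesis unfolding P_def by simp
  qed
  show ?thesis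
    unfolding sigma4_def P_def[symmetric]
    using P12[of j k i l] P34[of i j k l] Pp[of k l i j] P12[of j k l i] Pp[of k i j l] P12[of i k l j]
      P34[of k i j l] Pp[of k l j i] Pp[of l j k i] P34[of j k i l] P12[of l j k i] P12[of k i l j] P12[of i k j l]
      Pp[of i j k l] P34[of i j l k] P12[of i j k l] P34[of i k l j] Pp[of j l k i] Pp[of l j i k]
      P34[of j l i k] P34[of l j i k] P12[of j l i k] P12[of j l k i] Pp[of k i l j]
      Pp[of i k l j] Pp[of i k j l]
    by linarith
qed

text \<open>\<open>A\<close> is to be read as \<open>\<nabla>T\<close>, with the direction of differentiation as the first index.\<close>

locale skew_torsion_curvature =
  fixes T :: "7 \<Rightarrow> 7 \<Rightarrow> 7 \<Rightarrow> real" and R A :: "7 \<Rightarrow> 7 \<Rightarrow> 7 \<Rightarrow> 7 \<Rightarrow> real"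
  assumes T: "skew3 T" and A: "\<And>i. skew3 (A i)"
    and R12: "\<And>i j k l. R j i k l = - R i j k l" and R34: "\<And>i j k l. R i j l k = - R i j k l"
    and bianchi: "\<And>i j k l. R i j k l + R j k i l + R k i j l =
       A i j k l + A j k i l + A k i j l + sigma4 T i j k l"
    and instanton: "\<And>k l m. (\<Sum>\<^sub>7i j. R i j k l * ph m i j) = 0"
    and g2: "\<And>i j m. (\<Sum>\<^sub>7k l. R i j k l * ph m k l) = 0"
begin

text \<open>The usual derivation of pair symmetry from four cyclic shifts of the Bianchi identity.
  The \<open>sigma4\<close> terms cancel because a shift changes their sign; the derivatives of the
  torsion remain as the defect.\<close>

lemma R_pair: "R i j k l - R k l i j = 1/2 * (A i j k l - A j i k l - A k i j l + A l i j k)"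
proof -
  have s: "sigma4 T i j k l - sigma4 T j k l i - sigma4 T k l i j + sigma4 T l i j k = 0" for i j k l
    using sigma4_rot[OF T, of j k l i] sigma4_rot[OF T, of k l i j] sigma4_rot[OF T, of l i j k] by simp
  define E where "E i j k l = A i j k l + A j k i l + A k i j l" for i j k l
  have b: "2 * (R j k i l - R i l j k) = E i j k l - E j k l i - E k l i j + E l i j k" for i j k l
    using bianchi[of i j k l] bianchi[of j k l i] bianchi[of k l i j] bianchi[of l i j k] s[of i j k l]
      R34[of j k l i] R34[of k l j i] R12[of l j k i] R12[of l i k j] R34[of i l k j] R12[of i k l j]
      R34[of k i l j] R12[of l i j k] R34[of i j l k] R34[of j l i k]
    unfolding E_def by algebra
  have e: "E k i j l - E i j l k - E j l k i + E l k i j = A i j k l - A j i k l - A k i j l + A l i j k"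
    using skew3_23[OF A, of i j l k] skew3_13[OF A, of i l k j] skew3_12[OF A, of j k i l]
      skew3_13[OF A, of j l i k] skew3_13[OF A, of j l k i] skew3_cyc[OF A, of k j l i]
      skew3_23[OF A, of k i l j] skew3_13[OF A, of l k j i] skew3_cyc[OF A, of l i j k]
    unfolding E_def by linarith
  show ?thesis using b[of i j k l] e by simp
qed

text \<open>A 2-form annihilated by \<open>ph\<close> is an eigenvector of contraction with
  \<open>ps\<close>, by \<open>ph_ph_12\<close>; this is the description of g2 as an eigenspace in
  the 2-forms.\<close>

lemma R_ps: "(\<Sum>\<^sub>7i j. R i j k l * ps i j m n) = - 2 * R m n k l"
  using ph_ph_12[of "\<lambda>i j. R i j k l" m n] R12[of n m k l]
  unfolding sum7_into[symmetric] instanton by simp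

text \<open>Both pairs of indices of \<open>R\<close> are annihilated by \<open>ph\<close>, the
  first by \<open>instanton\<close> and the second by \<open>g2\<close>; hence so is the defect in
  \<open>R_pair\<close>. The result is hypothesis \<open>Z\<close> of
  \<open>symmetric_derivative\<close>.\<close>

lemma A_contr: "2 * (\<Sum>\<^sub>7i j. A i j k l * ph i j m) = phc (A k) l m - phc (A l) k m"
proof -
  have p: "ph m i j = ph i j m" for i j by (rule ph_cyc[symmetric])
  have "(\<Sum>\<^sub>7i j. (R i j k l - R k l i j) * ph m i j) = 0"
    unfolding left_diff_distrib sum_subtractf instanton g2 by simp
  then have "(\<Sum>\<^sub>7i j. (A i j k l - A j i k l - A k i j l + A l i j k) * ph m i j) = 0"
    unfolding R_pair mult.assoc sum_distrib_left[symmetric] by simp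
  moreover have "(\<Sum>\<^sub>7i j. A j i k l * ph m i j) = - (\<Sum>\<^sub>7i j. A i j k l * ph m i j)"
  proof -
    have "(\<Sum>\<^sub>7i j. A j i k l * ph m i j) = (\<Sum>\<^sub>7i j. A i j k l * ph m j i)" by (rule sum.swap)
    also have "\<dots> = (\<Sum>\<^sub>7i j. - (A i j k l * ph m i j))"
    proof -
      have "A i j k l * ph m j i = - (A i j k l * ph m i j)" for i j
        unfolding ph_skew23[of m j i] by simp
      then show ?thesis by simp
    qed
    finally show ?thesis by (simp add: sum_negf)
  qed
  moreover have "A k i j l = A k l i j" "A l i j k = A l k i j" for i j
    by (rule skew3_cyc[OF A])+
  ultimately show ?thesis
    unfolding left_diff_distrib distrib_right sum_subtractf sum.distrib phc_def p by simp
qed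

text \<open>Contract the Bianchi identity with \<open>ps\<close>: the three cyclic terms agree, and
  by \<open>R_ps\<close> each is twice the Ricci trace, whence the 6. The symmetry is pair symmetry,
  which is exact once \<open>A\<close> vanishes.\<close>

lemma ricci_sigma4:
  assumes A0: "\<And>i j k l. A i j k l = 0"
  shows "6 * (\<Sum>\<^sub>7a. R a p l a) = tr3 (\<lambda>i j k. ps i j k p) (\<lambda>i j k. sigma4 T i j k l)"
    "(\<Sum>\<^sub>7a. R a p l a) = (\<Sum>\<^sub>7a. R a l p a)"
proof -
  let ?w = "\<lambda>i j k. ps i j k p"
  have 1: "tr3 ?w (\<lambda>i j k. R i j k l) = 2 * (\<Sum>\<^sub>7a. R a p l a)"
  proof -
    have "tr3 ?w (\<lambda>i j k. R i j k l) = (\<Sum>\<^sub>7k i j. R i j k l * ps i j k p)"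
      unfolding tr3_def by (subst sum7_swap3[symmetric]) (simp only: mult.commute)
    also have "\<dots> = (\<Sum>\<^sub>7k. - 2 * R k p k l)" unfolding R_ps ..
    also have "\<dots> = (\<Sum>\<^sub>7k. 2 * R k p l k)"
    proof -
      have "- 2 * R k p k l = 2 * R k p l k" for k using R34[of k p l k] by simp
      then show ?thesis by (simp only:)
    qed
    finally show ?thesis by (simp add: sum_distrib_left)
  qed
  have "tr3 ?w (\<lambda>i j k. R i j k l + R j k i l + R k i j l) = tr3 ?w (\<lambda>i j k. sigma4 T i j k l)"
    unfolding bianchi A0 by simp
  then show "6 * (\<Sum>\<^sub>7a. R a p l a) = tr3 ?w (\<lambda>i j k. sigma4 T i j k l)"
    unfolding tr3_add tr3_cyc[OF skew3_ps, of p "\<lambda>i j k. R i j k l"] 1 by simp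
  have "R a p l a = R a l p a" for a
    using R_pair[of a p l a] R12[of l a a p] R34[of a l a p] unfolding A0 by simp
  then show "(\<Sum>\<^sub>7a. R a p l a) = (\<Sum>\<^sub>7a. R a l p a)" by simp
qed

text \<open>\<open>B\<close> stands for \<open>\<nabla>H\<close> and \<open>C\<close> for \<open>\<nabla>\<nabla>H\<close>, so that \<open>ricci\<close> is the Ricci identity for \<open>H\<close>.\<close>

context
  fixes H :: "7 \<Rightarrow> 7 \<Rightarrow> real" and B :: "7 \<Rightarrow> 7 \<Rightarrow> 7 \<Rightarrow> real" and C :: "7 \<Rightarrow> 7 \<Rightarrow> 7 \<Rightarrow> 7 \<Rightarrow> real"
  assumes H: "H = (\<lambda>i j. phc T i j + phc T j i)"
    and B12: "\<And>i j k. B j i k = B i j k" and B23: "\<And>i j k. B i k j = B i j k"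
    and B_tr: "\<And>i. (\<Sum>\<^sub>7j. B i j j) = 0"
    and C23: "\<And>i j k l. C i k j l = C i j k l" and C34: "\<And>i j k l. C i j l k = C i j k l"
    and C_tr: "\<And>i j. (\<Sum>\<^sub>7k. C i j k k) = 0"
    and ricci: "\<And>i j k l. C i j k l - C j i k l =
      - (\<Sum>\<^sub>7m. R i j k m * H m l) - (\<Sum>\<^sub>7m. R i j l m * H k m) - (\<Sum>\<^sub>7m. T i j m * B m k l)"
begin

lemma H_sym: "H j i = H i j" unfolding H by simp

lemma contr_ricci:
  "(\<Sum>\<^sub>7i j. (C i j k l - C j i k l) * q i j) =
    - (\<Sum>\<^sub>7m. (\<Sum>\<^sub>7i j. R i j k m * q i j) * H m l) - (\<Sum>\<^sub>7m. (\<Sum>\<^sub>7i j. R i j l m * q i j) * H k m)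
    - (\<Sum>\<^sub>7m. (\<Sum>\<^sub>7i j. T i j m * q i j) * B m k l)"
proof -
  have *: "(\<Sum>\<^sub>7i j. (\<Sum>\<^sub>7m. F i j m * g m) * q i j) = (\<Sum>\<^sub>7m. (\<Sum>\<^sub>7i j. F i j m * q i j) * g m)" for F g
  proof -
    have "(\<Sum>\<^sub>7i j. (\<Sum>\<^sub>7m. F i j m * g m) * q i j) = (\<Sum>\<^sub>7i j m. F i j m * q i j * g m)"
      unfolding sum_distrib_right by (simp only: mult_ac)
    also have "\<dots> = (\<Sum>\<^sub>7m i j. F i j m * q i j * g m)" by (rule sum7_swap3[symmetric])
    finally show ?thesis unfolding sum_distrib_right .
  qed
  show ?thesis unfolding ricci left_diff_distrib mult_minus_left sum_subtractf sum_negf * ..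
qed

text \<open>\<open>C\<close> is symmetric in its second and third index by \<open>C23\<close>,
  against a contraction that is skew in them. It serves for both \<open>ph\<close> and
  \<open>ps\<close>.\<close>

lemma skew_contr_C:
  assumes "skew3 w"
  shows "tr3 w (\<lambda>i j k. C i j k l) = 0" "tr3 w (\<lambda>i j k. C j i k l) = 0"
proof -
  have "tr3 w (\<lambda>i j k. C i j k l) = - tr3 w (\<lambda>i j k. C i j k l)"
    using tr3_swap23[OF assms, of "\<lambda>i j k. C i j k l"] unfolding C23[of _ _ _ l] by simp
  then show "tr3 w (\<lambda>i j k. C i j k l) = 0" by simp
  then show "tr3 w (\<lambda>i j k. C j i k l) = 0"
    using tr3_swap12[OF assms, of "\<lambda>i j k. C i j k l"] by simp
qed

lemma tr3_C:
  assumes "skew3 w"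
  shows "(\<Sum>\<^sub>7k i j. (C i j k l - C j i k l) * w i j k) = 0"
proof -
  have "(\<Sum>\<^sub>7k i j. (C i j k l - C j i k l) * w i j k) = tr3 w (\<lambda>i j k. C i j k l - C j i k l)"
    unfolding tr3_def by (subst sum7_swap3[symmetric]) (simp only: mult.commute)
  then show ?thesis unfolding tr3_diff skew_contr_C[OF assms] by simp
qed

text \<open>The contraction of the Ricci identity with \<open>\<phi>\<close>: its left-hand side vanishes by the symmetry of \<open>B\<close>,
  its curvature terms by the instanton condition.\<close>

lemma H_B: "(\<Sum>\<^sub>7m k. H m k * B m k l) = 0"
proof -
  have "(\<Sum>\<^sub>7i j. R i j a b * ph i j c) = 0" for a b c
  proof -
    have "ph i j c = ph c i j" for i j by (rule ph_cyc)
    then show ?thesis using instanton[of a b c] by simp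
  qed
  moreover have "(\<Sum>\<^sub>7i j. T i j m * ph i j k) = phc T m k" for m k
  proof -
    have "T i j m * ph i j k = T m i j * ph k i j" for i j
      using ph_cyc[of i j k] skew3_cyc[OF T, of i j m] by simp
    then show ?thesis unfolding phc_def by simp
  qed
  ultimately have "(\<Sum>\<^sub>7k. \<Sum>\<^sub>7m. phc T m k * B m k l) = 0"
    using tr3_C[OF skew3_ph, of l] unfolding contr_ricci by (simp add: sum_negf)
  moreover have "(\<Sum>\<^sub>7m k. phc T m k * B m k l) = (\<Sum>\<^sub>7k m. phc T m k * B m k l)" by (rule sum.swap)
  moreover have "(\<Sum>\<^sub>7m k. phc T k m * B m k l) = (\<Sum>\<^sub>7k m. phc T m k * B m k l)"
    unfolding B12[of _ _ l] ..
  ultimately show ?thesis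
    unfolding H distrib_right sum.distrib by simp
qed

text \<open>Here \<open>D\<close> is the divergence of \<open>H_B\<close>. The contraction of the Ricci identity with \<open>*\<phi>\<close> expresses
  \<open>C\<^sub>i\<^sub>i\<^sub>p\<^sub>l\<close> by \<open>H\<close>, \<open>\<theta>\<close> and \<open>B\<close>, and the result is orthogonal to \<open>H\<close>. What remains of \<open>D\<close> is
  \<open>\<bar>B\<bar>\<^sup>2 = 0\<close>.\<close>

lemma B_eq_0:
  fixes th :: "7 \<Rightarrow> real"
  assumes N: "\<And>i j. phc T i j - phc T j i = - 2 * (\<Sum>\<^sub>7q. th q * ph q i j)"
    and D: "(\<Sum>\<^sub>7l m k. B l m k * B m k l + H m k * C l m k l) = 0"
  shows "B i j k = 0"
proof -
  have B13: "B k j i = B i j k" for i j k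
    using B12[of k j i] B23[of j k i] B12[of j i k] by simp
  define E where "E p l = (\<Sum>\<^sub>7k m. R k p k m * H m l + R k p l m * H k m)" for p l
  \<comment> \<open>By the symmetries, \<open>C i i p l\<close> equals \<open>C i p l i\<close>,
    while the trace of \<open>C p i l i\<close> over \<open>i\<close> vanishes. So the Laplacian is
    a trace of commutators, given by the Ricci identity; its torsion term pairs a skew tensor with a
    symmetric one.\<close>
  have D1: "(\<Sum>\<^sub>7i. C i i p l) = - E p l" for p l
  proof -
    have "C i i p l = C i p l i" "C p i l i = C p l i i" for i
      using C23[of i p i l] C34[of i p l i] C23[of p l i i] by simp_all
    then have "(\<Sum>\<^sub>7i. C i i p l) = (\<Sum>\<^sub>7i. C i p l i - C p i l i)"
      unfolding sum_subtractf using C_tr[of p l] by simp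
    moreover have "(\<Sum>\<^sub>7i m. T i p m * B m l i) = 0"
      by (rule sum7_skew'[OF B13 skew3_13[OF T]])
    moreover have "R i p i m * H l m = R i p i m * H m l" "R i p l m * H m i = R i p l m * H i m" for i m
      using H_sym[of l m] H_sym[of m i] by simp_all
    ultimately show ?thesis
      unfolding ricci E_def sum_subtractf sum.distrib by (simp add: sum_negf)
  qed
  \<comment> \<open>Contraction of the Ricci identity with \<open>ps\<close> over \<open>i\<close>,
    \<open>j\<close>, \<open>k\<close>: the left-hand side vanishes by \<open>tr3_C\<close>, and
    \<open>R_ps\<close> turns the curvature terms into \<open>2 * E\<close>.\<close>
  have E: "E p l = 1/2 * (\<Sum>\<^sub>7k m. (\<Sum>\<^sub>7a. phc T m a * ph a k p) * B m k l)" for p l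
  proof -
    have T_ps: "(\<Sum>\<^sub>7i j. T i j m * ps i j k p) = (\<Sum>\<^sub>7a. phc T m a * ph a k p) - 2 * T m k p" for k m
    proof -
      have "T i j m = T m i j" for i j by (rule skew3_cyc[OF T])
      then show ?thesis unfolding phc_ph using skew3_23[OF T, of m p k] by simp
    qed
    have "(\<Sum>\<^sub>7k m. T m k p * B m k l) = 0"
    proof (rule sum7_skew')
      show "B j i l = B i j l" for i j by (rule B12)
      show "T i j p = - T j i p" for i j by (rule skew3_12[OF T])
    qed
    then have "(\<Sum>\<^sub>7k m. 2 * T m k p * B m k l) = 0"
      by (simp add: mult.assoc flip: sum_distrib_left)
    moreover have "(\<Sum>\<^sub>7i j. (C i j k l - C j i k l) * ps i j k p) =
        2 * (\<Sum>\<^sub>7m. R k p k m * H m l + R k p l m * H k m)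
        - (\<Sum>\<^sub>7m. (\<Sum>\<^sub>7a. phc T m a * ph a k p) * B m k l) + (\<Sum>\<^sub>7m. 2 * T m k p * B m k l)" for k
      unfolding contr_ricci R_ps T_ps unfolding left_diff_distrib sum_subtractf mult.assoc sum_distrib_left[symmetric]
        sum.distrib by simp
    ultimately show ?thesis
      using tr3_C[OF skew3_ps, of l p] unfolding E_def
      by (simp add: sum.distrib sum_subtractf flip: sum_distrib_left)
  qed
  \<comment> \<open>\<open>phc T\<close> is half of \<open>H\<close> plus a skew part known from
    \<open>N\<close>. The latter yields three terms, of which symmetry and tracelessness of
    \<open>B\<close> leave one.\<close>
  have E': "E p l = 1/4 * (\<Sum>\<^sub>7k m. (\<Sum>\<^sub>7a. H m a * ph a k p) * B m k l) - 1/2 * (\<Sum>\<^sub>7k. th k * B p k l)" for p l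
  proof -
    have phc: "phc T m a = 1/2 * H m a - (\<Sum>\<^sub>7q. th q * ph q m a)" for m a
      using N[of m a] unfolding H by (simp add: field_simps)
    have 1: "(\<Sum>\<^sub>7a. (\<Sum>\<^sub>7q. th q * ph q m a) * ph a k p) =
        th k * kd m p - th p * kd m k + (\<Sum>\<^sub>7q. th q * ps q m k p)" for m k
    proof -
      have "ph q m a = ph a q m" for q a by (rule ph_cyc)
      then have "(\<Sum>\<^sub>7a. (\<Sum>\<^sub>7q. th q * ph q m a) * ph a k p) = (\<Sum>\<^sub>7q. th q * (\<Sum>\<^sub>7a. ph a q m * ph a k p))"
        unfolding sum7_assoc by simp
      then show ?thesis
        unfolding ph_ph distrib_left right_diff_distrib sum.distrib sum_subtractf
          mult.assoc[symmetric] sum_distrib_right[symmetric] by simp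
    qed
    have 2: "(\<Sum>\<^sub>7k m. (\<Sum>\<^sub>7q. th q * ps q m k p) * B m k l) = 0"
    proof (rule sum7_skew')
      show "B j i l = B i j l" for i j by (rule B12)
      show "(\<Sum>\<^sub>7q. th q * ps q i j p) = - (\<Sum>\<^sub>7q. th q * ps q j i p)" for i j
        by (subst ps_skew23) (simp add: sum_negf)
    qed
    have 3: "(\<Sum>\<^sub>7k m. th k * kd m p * B m k l) = (\<Sum>\<^sub>7k. th k * B p k l)"
      by (simp add: mult.assoc flip: sum_distrib_left)
    have 4: "(\<Sum>\<^sub>7k m. th p * kd m k * B m k l) = 0"
      using B_tr[of l] B13[of l] by (simp add: mult.assoc flip: sum_distrib_left)
    have eq: "(\<Sum>\<^sub>7a. phc T m a * ph a k p) = 1/2 * (\<Sum>\<^sub>7a. H m a * ph a k p) -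
        (th k * kd m p - th p * kd m k + (\<Sum>\<^sub>7q. th q * ps q m k p))" for m k
      unfolding 1[symmetric] phc left_diff_distrib sum_subtractf mult.assoc sum_distrib_left ..
    show ?thesis
      unfolding E eq
      unfolding left_diff_distrib distrib_right sum_subtractf sum.distrib 2 3 4 mult.assoc[of "1/2"]
        sum_distrib_left[of "1/2", symmetric] by simp
  qed
  have HE: "(\<Sum>\<^sub>7p l. H p l * E p l) = 0"
  proof -
    \<comment> \<open>Exchanging the names \<open>m\<close> and \<open>l\<close> shows, by the total
      symmetry of \<open>B\<close>, that the factor in front of \<open>ph a k p\<close> is symmetric
      in \<open>a\<close> and \<open>p\<close>.\<close>
    have 1: "(\<Sum>\<^sub>7p l. H p l * (\<Sum>\<^sub>7k m. (\<Sum>\<^sub>7a. H m a * ph a k p) * B m k l)) = 0"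
    proof -
      have "(\<Sum>\<^sub>7p l. H p l * (\<Sum>\<^sub>7k m. (\<Sum>\<^sub>7a. H m a * ph a k p) * B m k l)) =
          (\<Sum>\<^sub>7p l k m a. H m a * H p l * B m k l * ph a k p)"
        unfolding sum_distrib_left sum_distrib_right by (simp only: mult_ac)
      also have "\<dots> = (\<Sum>\<^sub>7k m p l a. H m a * H p l * B m k l * ph a k p)"
        by (rule sum7_swap4)
      also have "\<dots> = (\<Sum>\<^sub>7k a p m l. H m a * H p l * B m k l * ph a k p)"
        by (rule sum.cong, rule refl, rule trans[OF _ sum7_swap3], rule sum.cong, rule refl,
            rule sum7_swap3[symmetric])
      also have "\<dots> = (\<Sum>\<^sub>7k a p. (\<Sum>\<^sub>7m l. H m a * H p l * B m k l) * ph a k p)"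
        unfolding sum_distrib_right ..
      also have "\<dots> = 0"
      proof (rule sum.neutral, rule ballI, rule sum7_skew)
        show "ph j k i = - ph i k j" for i j k by (rule ph_skew13)
        show "(\<Sum>\<^sub>7m l. H m j * H i l * B m k l) = (\<Sum>\<^sub>7m l. H m i * H j l * B m k l)" for i j k
        proof -
          have "H m j * H i l * B m k l = H l i * H j m * B l k m" for m l
            using H_sym[of l i] H_sym[of m j] B13[of l k m] by simp
          then show ?thesis by (simp only:) (rule sum.swap)
        qed
      qed
      finally show ?thesis .
    qed
    have "(\<Sum>\<^sub>7p l. H p l * (\<Sum>\<^sub>7k. th k * B p k l)) = (\<Sum>\<^sub>7p l k. th k * (H p l * B p k l))"
      unfolding sum_distrib_left by (simp only: mult_ac)
    also have "\<dots> = (\<Sum>\<^sub>7k p l. th k * (H p l * B p k l))"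
      by (rule sum7_swap3[symmetric])
    also have "\<dots> = 0"
    proof -
      have "(\<Sum>\<^sub>7p l. H p l * B p k l) = 0" for k
      proof -
        have "B p l k = B p k l" for p l by (rule B23)
        then show ?thesis using H_B[of k] by (simp only:)
      qed
      then show ?thesis by (simp only: sum_distrib_left[symmetric]) simp
    qed
    finally have 2: "(\<Sum>\<^sub>7p l. H p l * (\<Sum>\<^sub>7k. th k * B p k l)) = 0" .
    have "H p l * E p l = 1/4 * (H p l * (\<Sum>\<^sub>7k m. (\<Sum>\<^sub>7a. H m a * ph a k p) * B m k l))
        - 1/2 * (H p l * (\<Sum>\<^sub>7k. th k * B p k l))" for p l
      unfolding E' right_diff_distrib by simp
    then show ?thesis
      by (simp only: sum_subtractf sum_distrib_left[symmetric] 1 2)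
  qed
  have "(\<Sum>\<^sub>7l m k. H m k * C l m k l) = - (\<Sum>\<^sub>7m k. H m k * E m k)"
  proof -
    have "C l m k l = C l l m k" for l m k
      using C34[of l m k l] C23[of l m l k] by simp
    then have "(\<Sum>\<^sub>7l m k. H m k * C l m k l) = (\<Sum>\<^sub>7m k. H m k * (\<Sum>\<^sub>7l. C l l m k))"
      unfolding sum_distrib_left by (simp only: sum7_swap3[of "\<lambda>l m k. H m k * C l l m k"])
    then show ?thesis unfolding D1 by (simp add: sum_negf)
  qed
  then have "(\<Sum>\<^sub>7l m k. B l m k * B m k l) = 0"
    using D unfolding sum.distrib HE by simp
  moreover have "B l m k * B m k l = (B l m k)\<^sup>2" for l m k
    using B23[of m l k] B12[of l m k] by (simp add: power2_eq_square)
  ultimately have "(\<Sum>\<^sub>7l m k. (B l m k)\<^sup>2) = 0" by simp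
  then show ?thesis by (simp add: sum_nonneg_eq_0_iff sum_nonneg)
qed

end

end

section \<open>Exterior algebra in a frame\<close>

lemma alternating_swap:
  assumes "alternating p \<alpha>" "length I = p" "j \<noteq> k" "j < p" "k < p"
  shows "\<alpha> (I[j := I ! k, k := I ! j]) = - \<alpha> I"
proof (cases "j < k")
  case True
  then show ?thesis using assms unfolding alternating_def by blast
next
  case False
  then have "\<alpha> (I[k := I ! j, j := I ! k]) = - \<alpha> I"
    using assms unfolding alternating_def by auto
  then show ?thesis using assms(3) by (simp add: list_update_swap)
qed

lemma sign_transpose_comp:
  assumes "p permutes S" "finite S"
  shows "sign (Transposition.transpose a b \<circ> p) = (if a = b then 1 else - 1) * sign p"
proof -
  have "permutation p" using assms permutation_permutes by blast
  then show ?thesis by (simp add: sign_compose permutation_swap_id sign_swap_id)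
qed

lemma nth_transpose:
  assumes "a < length I" "b < length I" "i < length I"
  shows "I ! Transposition.transpose a b i = I[a := I ! b, b := I ! a] ! i"
  using assms by (auto simp: transpose_def nth_list_update)

text \<open>The permuted positions start at \<open>m\<close> because the slots of the second factor
  in a \<open>wedge\<close> do not start at 0.\<close>

lemma alternating_permute:
  assumes \<alpha>: "alternating n \<alpha>" and q: "q permutes {m..<m+n}" and I: "length I = m + n"
  shows "\<alpha> (map (\<lambda>j. I ! q j) [m..<m+n]) = of_int (sign q) * \<alpha> (drop m I)"
  using q finite_atLeastLessThan I
proof (induction arbitrary: I rule: permutes_induct)
  case id
  have "map (\<lambda>j. I ! id j) [m..<m+n] = drop m I"
    using id by (intro nth_equalityI) auto
  then show ?case by simp
next
  case (swap a b p)
  define I' where "I' = I[a := I ! b, b := I ! a]"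
  have m: "map (\<lambda>j. I ! (Transposition.transpose a b \<circ> p) j) [m..<m+n] = map (\<lambda>j. I' ! p j) [m..<m+n]"
  proof (rule map_cong[OF refl])
    fix j assume "j \<in> set [m..<m+n]"
    then have "p j \<in> {m..<m+n}" using swap.hyps permutes_in_image by fastforce
    then show "I ! (Transposition.transpose a b \<circ> p) j = I' ! p j"
      unfolding I'_def o_def using swap by (intro nth_transpose) auto
  qed
  moreover have "\<alpha> (map (\<lambda>j. I ! (Transposition.transpose a b \<circ> p) j) [m..<m+n]) = of_int (sign p) * \<alpha> (drop m I')"
    unfolding m by (rule swap.IH) (simp add: I'_def swap.prems)
  moreover have d: "drop m I' = (drop m I)[a - m := drop m I ! (b - m), b - m := drop m I ! (a - m)]"
    unfolding I'_def using swap by (simp add: drop_update_swap)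
  moreover have "\<alpha> (drop m I') = - \<alpha> (drop m I)"
    unfolding d by (rule alternating_swap[OF \<alpha>]) (use swap.hyps swap.prems in auto)
  moreover have "sign (Transposition.transpose a b \<circ> p) = - sign p"
    using swap.hyps by (simp add: sign_transpose_comp)
  ultimately show ?case by (simp only: mult_minus_left mult_minus_right of_int_minus)
qed

text \<open>Every permutation is uniquely a transposition of 0 with some \<open>b\<close>, composed
  with a permutation \<open>q\<close> fixing 0. The sum over \<open>q\<close> consists of
  \<open>fact n\<close> equal terms and cancels the normalisation. Putting \<open>I ! 0\<close> in
  place \<open>b\<close>, instead of deleting that place, gives all correction terms the same
  sign.\<close>

lemma wedge_1:
  assumes \<beta>: "alternating n \<beta>" and I: "length I = Suc n"
  shows "wedge 1 n \<alpha> \<beta> I = \<alpha> [I ! 0] * \<beta> (tl I) - (\<Sum>b<n. \<alpha> [I ! Suc b] * \<beta> ((tl I)[b := I ! 0]))"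
proof -
  let ?S = "{1..<1+n}"
  define f where "f \<pi> = of_int (sign \<pi>) * \<alpha> (map (\<lambda>k. I ! \<pi> k) [0..<1]) * \<beta> (map (\<lambda>k. I ! \<pi> k) [1..<1+n])" for \<pi>
  have f: "f (Transposition.transpose 0 b \<circ> q) = (if b = 0 then 1 else - 1) * \<alpha> [I ! b] * \<beta> (tl (I[0 := I ! b, b := I ! 0]))"
    if b: "b \<in> insert 0 ?S" and q: "q permutes ?S" for b q
  proof -
    let ?I = "I[0 := I ! b, b := I ! 0]"
    have q0: "q 0 = 0" using q by (simp add: permutes_not_in)
    have m: "map (\<lambda>k. I ! (Transposition.transpose 0 b \<circ> q) k) [1..<1+n] = map (\<lambda>k. ?I ! q k) [1..<1+n]"
    proof (rule map_cong[OF refl])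
      fix j assume "j \<in> set [1..<1+n]"
      then have "q j \<in> ?S" using q permutes_in_image by fastforce
      then show "I ! (Transposition.transpose 0 b \<circ> q) j = ?I ! q j"
        unfolding o_def using b I by (intro nth_transpose) auto
    qed
    have "\<beta> (map (\<lambda>k. I ! (Transposition.transpose 0 b \<circ> q) k) [1..<1+n]) = of_int (sign q) * \<beta> (drop 1 ?I)"
      unfolding m by (rule alternating_permute[OF \<beta> q]) (simp add: I)
    moreover have "sign (Transposition.transpose 0 b \<circ> q) = (if b = 0 then 1 else - 1) * sign q"
      using sign_transpose_comp[OF q] by auto
    moreover have "of_int (sign q) * (of_int (sign q) :: real) = 1"
      by (metis of_int_1 of_int_mult sign_idempotent)
    ultimately show ?thesis unfolding f_def by (simp add: q0 drop_Suc)
  qed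
  have "{..<1+n} = insert 0 ?S" by auto
  then have "(\<Sum>\<pi> | \<pi> permutes {..<1+n}. f \<pi>) = (\<Sum>b\<in>insert 0 ?S. \<Sum>q | q permutes ?S. f (Transposition.transpose 0 b \<circ> q))"
    using sum_over_permutations_insert[of ?S 0 f] by simp
  also have "\<dots> = (\<Sum>b\<in>insert 0 ?S. \<Sum>q | q permutes ?S.
      (if b = 0 then 1 else - 1) * \<alpha> [I ! b] * \<beta> (tl (I[0 := I ! b, b := I ! 0])))"
    by (intro sum.cong refl f) auto
  also have "\<dots> = fact n * (\<Sum>b\<in>insert 0 ?S. (if b = 0 then 1 else - 1) * \<alpha> [I ! b] * \<beta> (tl (I[0 := I ! b, b := I ! 0])))"
  proof -
    have "card {q. q permutes ?S} = fact n" by (rule card_permutations) auto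
    then show ?thesis by (simp only: sum_constant sum_distrib_left of_nat_fact)
  qed
  also have "(\<Sum>b\<in>insert 0 ?S. (if b = 0 then 1 else - 1) * \<alpha> [I ! b] * \<beta> (tl (I[0 := I ! b, b := I ! 0]))) =
     \<alpha> [I ! 0] * \<beta> (tl I) + (\<Sum>b\<in>?S. - (\<alpha> [I ! b] * \<beta> (tl (I[0 := I ! b, b := I ! 0]))))"
    by (subst sum.insert) (auto intro!: sum.cong)
  also have "(\<Sum>b\<in>?S. - (\<alpha> [I ! b] * \<beta> (tl (I[0 := I ! b, b := I ! 0])))) = - (\<Sum>b<n. \<alpha> [I ! Suc b] * \<beta> ((tl I)[b := I ! 0]))"
    unfolding sum_negf
    by (intro arg_cong[of _ _ uminus] sum.reindex_bij_witness[of _ Suc "\<lambda>b. b - 1"])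
      (use I in \<open>auto simp: list_update_code tl_def neq_Nil_conv split: list.splits nat.splits\<close>)
  finally show ?thesis unfolding wedge_def f_def by simp
qed

lemma alternating_wedge: "alternating (p + q) (wedge p q \<alpha> \<beta>)"
  unfolding alternating_def
proof (intro allI impI)
  fix I :: "7 list" and j k assume *: "length I = p + q \<and> j < k \<and> k < p + q"
  let ?I = "I[j := I ! k, k := I ! j]" and ?S = "{..<p + q}"
  define f where "f I \<pi> = of_int (sign \<pi>) * \<alpha> (map (\<lambda>k. I ! \<pi> k) [0..<p]) * \<beta> (map (\<lambda>k. I ! \<pi> k) [p..<p+q])"
    for I :: "7 list" and \<pi>
  have t: "Transposition.transpose j k permutes ?S" using * by (intro permutes_swap_id) auto
  have "f I (Transposition.transpose j k \<circ> \<pi>) = - f ?I \<pi>" if \<pi>: "\<pi> permutes ?S" for \<pi>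
  proof -
    have "I ! (Transposition.transpose j k \<circ> \<pi>) i = ?I ! \<pi> i" if "i < p + q" for i
      unfolding o_def using * that permutes_in_image[OF \<pi>, of i] by (intro nth_transpose) auto
    then have m: "map (\<lambda>i. I ! (Transposition.transpose j k \<circ> \<pi>) i) [0..<p] = map (\<lambda>i. ?I ! \<pi> i) [0..<p]"
      "map (\<lambda>i. I ! (Transposition.transpose j k \<circ> \<pi>) i) [p..<p+q] = map (\<lambda>i. ?I ! \<pi> i) [p..<p+q]"
      by auto
    have "sign (Transposition.transpose j k \<circ> \<pi>) = - sign \<pi>"
      using sign_transpose_comp[OF \<pi>] * by auto
    then show ?thesis unfolding f_def m by simp
  qed
  then have "(\<Sum>\<pi> | \<pi> permutes ?S. f I (Transposition.transpose j k \<circ> \<pi>)) = - (\<Sum>\<pi> | \<pi> permutes ?S. f ?I \<pi>)"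
    by (simp add: sum_negf)
  moreover have "(\<Sum>\<pi> | \<pi> permutes ?S. f I \<pi>) = (\<Sum>\<pi> | \<pi> permutes ?S. f I (Transposition.transpose j k \<circ> \<pi>))"
    using setum_permutations_compose_left[OF t, of "f I"] by simp
  ultimately show "wedge p q \<alpha> \<beta> ?I = - wedge p q \<alpha> \<beta> I"
    unfolding wedge_def f_def by simp
qed

lemma alternating_wedge_list: "alternating (length es) (wedge_list es)"
proof (cases es)
  case Nil
  then show ?thesis by (simp add: alternating_def)
next
  case (Cons e es')
  then show ?thesis using alternating_wedge[of 1 "length es'"] by simp
qed

lemma wedge_list_Cons:
  assumes "length I = Suc (length es)"
  shows "wedge_list (e # es) I = e [I ! 0] * wedge_list es (tl I) -
    (\<Sum>b<length es. e [I ! Suc b] * wedge_list es ((tl I)[b := I ! 0]))"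
  using wedge_1[OF alternating_wedge_list assms] by simp

lemma frl_permute:
  assumes \<pi>: "\<pi> permutes {..<n}" and J: "length J = n"
  shows "frl M (\<lambda>I. S (map (\<lambda>k. I ! \<pi> k) [0..<n])) J = frl M S (map (\<lambda>k. J ! \<pi> k) [0..<n])"
proof -
  let ?P = "\<lambda>\<rho> I. map (\<lambda>k. I ! \<rho> k) [0..<n]"
  have lt: "\<pi> k < n" "inv \<pi> k < n" if "k < n" for k
    using permutes_in_image[OF \<pi>, of k] permutes_in_image[OF permutes_inv[OF \<pi>], of k] that by auto
  have "frl M (\<lambda>I. S (?P \<pi> I)) J = (\<Sum>I | length I = n. (\<Prod>k<n. M (J ! k) (I ! k)) * S (?P \<pi> I))"
    using sum_prod_frl[OF J, of M "\<lambda>I. S (?P \<pi> I)"] by simp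
  also have "\<dots> = (\<Sum>I | length I = n. (\<Prod>k<n. M (?P \<pi> J ! k) (I ! k)) * S I)"
  proof (rule sum.reindex_bij_witness[of _ "?P (inv \<pi>)" "?P \<pi>"])
    fix I :: "7 list" assume I: "I \<in> {I. length I = n}"
    show "?P (inv \<pi>) (?P \<pi> I) = I"
      using I lt permutes_inverses[OF \<pi>] by (intro nth_equalityI) auto
    show "?P \<pi> (?P (inv \<pi>) I) = I"
      using I lt permutes_inverses[OF \<pi>] by (intro nth_equalityI) auto
    have "(\<Prod>k<n. M (?P \<pi> J ! k) (?P \<pi> I ! k)) = (\<Prod>k<n. M (J ! k) (I ! k))"
      using prod.permute[OF \<pi>, of "\<lambda>k. M (J ! k) (I ! k)"] by (simp add: o_def)
    then show "(\<Prod>k<n. M (?P \<pi> J ! k) (?P \<pi> I ! k)) * S (?P \<pi> I) = (\<Prod>k<n. M (J ! k) (I ! k)) * S (?P \<pi> I)"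
      by simp
  qed auto
  also have "\<dots> = frl M S (?P \<pi> J)" by (rule sum_prod_frl) simp
  finally show ?thesis .
qed

lemma frl_take_drop:
  "p \<le> length J \<Longrightarrow> frl M (\<lambda>I. \<alpha> (take p I) * \<beta> (drop p I)) J = frl M \<alpha> (take p J) * frl M \<beta> (drop p J)"
proof (induction p arbitrary: J \<alpha>)
  case 0
  then show ?case by (simp add: frl_cmult)
next
  case (Suc p)
  then obtain a J' where J: "J = a # J'" "p \<le> length J'" by (cases J) auto
  show ?case unfolding J(1)
    using Suc.IH[OF J(2), of "\<lambda>I. \<alpha> (i # I)" for i] by (simp add: sum_distrib_right mult.assoc)
qed

lemma frl_wedge:
  assumes J: "length J = p + q"
  shows "frl M (wedge p q \<alpha> \<beta>) J = wedge p q (frl M \<alpha>) (frl M \<beta>) J"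
proof -
  have m: "map (\<lambda>k. I ! \<pi> k) [0..<p] = take p (map (\<lambda>k. I ! \<pi> k) [0..<p+q])"
    "map (\<lambda>k. I ! \<pi> k) [p..<p+q] = drop p (map (\<lambda>k. I ! \<pi> k) [0..<p+q])" for I :: "7 list" and \<pi>
    by (simp_all add: take_map drop_map)
  have "frl M (\<lambda>I. \<alpha> (map (\<lambda>k. I ! \<pi> k) [0..<p]) * \<beta> (map (\<lambda>k. I ! \<pi> k) [p..<p+q])) J =
    frl M \<alpha> (map (\<lambda>k. J ! \<pi> k) [0..<p]) * frl M \<beta> (map (\<lambda>k. J ! \<pi> k) [p..<p+q])"
    if "\<pi> permutes {..<p+q}" for \<pi>
    unfolding m frl_permute[OF that J, of M "\<lambda>I. \<alpha> (take p I) * \<beta> (drop p I)"]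
    by (rule frl_take_drop) simp
  then show ?thesis
    unfolding wedge_def frl_cmult frl_sum mult.assoc by (intro arg_cong2[where f = "(*)"] refl sum.cong) auto
qed

lemma wedge_cong:
  assumes "\<And>I. length I = p \<Longrightarrow> \<alpha> I = \<alpha>' I" "\<And>I. length I = q \<Longrightarrow> \<beta> I = \<beta>' I"
  shows "wedge p q \<alpha> \<beta> J = wedge p q \<alpha>' \<beta>' J"
  unfolding wedge_def using assms by simp

lemma frl_wedge_list:
  "length J = length es \<Longrightarrow> frl M (wedge_list es) J = wedge_list (map (frl M) es) J"
proof (induction es arbitrary: J)
  case (Cons e es)
  have "frl M (wedge_list (e # es)) J = wedge 1 (length es) (frl M e) (frl M (wedge_list es)) J"
    using frl_wedge[of J 1 "length es" M e "wedge_list es"] Cons.prems by simp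
  also have "\<dots> = wedge 1 (length es) (frl M e) (wedge_list (map (frl M) es)) J"
    by (rule wedge_cong) (auto simp: Cons.IH)
  finally show ?case by simp
qed simp

lemma wedge_list_cong:
  assumes "list_all2 (\<lambda>e e'. \<forall>i. e [i] = e' [i]) es es'"
  shows "wedge_list es J = wedge_list es' J"
  using assms
proof (induction arbitrary: J)
  case (Cons e es e' es')
  have "wedge 1 (length es) e (wedge_list es) J = wedge 1 (length es) e' (wedge_list es') J"
    by (rule wedge_cong) (use Cons in \<open>auto simp: length_Suc_conv\<close>)
  then show ?case using Cons.hyps(2) list_all2_lengthD by fastforce
qed simp

lemma frl_adjoint:
  "(\<Sum>K | length K = p. \<beta> K * frl F \<gamma> K) = (\<Sum>L | length L = p. frl (\<lambda>a i. F i a) \<beta> L * \<gamma> L)"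
proof (induction p arbitrary: \<beta> \<gamma>)
  case 0
  show ?case by (simp add: sum_length_0[simplified])
next
  case (Suc p)
  have "(\<Sum>K | length K = Suc p. \<beta> K * frl F \<gamma> K) =
      (\<Sum>\<^sub>7k. \<Sum>K | length K = p. \<Sum>\<^sub>7i. F k i * (\<beta> (k # K) * frl F (\<lambda>I. \<gamma> (i # I)) K))"
    unfolding sum_length_Suc by (simp add: sum_distrib_left mult.left_commute)
  also have "\<dots> = (\<Sum>\<^sub>7k i. F k i * (\<Sum>K | length K = p. \<beta> (k # K) * frl F (\<lambda>I. \<gamma> (i # I)) K))"
    unfolding sum_distrib_left by (rule sum.cong, rule refl, rule sum.swap)
  also have "\<dots> = (\<Sum>\<^sub>7i k. F k i * (\<Sum>K | length K = p. \<beta> (k # K) * frl F (\<lambda>I. \<gamma> (i # I)) K))"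
    by (rule sum.swap)
  also have "\<dots> = (\<Sum>\<^sub>7i. \<Sum>L | length L = p. \<Sum>\<^sub>7k. F k i * (frl (\<lambda>a i. F i a) (\<lambda>I. \<beta> (k # I)) L * \<gamma> (i # L)))"
    unfolding Suc.IH sum_distrib_left by (rule sum.cong, rule refl, rule sum.swap)
  finally show ?case
    unfolding sum_length_Suc by (simp add: sum_distrib_right mult.assoc)
qed

text \<open>The hypothesis expresses orthonormality of the frame \<open>E\<close>;
  \<open>frl_adjoint\<close> moves one of the two factors \<open>E\<close> to the other tensor.
  Hodge star and scalar products thereby become plain sums over frame indices.\<close>

lemma orthonormal_contract:
  assumes G: "\<And>i j. Gi i j = (\<Sum>\<^sub>7a. E a i * E a j)"
  shows "(\<Sum>I | length I = p. \<Sum>K | length K = p. (\<Prod>k<p. Gi (I ! k) (K ! k)) * \<alpha> I * \<beta> K) =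
    (\<Sum>L | length L = p. frl E \<alpha> L * frl E \<beta> L)"
proof -
  have Gi: "Gi = (\<lambda>i j. \<Sum>\<^sub>7a. E a i * E a j)" using G by blast
  have "(\<Sum>K | length K = p. (\<Prod>k<p. Gi (I ! k) (K ! k)) * \<alpha> I * \<beta> K) = \<alpha> I * frl (\<lambda>i a. E a i) (frl E \<beta>) I"
    if "length I = p" for I
    unfolding frl_frl Gi[symmetric] sum_prod_frl[OF that, of Gi \<beta>, symmetric] sum_distrib_left
    by (simp add: mult_ac)
  then have "(\<Sum>I | length I = p. \<Sum>K | length K = p. (\<Prod>k<p. Gi (I ! k) (K ! k)) * \<alpha> I * \<beta> K) =
    (\<Sum>I | length I = p. \<alpha> I * frl (\<lambda>i a. E a i) (frl E \<beta>) I)" by simp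
  then show ?thesis unfolding frl_adjoint .
qed

lemma frl_append: "frl E (\<lambda>J. frl E (\<lambda>I. v (I @ J)) L) J = frl E v (L @ J)"
proof (induction L arbitrary: v)
  case (Cons a L)
  show ?case using Cons.IH[of "\<lambda>I. v (i # I)" for i] by (simp add: frl_sum frl_cmult)
qed simp

lemma frl_hodge:
  assumes "\<And>i j. inv_metric G i j = (\<Sum>\<^sub>7a. E a i * E a j)"
  shows "frl E (hodge G v p \<alpha>) J = 1 / fact p * (\<Sum>L | length L = p. frl E \<alpha> L * frl E v (L @ J))"
proof -
  have "hodge G v p \<alpha> J = 1 / fact p * (\<Sum>L | length L = p. frl E \<alpha> L * frl E (\<lambda>I. v (I @ J)) L)" for J
    unfolding hodge_def
    using orthonormal_contract[of "inv_metric G" E p "\<lambda>I. v (I @ J)" \<alpha>, OF assms]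
    by (simp add: mult_ac)
  then have "hodge G v p \<alpha> = (\<lambda>J. 1 / fact p * (\<Sum>L | length L = p. frl E \<alpha> L * frl E (\<lambda>I. v (I @ J)) L))"
    by blast
  then show ?thesis by (simp only: frl_cmult frl_sum frl_append)
qed

lemma form_inner_frl:
  assumes "\<And>i j. inv_metric G i j = (\<Sum>\<^sub>7a. E a i * E a j)"
  shows "form_inner G p \<alpha> \<beta> = 1 / fact p * (\<Sum>L | length L = p. frl E \<alpha> L * frl E \<beta> L)"
  unfolding form_inner_def orthonormal_contract[of "inv_metric G" E p \<alpha> \<beta>, OF assms] ..

text \<open>An adapted coframe expressed in its own frame, see \<open>frl_dual\<close>. Only the
  values on lists of length one matter.\<close>

definition dual :: "7 \<Rightarrow> tensor" where
  "dual a I = kd a (hd I)"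

lemma std_phi_dual: "std_phi dual [i, j, k] = ph i j k"
  unfolding std_phi_def Let_def ph_def wedge3_def
  by (simp add: wedge_list_Cons dual_def del: wedge_list.simps(2) kd_simps)
     (simp add: algebra_simps del: kd_simps)

lemma wedge_list_eq_0:
  "length I = length es \<Longrightarrow> v \<in> set I \<Longrightarrow> (\<And>e. e \<in> set es \<Longrightarrow> e [v] = 0) \<Longrightarrow> wedge_list es I = 0"
proof (induction es arbitrary: I)
  case (Cons e es)
  then obtain i I' where I: "I = i # I'" "length I' = length es" by (cases I) auto
  have e: "e [v] = 0" using Cons.prems by simp
  have IH: "wedge_list es L = 0" if "length L = length es" "v \<in> set L" for L
    using Cons.IH[of L] Cons.prems that by simp
  have 1: "e [i] * wedge_list es I' = 0"
    using Cons.prems(2) e IH[of I'] I by auto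
  have "e [I' ! b] * wedge_list es (I'[b := i]) = 0" if b: "b < length es" for b
  proof (cases "v = I' ! b")
    case False
    have "v \<in> set (I'[b := i])"
    proof (cases "v = i")
      case True then show ?thesis using b I by (simp add: set_update_memI)
    next
      case f: False
      then obtain n where "n < length I'" "I' ! n = v" using Cons.prems(2) I by (auto simp: in_set_conv_nth)
      then show ?thesis using False
        by (metis in_set_conv_nth length_list_update nth_list_update_neq)
    qed
    then show ?thesis using IH[of "I'[b := i]"] I by simp
  next
    case True
    with e show ?thesis by simp
  qed
  then have "(\<Sum>b<length es. e [I' ! b] * wedge_list es (I'[b := i])) = 0"
    by (intro sum.neutral) simp
  then show ?case using 1 I wedge_list_Cons[of I es e] by simp
qed simp

text \<open>Insertion of the basis vector \<open>a\<close> in the first slot: only the factor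
  \<open>f\<close> sees it, and moving \<open>f\<close> to the front past the factors
  \<open>as\<close> gives the sign.\<close>

lemma wedge_list_contract:
  assumes a: "\<And>e. e \<in> set as \<union> set bs \<Longrightarrow> e [a] = 0" and f: "f [a] = 1"
    and I: "length I = length as + length bs"
  shows "wedge_list (as @ f # bs) (a # I) = (-1) ^ length as * wedge_list (as @ bs) I"
  using a I
proof (induction as arbitrary: I)
  case Nil
  have "wedge_list bs (I[b := a]) = 0" if "b < length bs" for b
    by (rule wedge_list_eq_0[where v = a]) (use Nil that in \<open>auto simp: set_update_memI\<close>)
  then show ?case using wedge_list_Cons[of "a # I" bs f] Nil f by simp
next
  case (Cons c as)
  obtain i J where I: "I = i # J" "length J = length as + length bs" using Cons.prems by (cases I) auto
  let ?W = "wedge_list (as @ f # bs)" and ?V = "wedge_list (as @ bs)" and ?s = "(-1) ^ length as :: real"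
  have IH: "?W (a # L) = ?s * ?V L" if "length L = length as + length bs" for L
    using Cons.IH[of L] Cons.prems that by simp
  have c: "c [a] = 0" using Cons.prems by simp
  have "?W ((i # J)[Suc b := a]) = - (?s * ?V (J[b := i]))" if b: "b < length J" for b
  proof -
    have "?W ((a # J[b := i])[0 := (a # J[b := i]) ! Suc b, Suc b := (a # J[b := i]) ! 0]) = - ?W (a # J[b := i])"
      by (rule alternating_swap[OF alternating_wedge_list]) (use b I in auto)
    then show ?thesis using b IH[of "J[b := i]"] I by simp
  qed
  then have 1: "(\<Sum>b<length J. c [J ! b] * ?W ((i # J)[Suc b := a])) = - (?s * (\<Sum>b<length J. c [J ! b] * ?V (J[b := i])))"
    by (simp add: sum_distrib_left sum_negf mult_ac)
  have "wedge_list ((c # as) @ f # bs) (a # I) = - (\<Sum>b<Suc (length J). c [(i # J) ! b] * ?W ((i # J)[b := a]))"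
    using wedge_list_Cons[of "a # i # J" "as @ f # bs" c] c I by simp
  then have 2: "wedge_list ((c # as) @ f # bs) (a # I) = - (c [i] * (?s * ?V J)) + ?s * (\<Sum>b<length J. c [J ! b] * ?V (J[b := i]))"
    unfolding sum.lessThan_Suc_shift using 1 IH[of J] I by simp
  have 3: "wedge_list ((c # as) @ bs) I = c [i] * ?V J - (\<Sum>b<length J. c [J ! b] * ?V (J[b := i]))"
    using wedge_list_Cons[of "i # J" "as @ bs" c] I by simp
  show ?case
    unfolding 2 3 by (simp add: algebra_simps)
qed

lemma wedge_list_dual:
  assumes "a \<in> set as" "distinct as" "length as = Suc (length I)"
  shows "wedge_list (map dual as) (a # I) =
    (-1) ^ length (takeWhile (\<lambda>x. x \<noteq> a) as) * wedge_list (map dual (remove1 a as)) I"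
proof -
  obtain xs ys where as: "as = xs @ a # ys" "a \<notin> set xs" using assms(1) split_list_first by metis
  have "wedge_list (map dual xs @ dual a # map dual ys) (a # I) =
    (-1) ^ length (map dual xs) * wedge_list (map dual xs @ map dual ys) I"
    by (rule wedge_list_contract) (use assms as in \<open>auto simp: dual_def kd_def\<close>)
  moreover have "takeWhile (\<lambda>x. x \<noteq> a) as = xs" "remove1 a as = xs @ ys"
    using as by (auto simp: takeWhile_append remove1_append)
  ultimately show ?thesis using as by simp
qed

definition vol7 :: tensor where
  "vol7 = wedge_list (map dual [1, 2, 3, 4, 5, 6, 7])"

lemma sum_wedge3:
  assumes X: "skew3 X"
  shows "(\<Sum>\<^sub>7a b c. wedge3 p q r a b c * X a b c) = 6 * X p q r"
proof -
  have k3: "(\<Sum>\<^sub>7a b c. kd p a * (kd q b * kd r c) * X a b c) = X p q r" for p q r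
    by (simp add: mult.assoc flip: sum_distrib_left)
  have "wedge3 p q r a b c * X a b c = kd p a * (kd q b * kd r c) * X a b c - kd p a * (kd r b * kd q c) * X a b c
    - kd q a * (kd p b * kd r c) * X a b c + kd q a * (kd r b * kd p c) * X a b c
    + kd r a * (kd p b * kd q c) * X a b c - kd r a * (kd q b * kd p c) * X a b c" for a b c
    unfolding wedge3_def by (simp add: algebra_simps)
  then have "(\<Sum>\<^sub>7a b c. wedge3 p q r a b c * X a b c) = X p q r - X p r q - X q p r + X q r p + X r p q - X r q p"
    by (simp only: sum.distrib sum_subtractf k3)
  then show ?thesis
    using skew3_23[OF X, of p r q] skew3_12[OF X, of q p r] skew3_cyc[OF X, of p q r]
      skew3_cyc[OF X, of r p q] skew3_13[OF X, of r q p] by simp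
qed

lemma sum_length_3: "(\<Sum>L | length L = 3. f L) = (\<Sum>\<^sub>7a b c. f [a, b, c])"
  unfolding numeral_3_eq_3 sum_length_Suc sum_length_0 ..

lemma sum_ph:
  assumes X: "skew3 X"
  shows "(\<Sum>\<^sub>7a b c. ph a b c * X a b c) = 6 * (X 1 2 7 + X 1 3 5 - X 1 4 6 - X 2 3 6 - X 2 4 5 + X 3 4 7 + X 5 6 7)"
  unfolding ph_def distrib_right left_diff_distrib sum.distrib sum_subtractf sum_wedge3[OF X] by simp

text \<open>Only the seven triples of \<open>ph\<close> contribute to the Hodge star, each with the
  four complementary indices and the sign of the corresponding rearrangement. That this agrees with
  the contraction defining \<open>ps\<close> is then a polynomial identity in the
  \<open>kd\<close>.\<close>

lemma star_ph: "1 / fact 3 * (\<Sum>L | length L = 3. ph (L ! 0) (L ! 1) (L ! 2) * vol7 (L @ [i, j, k, l])) = ps i j k l"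
proof -
  define X where "X a b c = vol7 [a, b, c, i, j, k, l]" for a b c
  have alt: "alternating 7 vol7"
  proof -
    have "length (map dual [1, 2, 3, 4, 5, 6, 7]) = 7" by simp
    then show ?thesis unfolding vol7_def by (metis alternating_wedge_list)
  qed
  have "X b a c = - X a b c" "X a c b = - X a b c" for a b c
    using alternating_swap[OF alt, of "[a, b, c, i, j, k, l]" 0 1]
      alternating_swap[OF alt, of "[a, b, c, i, j, k, l]" 1 2] unfolding X_def by (simp_all add: eval_nat_numeral)
  then have X: "skew3 X" unfolding skew3_def by blast
  have "(\<Sum>L | length L = 3. ph (L ! 0) (L ! 1) (L ! 2) * vol7 (L @ [i, j, k, l])) =
    6 * (X 1 2 7 + X 1 3 5 - X 1 4 6 - X 2 3 6 - X 2 4 5 + X 3 4 7 + X 5 6 7)"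
    unfolding sum_ph[OF X, symmetric] unfolding sum_length_3 X_def by simp
  moreover have "X 1 2 7 + X 1 3 5 - X 1 4 6 - X 2 3 6 - X 2 4 5 + X 3 4 7 + X 5 6 7 = ps i j k l"
  proof -
    define w where "w as = wedge_list (map dual as) [i, j, k, l]" for as
    have X: "X 1 2 7 = w [3, 4, 5, 6]" "X 1 3 5 = - w [2, 4, 6, 7]" "X 1 4 6 = - w [2, 3, 5, 7]"
      "X 2 3 6 = - w [1, 4, 5, 7]" "X 2 4 5 = - w [1, 3, 6, 7]" "X 3 4 7 = w [1, 2, 5, 6]" "X 5 6 7 = w [1, 2, 3, 4]"
      unfolding X_def vol7_def w_def by (simp_all add: wedge_list_dual del: list.map wedge_list.simps)
    have w: "w [a, b, c, d] = kd a i * (kd b j * (kd c k * kd d l - kd c l * kd d k)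
        - kd b k * (kd c j * kd d l - kd c l * kd d j) - kd b l * (kd c k * kd d j - kd c j * kd d k))
      - kd a j * (kd b i * (kd c k * kd d l - kd c l * kd d k)
        - kd b k * (kd c i * kd d l - kd c l * kd d i) - kd b l * (kd c k * kd d i - kd c i * kd d k))
      - kd a k * (kd b j * (kd c i * kd d l - kd c l * kd d i)
        - kd b i * (kd c j * kd d l - kd c l * kd d j) - kd b l * (kd c i * kd d j - kd c j * kd d i))
      - kd a l * (kd b j * (kd c k * kd d i - kd c i * kd d k)
        - kd b k * (kd c j * kd d i - kd c i * kd d j) - kd b i * (kd c k * kd d j - kd c j * kd d k))" for a b c d
      unfolding w_def by (simp add: wedge_list_Cons dual_def del: wedge_list.simps(2)) algebra
    show ?thesis
      unfolding X w ps_def kd_sum[of i k] kd_sum[of j l] kd_sum[of i l] kd_sum[of j k] sum_7 ph_row by algebra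
  qed
  ultimately show ?thesis by (simp add: fact_numeral)
qed

section \<open>The Lie algebra of the stabiliser\<close>

definition act1 :: "(7 \<Rightarrow> 7 \<Rightarrow> real) \<Rightarrow> (7 \<Rightarrow> real) \<Rightarrow> 7 \<Rightarrow> real" where
  "act1 w F a = (\<Sum>\<^sub>7m. w a m * F m)"

definition act2 :: "(7 \<Rightarrow> 7 \<Rightarrow> real) \<Rightarrow> (7 \<Rightarrow> 7 \<Rightarrow> real) \<Rightarrow> 7 \<Rightarrow> 7 \<Rightarrow> real" where
  "act2 w F a b = (\<Sum>\<^sub>7m. w a m * F m b) + (\<Sum>\<^sub>7m. w b m * F a m)"

definition act3 :: "(7 \<Rightarrow> 7 \<Rightarrow> real) \<Rightarrow> (7 \<Rightarrow> 7 \<Rightarrow> 7 \<Rightarrow> real) \<Rightarrow> 7 \<Rightarrow> 7 \<Rightarrow> 7 \<Rightarrow> real" where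
  "act3 w F a b c = (\<Sum>\<^sub>7m. w a m * F m b c) + (\<Sum>\<^sub>7m. w b m * F a m c) + (\<Sum>\<^sub>7m. w c m * F a b m)"

definition act4 :: "(7 \<Rightarrow> 7 \<Rightarrow> real) \<Rightarrow> (7 \<Rightarrow> 7 \<Rightarrow> 7 \<Rightarrow> 7 \<Rightarrow> real) \<Rightarrow> 7 \<Rightarrow> 7 \<Rightarrow> 7 \<Rightarrow> 7 \<Rightarrow> real" where
  "act4 w F a b c d = (\<Sum>\<^sub>7m. w a m * F m b c d) + (\<Sum>\<^sub>7m. w b m * F a m c d)
     + (\<Sum>\<^sub>7m. w c m * F a b m d) + (\<Sum>\<^sub>7m. w d m * F a b c m)"

text \<open>The connection coefficients \<open>W x i\<close> will be of this kind
  (\<open>W_g2\<close>). The lemmas of the locale state the equivariance of the contractions that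
  occur, so that a covariant derivative may be taken inside them.\<close>

locale g2_element =
  fixes w :: "7 \<Rightarrow> 7 \<Rightarrow> real"
  assumes skew: "\<And>a b. w b a = - w a b"
    and stab: "\<And>a b c. act3 w ph a b c = 0"
begin

lemma transfer: "(\<Sum>\<^sub>7m. (\<Sum>\<^sub>7n. w m n * F n) * G m) = - (\<Sum>\<^sub>7m. F m * (\<Sum>\<^sub>7n. w m n * G n))"
proof -
  have "(\<Sum>\<^sub>7m. (\<Sum>\<^sub>7n. w m n * F n) * G m) = (\<Sum>\<^sub>7m n. F n * (w m n * G m))"
    unfolding sum_distrib_right by (simp only: mult_ac)
  also have "\<dots> = (\<Sum>\<^sub>7n m. F n * (w m n * G m))" by (rule sum.swap)
  also have "\<dots> = (\<Sum>\<^sub>7n. F n * (- (\<Sum>\<^sub>7m. w n m * G m)))"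
  proof -
    have "w m n * G m = - (w n m * G m)" for m n unfolding skew[of m n] by simp
    then show ?thesis by (simp only: sum_distrib_left[symmetric] sum_negf)
  qed
  finally show ?thesis by (simp add: sum_negf)
qed

lemma transfer2:
  "(\<Sum>\<^sub>7m k. (\<Sum>\<^sub>7n. w m n * F n k) * G m k) = - (\<Sum>\<^sub>7m k. F m k * (\<Sum>\<^sub>7n. w m n * G n k))"
  by (rule trans[OF sum.swap], rule trans[OF _ arg_cong[of _ _ uminus, OF sum.swap]])
    (simp only: transfer sum_negf)

lemma trace_skew: "(\<Sum>\<^sub>7j m. w j m * F j m + w j m * F m j) = 0"
proof -
  have "(\<Sum>\<^sub>7j m. w j m * F m j) = (\<Sum>\<^sub>7j m. w m j * F j m)" by (rule sum.swap)
  also have "\<dots> = (\<Sum>\<^sub>7j m. - (w j m * F j m))"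
  proof -
    have "w m j * F j m = - (w j m * F j m)" for j m unfolding skew[of m j] by simp
    then show ?thesis by (simp only:)
  qed
  finally show ?thesis by (simp add: sum.distrib sum_negf)
qed

lemma tr3_slots:
  "tr3 q (\<lambda>i j k. \<Sum>\<^sub>7m. w i m * s m j k) = - tr3 (\<lambda>i j k. \<Sum>\<^sub>7m. w i m * q m j k) s"
  "tr3 q (\<lambda>i j k. \<Sum>\<^sub>7m. w j m * s i m k) = - tr3 (\<lambda>i j k. \<Sum>\<^sub>7m. w j m * q i m k) s"
  "tr3 q (\<lambda>i j k. \<Sum>\<^sub>7m. w k m * s i j m) = - tr3 (\<lambda>i j k. \<Sum>\<^sub>7m. w k m * q i j m) s"
proof -
  have *: "(\<Sum>\<^sub>7m. F m * (\<Sum>\<^sub>7n. w m n * G n)) = - (\<Sum>\<^sub>7m. (\<Sum>\<^sub>7n. w m n * F n) * G m)" for F G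
    unfolding transfer by simp
  show "tr3 q (\<lambda>i j k. \<Sum>\<^sub>7m. w k m * s i j m) = - tr3 (\<lambda>i j k. \<Sum>\<^sub>7m. w k m * q i j m) s"
    unfolding tr3_def * sum_negf ..
  have r: "tr3 u v = (\<Sum>\<^sub>7i k j. u i j k * v i j k)" for u v
    unfolding tr3_def by (rule sum.cong, rule refl, rule sum.swap)
  show "tr3 q (\<lambda>i j k. \<Sum>\<^sub>7m. w j m * s i m k) = - tr3 (\<lambda>i j k. \<Sum>\<^sub>7m. w j m * q i m k) s"
    unfolding r * sum_negf ..
  have r: "tr3 u v = (\<Sum>\<^sub>7j k i. u i j k * v i j k)" for u v
    unfolding tr3_def by (rule sum7_swap3)
  show "tr3 q (\<lambda>i j k. \<Sum>\<^sub>7m. w i m * s m j k) = - tr3 (\<lambda>i j k. \<Sum>\<^sub>7m. w i m * q m j k) s"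
    unfolding r * sum_negf ..
qed

lemma phc_act3: "phc (act3 w T) a b = act2 w (phc T) a b"
proof -
  have 1: "(\<Sum>\<^sub>7j k. (\<Sum>\<^sub>7m. w a m * T m j k) * ph b j k) = (\<Sum>\<^sub>7m. w a m * phc T m b)"
    unfolding sum7_out phc_def ..
  have 2: "(\<Sum>\<^sub>7j k. (\<Sum>\<^sub>7m. w j m * T a m k) * ph b j k) = - (\<Sum>\<^sub>7j k. T a j k * (\<Sum>\<^sub>7m. w j m * ph b m k))"
    by (rule transfer2)
  have 3: "(\<Sum>\<^sub>7j k. (\<Sum>\<^sub>7m. w k m * T a j m) * ph b j k) = - (\<Sum>\<^sub>7j k. T a j k * (\<Sum>\<^sub>7m. w k m * ph b j m))"
    by (simp only: transfer sum_negf)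
  have 4: "(\<Sum>\<^sub>7j k. T a j k * (\<Sum>\<^sub>7m. w b m * ph m j k)) = (\<Sum>\<^sub>7m. w b m * phc T a m)"
  proof -
    have "phc T a m = (\<Sum>\<^sub>7j k. ph m j k * T a j k)" for m unfolding phc_def by (simp only: mult.commute)
    then have "(\<Sum>\<^sub>7m. w b m * phc T a m) = (\<Sum>\<^sub>7j k. (\<Sum>\<^sub>7m. w b m * ph m j k) * T a j k)"
      by (simp only: sum7_out)
    then show ?thesis by (simp only: mult.commute)
  qed
  have "(\<Sum>\<^sub>7m. w j m * ph b m k) + (\<Sum>\<^sub>7m. w k m * ph b j m) = - (\<Sum>\<^sub>7m. w b m * ph m j k)" for j k
    using stab[of b j k] unfolding act3_def by simp
  then have "(\<Sum>\<^sub>7j k. T a j k * (\<Sum>\<^sub>7m. w j m * ph b m k)) + (\<Sum>\<^sub>7j k. T a j k * (\<Sum>\<^sub>7m. w k m * ph b j m))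
      = - (\<Sum>\<^sub>7m. w b m * phc T a m)"
    unfolding sum.distrib[symmetric] distrib_left[symmetric] 4[symmetric] by (simp add: sum_negf)
  then show ?thesis
    unfolding phc_def[of "act3 w T"] act3_def distrib_right sum.distrib 1 2 3 act2_def by simp
qed

lemma vector_ph_act: "act2 w (\<lambda>i j. \<Sum>\<^sub>7k. th k * ph k i j) i j = (\<Sum>\<^sub>7k. act1 w th k * ph k i j)"
proof -
  have *: "(\<Sum>\<^sub>7m. w i m * (\<Sum>\<^sub>7k. th k * f k m)) = (\<Sum>\<^sub>7k. th k * (\<Sum>\<^sub>7m. w i m * f k m))" for f i
    unfolding sum_distrib_left by (subst sum.swap) (simp only: mult.left_commute)
  have "(\<Sum>\<^sub>7m. w i m * ph k m j) + (\<Sum>\<^sub>7m. w j m * ph k i m) = - (\<Sum>\<^sub>7m. w k m * ph m i j)" for k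
    using stab[of k i j] unfolding act3_def by simp
  then have "act2 w (\<lambda>i j. \<Sum>\<^sub>7k. th k * ph k i j) i j = (\<Sum>\<^sub>7k. th k * (- (\<Sum>\<^sub>7m. w k m * ph m i j)))"
    unfolding act2_def * sum.distrib[symmetric] distrib_left[symmetric] by simp
  then show ?thesis unfolding act1_def transfer by (simp add: sum_negf)
qed

lemma contr_act:
  "(\<Sum>\<^sub>7m k. act2 w H m k * B m k l + H m k * act3 w B m k l) = act1 w (\<lambda>l. \<Sum>\<^sub>7m k. H m k * B m k l) l"
proof -
  have 1: "(\<Sum>\<^sub>7m k. (\<Sum>\<^sub>7n. w m n * H n k) * B m k l) = - (\<Sum>\<^sub>7m k. H m k * (\<Sum>\<^sub>7n. w m n * B n k l))"
    by (rule transfer2)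
  have 2: "(\<Sum>\<^sub>7m k. (\<Sum>\<^sub>7n. w k n * H m n) * B m k l) = - (\<Sum>\<^sub>7m k. H m k * (\<Sum>\<^sub>7n. w k n * B m n l))"
    by (simp only: transfer sum_negf)
  have 3: "(\<Sum>\<^sub>7m k. H m k * (\<Sum>\<^sub>7n. w l n * B m k n)) = act1 w (\<lambda>l. \<Sum>\<^sub>7m k. H m k * B m k l) l"
  proof -
    have "(\<Sum>\<^sub>7m k. H m k * (\<Sum>\<^sub>7n. w l n * B m k n)) = (\<Sum>\<^sub>7m k n. w l n * (H m k * B m k n))"
      unfolding sum_distrib_left by (simp only: mult.left_commute)
    also have "\<dots> = (\<Sum>\<^sub>7n m k. w l n * (H m k * B m k n))" by (rule sum7_swap3[symmetric])
    finally show ?thesis unfolding act1_def sum_distrib_left .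
  qed
  show ?thesis
    unfolding act2_def act3_def distrib_left distrib_right sum.distrib 1 2 3 by simp
qed

lemma trace_act3: "(\<Sum>\<^sub>7j. act3 w B i j j) = act1 w (\<lambda>i. \<Sum>\<^sub>7j. B i j j) i"
proof -
  have "(\<Sum>\<^sub>7j m. w i m * B m j j) = act1 w (\<lambda>i. \<Sum>\<^sub>7j. B i j j) i"
    unfolding act1_def sum_distrib_left by (rule sum.swap)
  then show ?thesis
    using trace_skew[of "\<lambda>j m. B i j m"] unfolding act3_def sum.distrib by simp
qed

lemma trace_act2: "(\<Sum>\<^sub>7i. act2 w M i i) = 0"
  using trace_skew[of "\<lambda>j m. M j m"] unfolding act2_def sum.distrib by simp

lemma contr3_act:
  "(\<Sum>\<^sub>7a. act3 w S i j a * T a k l + S i j a * act3 w T a k l) = act4 w (\<lambda>i j k l. \<Sum>\<^sub>7a. S i j a * T a k l) i j k l"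
proof -
  have *: "(\<Sum>\<^sub>7m. w x m * (\<Sum>\<^sub>7a. f a m * g a)) = (\<Sum>\<^sub>7a. (\<Sum>\<^sub>7m. w x m * f a m) * g a)" for f g x
    unfolding sum_distrib_left sum_distrib_right mult.assoc by (rule sum.swap)
  have **: "(\<Sum>\<^sub>7m. w x m * (\<Sum>\<^sub>7a. g a * f a m)) = (\<Sum>\<^sub>7a. g a * (\<Sum>\<^sub>7m. w x m * f a m))" for f g x
    unfolding sum_distrib_left by (subst sum.swap) (simp only: mult.left_commute)
  show ?thesis
    unfolding act4_def act3_def distrib_left distrib_right sum.distrib transfer
      *[of i "\<lambda>a m. S m j a"] *[of j "\<lambda>a m. S i m a"] **[of k _ "\<lambda>a m. T a m l"] **[of l _ "\<lambda>a m. T a k m"]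
    by simp
qed

lemma sigma4_act:
  "act4 w (sigma4 T) i j k l =
    (\<Sum>\<^sub>7a. act3 w T i j a * T a k l + T i j a * act3 w T a k l) +
    (\<Sum>\<^sub>7a. act3 w T j k a * T a i l + T j k a * act3 w T a i l) +
    (\<Sum>\<^sub>7a. act3 w T k i a * T a j l + T k i a * act3 w T a j l)"
  unfolding contr3_act unfolding sigma4_def[abs_def] act4_def distrib_left sum.distrib by simp

text \<open>\<open>ps\<close> is made of \<open>ph\<close> and Kronecker deltas; \<open>w\<close>
  annihilates the former by \<open>stab\<close> and the latter by skewness.\<close>

lemma ps_act: "act4 w ps i j k l = 0"
proof -
  have ps: "ps = (\<lambda>i j k l. (\<Sum>\<^sub>7p. ph i j p * ph p k l) - kd i k * kd j l + kd i l * kd j k)"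
  proof (intro ext)
    fix i j k l
    have "ph p i j = ph i j p" for p by (rule ph_cyc[symmetric])
    then show "ps i j k l = (\<Sum>\<^sub>7p. ph i j p * ph p k l) - kd i k * kd j l + kd i l * kd j k"
      unfolding ps_def by simp
  qed
  have "act4 w (\<lambda>i j k l. \<Sum>\<^sub>7p. ph i j p * ph p k l) i j k l = 0"
    unfolding contr3_act[symmetric] stab by simp
  moreover have k: "(\<Sum>\<^sub>7m. w x m * (kd m a * c)) = w x a * c" "(\<Sum>\<^sub>7m. w x m * (kd a m * c)) = w x a * c"
    "(\<Sum>\<^sub>7m. w x m * (c * kd m a)) = w x a * c" "(\<Sum>\<^sub>7m. w x m * (c * kd a m)) = w x a * c" for x a c
    unfolding mult.commute[of c] mult.assoc[symmetric] sum_distrib_right[symmetric] by simp_all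
  moreover have "act4 w (\<lambda>i j k l. kd i k * kd j l) i j k l = 0" "act4 w (\<lambda>i j k l. kd i l * kd j k) i j k l = 0"
    unfolding act4_def k using skew[of i k] skew[of j l] skew[of i l] skew[of j k]
    by simp_all
  ultimately show ?thesis
    unfolding ps act4_def distrib_left right_diff_distrib sum.distrib sum_subtractf by simp
qed

lemma tr3_ps_act:
  "act2 w (\<lambda>p l. tr3 (\<lambda>i j k. ps i j k p) (\<lambda>i j k. s i j k l)) p l = tr3 (\<lambda>i j k. ps i j k p) (\<lambda>i j k. act4 w s i j k l)"
proof -
  let ?q = "\<lambda>p i j k. ps i j k p"
  have 1: "(\<Sum>\<^sub>7m. w l m * tr3 (?q p) (\<lambda>i j k. s i j k m)) = tr3 (?q p) (\<lambda>i j k. \<Sum>\<^sub>7m. w l m * s i j k m)"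
    by (rule tr3_sum[symmetric])
  have "tr3 u v = tr3 v u" for u v unfolding tr3_def by (simp only: mult.commute)
  then have 2: "(\<Sum>\<^sub>7m. w p m * tr3 (?q m) (\<lambda>i j k. s i j k l)) = tr3 (\<lambda>i j k. \<Sum>\<^sub>7m. w p m * ps i j k m) (\<lambda>i j k. s i j k l)"
    using tr3_sum[of "\<lambda>i j k. s i j k l" "\<lambda>m. w p m" ?q] by simp
  have "(\<Sum>\<^sub>7m. w i m * ps m j k p) + (\<Sum>\<^sub>7m. w j m * ps i m k p) + (\<Sum>\<^sub>7m. w k m * ps i j m p) = - (\<Sum>\<^sub>7m. w p m * ps i j k m)" for i j k
    using ps_act[of i j k p] unfolding act4_def by simp
  then have "tr3 (\<lambda>i j k. (\<Sum>\<^sub>7m. w i m * ps m j k p) + (\<Sum>\<^sub>7m. w j m * ps i m k p) + (\<Sum>\<^sub>7m. w k m * ps i j m p)) (\<lambda>i j k. s i j k l)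
    = - tr3 (\<lambda>i j k. \<Sum>\<^sub>7m. w p m * ps i j k m) (\<lambda>i j k. s i j k l)"
    by (simp add: tr3_def sum_negf)
  moreover have "tr3 (\<lambda>i j k. a i j k + b i j k + c i j k) v = tr3 a v + tr3 b v + tr3 c v" for a b c v
    unfolding tr3_def distrib_right sum.distrib ..
  ultimately show ?thesis
    unfolding act2_def act4_def tr3_add tr3_slots 1 2 by simp
qed

end

section \<open>Adapted frames\<close>

lemma smooth_det:
  assumes "open V" "\<And>a i. smooth_on V (\<lambda>x. A x $ a $ i)"
  shows "smooth_on V (\<lambda>x. det (A x :: real^7^7))"
  unfolding det_def by (intro smooth_on_sum smooth_on_mult smooth_on_const smooth_on_prod assms)

lemma sum_length_2: "(\<Sum>L | length L = 2. f L) = (\<Sum>\<^sub>7a b. f [a, b])"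
  unfolding numeral_2_eq_2 sum_length_Suc sum_length_0 ..

text \<open>\<open>matrix_inv\<close> chooses some two-sided inverse. For square matrices a right
  inverse exists only as a two-sided one, which determines the choice.\<close>

lemma inv_metric_eq:
  assumes "\<And>i k. (\<Sum>\<^sub>7j. G [i, j] * X j k) = kd i k"
  shows "inv_metric G i j = X i j"
proof -
  let ?G = "(\<chi> a b. G [a, b]) :: real^7^7" and ?X = "(\<chi> a b. X a b) :: real^7^7"
  have GX: "?G ** ?X = mat 1"
    using assms by (simp add: matrix_matrix_mult_def mat_def vec_eq_iff kd_def)
  then have XG: "?X ** ?G = mat 1" by (simp add: matrix_left_right_inverse)
  have "\<exists>A. ?G ** A = mat 1 \<and> A ** ?G = mat 1" using GX XG by blast
  then have "matrix_inv ?G ** ?G = mat 1"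
    unfolding matrix_inv_def by (rule someI2_ex) blast
  then have "matrix_inv ?G = ?X"
    using matrix_mul_assoc[of "matrix_inv ?G" ?G ?X] unfolding GX by simp
  then show ?thesis unfolding inv_metric_def by simp
qed

lemma cov_deriv_cong:
  assumes "open V" "x \<in> V" "\<And>y J. y \<in> V \<Longrightarrow> length J = length I \<Longrightarrow> S y J = S' y J"
  shows "cov_deriv \<Gamma> S x i I = cov_deriv \<Gamma> S' x i I"
proof -
  have "pd i (\<lambda>y. S y I) x = pd i (\<lambda>y. S' y I) x" using assms by (intro pd_cong_open) auto
  moreover have "derl (\<Gamma> x i) (S x) I = derl (\<Gamma> x i) (S' x) I" using assms by (intro derl_cong) auto
  ultimately show ?thesis unfolding cov_deriv_derl by simp
qed

locale adapted_frame =
  fixes V :: "(real^7) set" and e :: "7 \<Rightarrow> tensor_field" and g vol \<phi> :: tensor_field and \<Gamma> :: christoffel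
  assumes V: "open V"
    and e_smooth: "\<And>a i. smooth_on V (\<lambda>x. e a x [i])"
    and e_det: "\<And>x. x \<in> V \<Longrightarrow> det (\<chi> a i. e a x [i]) \<noteq> 0"
    and phi: "\<And>x I. x \<in> V \<Longrightarrow> length I = 3 \<Longrightarrow> \<phi> x I = std_phi (\<lambda>a. e a x) I"
    and metric: "\<And>x i j. x \<in> V \<Longrightarrow> g x [i, j] = (\<Sum>\<^sub>7a. e a x [i] * e a x [j])"
    and volume: "\<And>x I. x \<in> V \<Longrightarrow> length I = 7 \<Longrightarrow>
      vol x I = wedge_list (map (\<lambda>a. e a x) [1, 2, 3, 4, 5, 6, 7]) I"
    and \<Gamma>_smooth: "\<And>i j l. smooth_on V (\<lambda>x. \<Gamma> x i j l)"
    and metric_parallel: "\<And>x i I. x \<in> V \<Longrightarrow> length I = 2 \<Longrightarrow> cov_deriv \<Gamma> g x i I = 0"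
    and phi_parallel: "\<And>x i I. x \<in> V \<Longrightarrow> length I = 3 \<Longrightarrow> cov_deriv \<Gamma> \<phi> x i I = 0"
    and torsion_alternating: "\<And>x. x \<in> V \<Longrightarrow> alternating 3 (torsion g \<Gamma> x)"
begin

text \<open>The dual frame by Cramer's rule, which makes its smoothness evident.\<close>

definition E :: "real^7 \<Rightarrow> 7 \<Rightarrow> 7 \<Rightarrow> real" where
  "E x a i = det (\<chi> b j. if j = i then kd a b else e b x [j]) / det (\<chi> b j. e b x [j])"

lemma E_smooth: "smooth_on V (\<lambda>x. E x a i)"
proof -
  have "smooth_on V (\<lambda>x. if j = i then kd a b else e b x [j])" for b j
    by (cases "j = i") (simp_all add: smooth_on_const e_smooth)
  then have "smooth_on V (\<lambda>x. det (\<chi> b j. if j = i then kd a b else e b x [j]) * inverse (det (\<chi> b j. e b x [j])))"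
    by (intro smooth_on_mult smooth_on_inverse smooth_det V) (auto simp: e_smooth e_det smooth_on_const)
  then show ?thesis unfolding E_def by (simp add: divide_inverse)
qed

lemma e_E: assumes x: "x \<in> V" shows "(\<Sum>\<^sub>7i. e a x [i] * E x b i) = kd a b"
proof -
  let ?A = "(\<chi> a i. e a x [i]) :: real^7^7"
  have "?A *v (\<chi> i. E x b i) = (\<chi> a. kd b a)"
    unfolding cramer[OF e_det[OF x]] E_def by (simp add: vec_eq_iff cong: if_cong)
  then show ?thesis by (simp add: matrix_vector_mult_def vec_eq_iff kd_commute)
qed

lemma E_e: assumes x: "x \<in> V" shows "(\<Sum>\<^sub>7a. e a x [i] * E x a j) = kd i j"
proof -
  let ?A = "(\<chi> a i. e a x [i]) :: real^7^7" and ?B = "(\<chi> i b. E x b i) :: real^7^7"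
  have "?A ** ?B = mat 1"
    using e_E[OF x] by (simp add: matrix_matrix_mult_def mat_def vec_eq_iff kd_def)
  then have "?B ** ?A = mat 1" by (simp add: matrix_left_right_inverse)
  then have "(\<Sum>\<^sub>7a. E x a j * e a x [i]) = kd j i"
    by (simp add: matrix_matrix_mult_def mat_def vec_eq_iff kd_def)
  then show ?thesis by (simp add: kd_commute mult.commute)
qed

lemma inv_metric: assumes x: "x \<in> V" shows "inv_metric (g x) i j = (\<Sum>\<^sub>7a. E x a i * E x a j)"
proof (rule inv_metric_eq)
  fix i k
  have "(\<Sum>\<^sub>7j. g x [i, j] * (\<Sum>\<^sub>7a. E x a j * E x a k)) = (\<Sum>\<^sub>7a. (\<Sum>\<^sub>7j. g x [i, j] * E x a j) * E x a k)"
    by (rule sum7_assoc)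
  also have "\<dots> = (\<Sum>\<^sub>7a. e a x [i] * E x a k)"
  proof -
    have "(\<Sum>\<^sub>7j. g x [i, j] * E x a j) = (\<Sum>\<^sub>7b. e b x [i] * (\<Sum>\<^sub>7j. e b x [j] * E x a j))" for a
      unfolding metric[OF x] by (simp only: sum7_assoc)
    then show ?thesis unfolding e_E[OF x] by simp
  qed
  finally show "(\<Sum>\<^sub>7j. g x [i, j] * (\<Sum>\<^sub>7a. E x a j * E x a k)) = kd i k" unfolding E_e[OF x] .
qed

lemma metric_E: assumes x: "x \<in> V" shows "(\<Sum>\<^sub>7j. g x [i, j] * E x a j) = e a x [i]"
proof -
  have "(\<Sum>\<^sub>7j. g x [i, j] * E x a j) = (\<Sum>\<^sub>7b. e b x [i] * (\<Sum>\<^sub>7j. e b x [j] * E x a j))"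
    unfolding metric[OF x] by (simp only: sum7_assoc)
  then show ?thesis unfolding e_E[OF x] by simp
qed

lemma frl_e: assumes x: "x \<in> V" shows "frl (E x) (e a x) [b] = kd a b"
  using e_E[OF x, of a b] by (simp add: mult.commute)

lemma frl_dual: assumes x: "x \<in> V" and J: "length J = length as"
  shows "frl (E x) (wedge_list (map (\<lambda>a. e a x) as)) J = wedge_list (map dual as) J"
proof -
  have "frl (E x) (wedge_list (map (\<lambda>a. e a x) as)) J = wedge_list (map (frl (E x)) (map (\<lambda>a. e a x) as)) J"
    by (rule frl_wedge_list) (simp add: J)
  also have "\<dots> = wedge_list (map dual as) J"
    by (rule wedge_list_cong) (simp add: list_all2_conv_all_nth frl_e[OF x] dual_def del: frl.simps)
  finally show ?thesis .
qed

lemma frl_metric: assumes x: "x \<in> V" shows "frl (E x) (g x) [a, b] = kd a b"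
proof -
  have "frl (E x) (g x) [a, b] = (\<Sum>\<^sub>7i. E x a i * (\<Sum>\<^sub>7j. g x [i, j] * E x b j))"
    by (simp add: mult.commute)
  also have "\<dots> = kd b a" unfolding metric_E[OF x] using e_E[OF x, of b a] by (simp add: mult.commute)
  finally show ?thesis by (simp add: kd_commute)
qed

lemma frl_phi: assumes x: "x \<in> V" shows "frl (E x) (\<phi> x) [a, b, c] = ph a b c"
proof -
  have w: "frl (E x) (wedge_list [e i x, e j x, e k x]) [a, b, c] = wedge_list [dual i, dual j, dual k] [a, b, c]" for i j k
    using frl_dual[OF x, of "[a, b, c]" "[i, j, k]"] by (simp del: frl.simps wedge_list.simps)
  have "frl (E x) (\<phi> x) [a, b, c] = frl (E x) (std_phi (\<lambda>a. e a x)) [a, b, c]"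
    by (rule frl_cong) (simp add: phi[OF x])
  also have "\<dots> = std_phi dual [a, b, c]"
    unfolding std_phi_def Let_def frl_add frl_diff w ..
  finally show ?thesis unfolding std_phi_dual .
qed

lemma frl_volume: assumes x: "x \<in> V" and L: "length L = 7" shows "frl (E x) (vol x) L = vol7 L"
proof -
  have "frl (E x) (vol x) L = frl (E x) (wedge_list (map (\<lambda>a. e a x) [1, 2, 3, 4, 5, 6, 7])) L"
    by (rule frl_cong) (simp add: volume[OF x] L del: wedge_list.simps list.map)
  then show ?thesis
    using frl_dual[OF x, of L "[1, 2, 3, 4, 5, 6, 7]"] L unfolding vol7_def by (simp del: frl.simps wedge_list.simps list.map)
qed

abbreviation "star \<equiv> star_phi g vol \<phi>"

lemma frl_star: assumes x: "x \<in> V" shows "frl (E x) (star x) [i, j, k, l] = ps i j k l"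
proof -
  have "frl (E x) (star x) [i, j, k, l] =
    1 / fact 3 * (\<Sum>L | length L = 3. frl (E x) (\<phi> x) L * frl (E x) (vol x) (L @ [i, j, k, l]))"
    unfolding star_phi_def by (rule frl_hodge) (rule inv_metric[OF x])
  also have "\<dots> = 1 / fact 3 * (\<Sum>L | length L = 3. ph (L ! 0) (L ! 1) (L ! 2) * vol7 (L @ [i, j, k, l]))"
  proof (intro arg_cong[of _ _ "(*) _"] sum.cong refl)
    fix L :: "7 list" assume "L \<in> {L. length L = 3}"
    then obtain a b c where L: "L = [a, b, c]" by (auto simp: length_Suc_conv numeral_3_eq_3)
    show "frl (E x) (\<phi> x) L * frl (E x) (vol x) (L @ [i, j, k, l]) = ph (L ! 0) (L ! 1) (L ! 2) * vol7 (L @ [i, j, k, l])"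
      using frl_phi[OF x, of a b c] frl_volume[OF x, of "L @ [i, j, k, l]"] L by (simp del: frl.simps)
  qed
  finally show ?thesis unfolding star_ph .
qed

lemma coframe_frl: assumes "x \<in> V" shows "frl (\<lambda>i a. e a x [i]) (frl (E x) S) I = S I"
  by (rule frl_inverse) (simp add: E_e[OF assms] kd_def)

lemma frl_coframe: assumes "x \<in> V" shows "frl (E x) (frl (\<lambda>i a. e a x [i]) S) J = S J"
  by (rule frl_inverse) (use e_E[OF assms] in \<open>simp add: kd_def mult.commute\<close>)

lemma frl_eq_0_imp:
  assumes x: "x \<in> V" and "\<And>J. length J = length I \<Longrightarrow> frl (E x) S J = 0"
  shows "S I = 0"
proof -
  have "frl (\<lambda>i a. e a x [i]) (frl (E x) S) I = frl (\<lambda>i a. e a x [i]) (\<lambda>_. 0) I"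
    using assms(2) by (rule frl_cong)
  then show ?thesis unfolding coframe_frl[OF x] frl_0 .
qed

text \<open>The coframe is smooth, so smoothness may be read off from frame components; those of
  \<open>\<phi>\<close> and \<open>*\<phi>\<close> are constant.\<close>

lemma smooth_from_frame:
  assumes "\<And>J. length J = length I \<Longrightarrow> smooth_on V (\<lambda>x. frl (E x) (S x) J)"
  shows "smooth_on V (\<lambda>x. S x I)"
proof -
  have "smooth_on V (\<lambda>x. frl (\<lambda>i a. e a x [i]) (frl (E x) (S x)) I)"
    by (rule smooth_frl[OF V e_smooth assms])
  moreover have "smooth_on V (\<lambda>x. frl (\<lambda>i a. e a x [i]) (frl (E x) (S x)) I) = smooth_on V (\<lambda>x. S x I)"
    by (rule smooth_on_cong[OF V]) (rule coframe_frl)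
  ultimately show ?thesis by blast
qed

lemma smooth_frame:
  assumes "\<And>J. length J = length I \<Longrightarrow> smooth_on V (\<lambda>x. S x J)"
  shows "smooth_on V (\<lambda>x. frl (E x) (S x) I)"
  by (rule smooth_frl[OF V E_smooth assms])

lemma smooth_metric: "smooth_on V (\<lambda>x. g x [i, j])"
proof -
  have "smooth_on V (\<lambda>x. \<Sum>\<^sub>7a. e a x [i] * e a x [j])"
    by (intro smooth_on_sum smooth_on_mult V e_smooth)
  moreover have "smooth_on V (\<lambda>x. g x [i, j]) = smooth_on V (\<lambda>x. \<Sum>\<^sub>7a. e a x [i] * e a x [j])"
    by (rule smooth_on_cong[OF V]) (rule metric)
  ultimately show ?thesis by blast
qed

lemma smooth_phi: assumes "length I = 3" shows "smooth_on V (\<lambda>x. \<phi> x I)"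
proof (rule smooth_from_frame)
  fix J :: "7 list" assume "length J = length I"
  then obtain a b c where J: "J = [a, b, c]" using assms by (auto simp: length_Suc_conv numeral_3_eq_3)
  show "smooth_on V (\<lambda>x. frl (E x) (\<phi> x) J)"
    unfolding J by (rule iffD2[OF smooth_on_cong[OF V frl_phi] smooth_on_const])
qed

lemma smooth_star: assumes "length I = 4" shows "smooth_on V (\<lambda>x. star x I)"
proof (rule smooth_from_frame)
  fix J :: "7 list" assume "length J = length I"
  then obtain a b c d where J: "J = [a, b, c, d]" using assms by (auto simp: length_Suc_conv eval_nat_numeral)
  show "smooth_on V (\<lambda>x. frl (E x) (star x) J)"
    unfolding J by (rule iffD2[OF smooth_on_cong[OF V frl_star] smooth_on_const])
qed

text \<open>The connection coefficients in the frame; only the index \<open>i\<close> of differentiation refers to the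
  coordinates.\<close>

definition W :: christoffel where
  "W x i a b = (\<Sum>\<^sub>7j. (pd i (\<lambda>y. E y a j) x + (\<Sum>\<^sub>7k. E x a k * \<Gamma> x i k j)) * e b x [j])"

lemma W_smooth: "smooth_on V (\<lambda>x. W x i a b)"
  unfolding W_def
  by (intro smooth_on_sum smooth_on_mult smooth_on_add smooth_on_pd V e_smooth E_smooth \<Gamma>_smooth)

lemma W_E: assumes x: "x \<in> V"
  shows "(\<Sum>\<^sub>7b. W x i a b * E x b j) = pd i (\<lambda>y. E y a j) x + (\<Sum>\<^sub>7k. E x a k * \<Gamma> x i k j)"
  unfolding W_def sum7_assoc[symmetric] E_e[OF x] by simp

lemma cov_deriv_frame:
  assumes x: "x \<in> V" and S: "\<And>I. length I = length J \<Longrightarrow> smooth_on V (\<lambda>y. S y I)"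
  shows "cov_deriv W (\<lambda>y. frl (E y) (S y)) x i J = frl (E x) (cov_deriv \<Gamma> S x i) J"
  by (rule cov_deriv_frl)
    (use smooth_on_differentiable[OF _ x] E_smooth S W_E[OF x] in auto)

text \<open>The frame components of the metric and of \<open>\<phi>\<close> are constant, so their
  covariant derivatives, which vanish, consist of the action of \<open>W x i\<close> alone.\<close>

lemma W_g2: assumes x: "x \<in> V" shows "g2_element (W x i)"
proof
  fix a b c
  have "0 = frl (E x) (cov_deriv \<Gamma> g x i) [a, b]"
    using frl_cong[of "[a, b]" "cov_deriv \<Gamma> g x i" "\<lambda>_. 0"] metric_parallel[OF x] by (simp add: frl_0 del: frl.simps)
  also have "\<dots> = cov_deriv W (\<lambda>y. frl (E y) (g y)) x i [a, b]"
    by (rule cov_deriv_frame[OF x, symmetric]) (auto simp: length_Suc_conv smooth_metric)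
  also have "\<dots> = cov_deriv W (\<lambda>y J. kd (J ! 0) (J ! 1)) x i [a, b]"
    by (rule cov_deriv_cong[OF V x]) (auto simp: length_Suc_conv frl_metric simp del: frl.simps)
  also have "\<dots> = - W x i a b - W x i b a"
    unfolding cov_deriv_derl by simp
  finally show "W x i b a = - W x i a b" by simp
  have "0 = frl (E x) (cov_deriv \<Gamma> \<phi> x i) [a, b, c]"
    using frl_cong[of "[a, b, c]" "cov_deriv \<Gamma> \<phi> x i" "\<lambda>_. 0"] phi_parallel[OF x] by (simp add: frl_0 del: frl.simps)
  also have "\<dots> = cov_deriv W (\<lambda>y. frl (E y) (\<phi> y)) x i [a, b, c]"
    by (rule cov_deriv_frame[OF x, symmetric]) (simp add: smooth_phi)
  also have "\<dots> = cov_deriv W (\<lambda>y J. ph (J ! 0) (J ! 1) (J ! 2)) x i [a, b, c]"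
    by (rule cov_deriv_cong[OF V x]) (auto simp: length_Suc_conv frl_phi simp del: frl.simps)
  also have "\<dots> = - act3 (W x i) ph a b c"
    unfolding cov_deriv_derl act3_def by (simp add: nth_Cons')
  finally show "act3 (W x i) ph a b c = 0" by simp
qed

end

section \<open>Torsion and curvature in an adapted frame\<close>

definition tor :: "christoffel \<Rightarrow> real^7 \<Rightarrow> 7 \<Rightarrow> 7 \<Rightarrow> 7 \<Rightarrow> real" where
  "tor \<Gamma> x i j l = \<Gamma> x i j l - \<Gamma> x j i l"

text \<open>The covariant derivative of the torsion with its last index raised, whence the opposite
  sign of the term for \<open>l\<close>.\<close>

definition nabla_tor :: "christoffel \<Rightarrow> real^7 \<Rightarrow> 7 \<Rightarrow> 7 \<Rightarrow> 7 \<Rightarrow> 7 \<Rightarrow> real" where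
  "nabla_tor \<Gamma> x i j k l = pd i (\<lambda>y. tor \<Gamma> y j k l) x + (\<Sum>\<^sub>7m. \<Gamma> x i m l * tor \<Gamma> x j k m)
     - (\<Sum>\<^sub>7m. \<Gamma> x i j m * tor \<Gamma> x m k l) - (\<Sum>\<^sub>7m. \<Gamma> x i k m * tor \<Gamma> x j m l)"

text \<open>The derivatives of the Christoffel symbols match directly. The remaining quadratic terms
  already agree for each \<open>m\<close>, before summation.\<close>

lemma first_Bianchi:
  assumes d: "\<And>i j l. (\<lambda>x. \<Gamma> x i j l) differentiable (at x)"
  shows "curvature_op \<Gamma> x i j k l + curvature_op \<Gamma> x j k i l + curvature_op \<Gamma> x k i j l =
    nabla_tor \<Gamma> x i j k l + nabla_tor \<Gamma> x j k i l + nabla_tor \<Gamma> x k i j l +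
    ((\<Sum>\<^sub>7m. tor \<Gamma> x i j m * tor \<Gamma> x m k l) + (\<Sum>\<^sub>7m. tor \<Gamma> x j k m * tor \<Gamma> x m i l)
     + (\<Sum>\<^sub>7m. tor \<Gamma> x k i m * tor \<Gamma> x m j l))"
proof -
  let ?G = "\<Gamma> x" and ?t = "tor \<Gamma> x"
  have pd: "pd i (\<lambda>y. tor \<Gamma> y j k l) x = pd i (\<lambda>y. \<Gamma> y j k l) x - pd i (\<lambda>y. \<Gamma> y k j l) x" for i j k
    unfolding tor_def by (rule pd_diff[OF d d])
  have "(\<Sum>\<^sub>7m. (?G j k m * ?G i m l - ?G i k m * ?G j m l) + (?G k i m * ?G j m l - ?G j i m * ?G k m l)
      + (?G i j m * ?G k m l - ?G k j m * ?G i m l)) =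
    (\<Sum>\<^sub>7m. (?G i m l * ?t j k m - ?G i j m * ?t m k l - ?G i k m * ?t j m l)
      + (?G j m l * ?t k i m - ?G j k m * ?t m i l - ?G j i m * ?t k m l)
      + (?G k m l * ?t i j m - ?G k i m * ?t m j l - ?G k j m * ?t i m l)
      + (?t i j m * ?t m k l + ?t j k m * ?t m i l + ?t k i m * ?t m j l))"
    by (rule sum.cong[OF refl], unfold tor_def) algebra
  then show ?thesis
    unfolding curvature_op_def nabla_tor_def pd sum.distrib sum_subtractf by simp
qed

lemma sum_rot3:
  "(\<Sum>\<^sub>7i. f i * (\<Sum>\<^sub>7j. h j * (\<Sum>\<^sub>7k. u k * Y j k i))) = (\<Sum>\<^sub>7i. h i * (\<Sum>\<^sub>7j. u j * (\<Sum>\<^sub>7k. f k * Y i j k)))"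
proof -
  have "(\<Sum>\<^sub>7i j k. f i * (h j * (u k * Y j k i))) = (\<Sum>\<^sub>7j k i. h j * (u k * (f i * Y j k i)))"
    by (rule trans[OF sum7_swap3]) (simp only: mult.left_commute)
  then show ?thesis unfolding sum_distrib_left .
qed

lemma sum_swap2:
  "(\<Sum>\<^sub>7i. f i * (\<Sum>\<^sub>7j. h j * Y i j)) = (\<Sum>\<^sub>7j. h j * (\<Sum>\<^sub>7i. f i * Y i j))"
  unfolding sum_distrib_left by (subst sum.swap) (simp only: mult.left_commute)

lemma sum_mult_neg:
  fixes f :: "7 \<Rightarrow> real"
  shows "(\<And>m. F m = - G m) \<Longrightarrow> (\<Sum>\<^sub>7m. f m * F m) = - (\<Sum>\<^sub>7m. f m * G m)"
  by (simp add: sum_negf)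

lemma frl_eq_0: "(\<And>I. length I = length J \<Longrightarrow> S I = 0) \<Longrightarrow> frl E S J = 0"
  using frl_cong[of J S "\<lambda>_. 0" E] frl_0[of E J] by simp

context adapted_frame
begin

abbreviation "tors \<equiv> torsion g \<Gamma>"

definition T :: "real^7 \<Rightarrow> 7 \<Rightarrow> 7 \<Rightarrow> 7 \<Rightarrow> real" where
  "T x a b c = frl (E x) (tors x) [a, b, c]"

definition dT :: "real^7 \<Rightarrow> 7 \<Rightarrow> 7 \<Rightarrow> 7 \<Rightarrow> 7 \<Rightarrow> real" where
  "dT x i b c d = pd i (\<lambda>y. T y b c d) x - act3 (W x i) (T x) b c d"

text \<open>The last index is an upper one and is therefore converted by the coframe
  \<open>e\<close>. As the frame is orthonormal, this agrees with lowering that index first and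
  converting by \<open>E\<close>, see \<open>lower\<close>.\<close>

definition frame4 :: "real^7 \<Rightarrow> (7 \<Rightarrow> 7 \<Rightarrow> 7 \<Rightarrow> 7 \<Rightarrow> real) \<Rightarrow> 7 \<Rightarrow> 7 \<Rightarrow> 7 \<Rightarrow> 7 \<Rightarrow> real" where
  "frame4 x X a b c d = (\<Sum>\<^sub>7i. E x a i * (\<Sum>\<^sub>7j. E x b j * (\<Sum>\<^sub>7k. E x c k * (\<Sum>\<^sub>7l. X i j k l * e d x [l]))))"

definition A :: "real^7 \<Rightarrow> 7 \<Rightarrow> 7 \<Rightarrow> 7 \<Rightarrow> 7 \<Rightarrow> real" where
  "A x a b c d = (\<Sum>\<^sub>7i. E x a i * dT x i b c d)"

text \<open>The first two indices refer to the coordinates, the others to the frame.\<close>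

definition Rf :: "real^7 \<Rightarrow> 7 \<Rightarrow> 7 \<Rightarrow> 7 \<Rightarrow> 7 \<Rightarrow> real" where
  "Rf x i j c d = (\<Sum>\<^sub>7k. E x c k * (\<Sum>\<^sub>7l. curvature_op \<Gamma> x i j k l * e d x [l]))"

definition R :: "real^7 \<Rightarrow> 7 \<Rightarrow> 7 \<Rightarrow> 7 \<Rightarrow> 7 \<Rightarrow> real" where
  "R x = frame4 x (curvature_op \<Gamma> x)"

lemma R_Rf: "R x a b c d = (\<Sum>\<^sub>7i. E x a i * (\<Sum>\<^sub>7j. E x b j * Rf x i j c d))"
  unfolding R_def frame4_def Rf_def ..

lemma lower: assumes x: "x \<in> V"
  shows "(\<Sum>\<^sub>7m. E x d m * (\<Sum>\<^sub>7l. X l * g x [l, m])) = (\<Sum>\<^sub>7l. X l * e d x [l])"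
proof -
  have "(\<Sum>\<^sub>7m. E x d m * (\<Sum>\<^sub>7l. X l * g x [l, m])) = (\<Sum>\<^sub>7l. X l * (\<Sum>\<^sub>7m. g x [l, m] * E x d m))"
    unfolding sum_distrib_left by (subst sum.swap) (simp only: mult_ac)
  then show ?thesis unfolding metric_E[OF x] .
qed

lemma tors_eq: "tors x [i, j, k] = (\<Sum>\<^sub>7l. tor \<Gamma> x i j l * g x [l, k])"
  unfolding torsion_def tor_def by simp

lemma T_eq: assumes x: "x \<in> V"
  shows "T x a b c = (\<Sum>\<^sub>7i. E x a i * (\<Sum>\<^sub>7j. E x b j * (\<Sum>\<^sub>7l. tor \<Gamma> x i j l * e c x [l])))"
  unfolding T_def frl.simps tors_eq lower[OF x] ..

lemma smooth_tors: "smooth_on V (\<lambda>x. tors x I)"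
  unfolding torsion_def
  by (intro smooth_on_sum smooth_on_mult smooth_on_diff V \<Gamma>_smooth smooth_metric)

lemma smooth_T: "smooth_on V (\<lambda>x. T x a b c)"
  unfolding T_def by (rule smooth_frame) (rule smooth_tors)

lemma T_skew3: assumes x: "x \<in> V" shows "skew3 (T x)"
proof -
  have s: "tors x [j, i, k] = - tors x [i, j, k]" "tors x [i, k, j] = - tors x [i, j, k]" for i j k
    using alternating_swap[OF torsion_alternating[OF x], of "[i, j, k]" 0 1]
      alternating_swap[OF torsion_alternating[OF x], of "[i, j, k]" 1 2] by (simp_all add: eval_nat_numeral)
  have "T x b a c = - T x a b c" for a b c
  proof -
    have "T x b a c = (\<Sum>\<^sub>7i. E x a i * (\<Sum>\<^sub>7j. E x b j * (\<Sum>\<^sub>7k. E x c k * tors x [j, i, k])))"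
      unfolding T_def frl.simps by (rule sum_swap2)
    then show ?thesis unfolding T_def frl.simps by (subst (asm) s(1)) (simp add: sum_negf)
  qed
  moreover have "T x a c b = - T x a b c" for a b c
  proof -
    have "T x a c b = (\<Sum>\<^sub>7i. E x a i * (\<Sum>\<^sub>7j. E x b j * (\<Sum>\<^sub>7k. E x c k * tors x [i, k, j])))"
      unfolding T_def frl.simps by (simp only: sum_swap2[of "E x c"])
    then show ?thesis unfolding T_def frl.simps by (subst (asm) s(2)) (simp add: sum_negf)
  qed
  ultimately show ?thesis unfolding skew3_def by blast
qed

lemma dT_frl: assumes x: "x \<in> V"
  shows "dT x i b c d = frl (E x) (cov_deriv \<Gamma> tors x i) [b, c, d]"
proof -
  have "cov_deriv W (\<lambda>y. frl (E y) (tors y)) x i [b, c, d] = dT x i b c d"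
    unfolding cov_deriv_derl dT_def act3_def T_def by (simp del: frl.simps)
  then show ?thesis using cov_deriv_frame[OF x, of "[b, c, d]" tors i] smooth_tors by simp
qed

lemma tor_differentiable: "x \<in> V \<Longrightarrow> (\<lambda>y. tor \<Gamma> y i j l) differentiable (at x)"
  unfolding tor_def
  by (rule smooth_on_differentiable[of V]) (intro smooth_on_diff V \<Gamma>_smooth)

text \<open>The metric is parallel, so lowering an index commutes with \<open>\<nabla>\<close>. This
  connects the torsion 3-form with \<open>first_Bianchi\<close>, which has the last index
  raised.\<close>

lemma cov_deriv_tors: assumes x: "x \<in> V"
  shows "cov_deriv \<Gamma> tors x i [j, k, m] = (\<Sum>\<^sub>7l. nabla_tor \<Gamma> x i j k l * g x [l, m])"
proof -
  let ?G = "\<Gamma> x" and ?t = "tor \<Gamma> x" and ?g = "\<lambda>i j. g x [i, j]"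
  have dg: "pd i (\<lambda>y. g y [l, m]) x = (\<Sum>\<^sub>7r. ?G i l r * ?g r m) + (\<Sum>\<^sub>7r. ?G i m r * ?g l r)" for l m
    using metric_parallel[OF x, of "[l, m]" i] unfolding cov_deriv_derl by simp
  have "pd i (\<lambda>y. \<Sum>\<^sub>7l. tor \<Gamma> y j k l * g y [l, m]) x =
    (\<Sum>\<^sub>7l. pd i (\<lambda>y. tor \<Gamma> y j k l) x * ?g l m + ?t j k l * pd i (\<lambda>y. g y [l, m]) x)"
    using tor_differentiable[OF x] smooth_on_differentiable[OF smooth_metric x]
    by (subst pd_sum) (auto simp: pd_mult differentiable_mult)
  also have "\<dots> = (\<Sum>\<^sub>7l. pd i (\<lambda>y. tor \<Gamma> y j k l) x * ?g l m)
    + ((\<Sum>\<^sub>7l. ?t j k l * (\<Sum>\<^sub>7r. ?G i l r * ?g r m)) + (\<Sum>\<^sub>7l. ?t j k l * (\<Sum>\<^sub>7r. ?G i m r * ?g l r)))"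
    unfolding dg distrib_left sum.distrib ..
  also have "(\<Sum>\<^sub>7l. ?t j k l * (\<Sum>\<^sub>7r. ?G i l r * ?g r m)) = (\<Sum>\<^sub>7l. (\<Sum>\<^sub>7m. ?G i m l * ?t j k m) * ?g l m)"
    unfolding sum7_assoc by (simp only: mult.commute)
  also have "(\<Sum>\<^sub>7l. ?t j k l * (\<Sum>\<^sub>7r. ?G i m r * ?g l r)) = (\<Sum>\<^sub>7r. ?G i m r * (\<Sum>\<^sub>7l. ?t j k l * ?g l r))"
    by (rule sum_swap2)
  finally have "cov_deriv \<Gamma> tors x i [j, k, m] = (\<Sum>\<^sub>7l. pd i (\<lambda>y. tor \<Gamma> y j k l) x * ?g l m)
     + (\<Sum>\<^sub>7l. (\<Sum>\<^sub>7m. ?G i m l * ?t j k m) * ?g l m)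
     - (\<Sum>\<^sub>7r. ?G i j r * (\<Sum>\<^sub>7l. ?t r k l * ?g l m)) - (\<Sum>\<^sub>7r. ?G i k r * (\<Sum>\<^sub>7l. ?t j r l * ?g l m))"
    unfolding cov_deriv_derl derl.simps tors_eq by simp
  then show ?thesis
    unfolding nabla_tor_def sum7_assoc left_diff_distrib distrib_right sum_subtractf sum.distrib by simp
qed

lemma A_frame4: assumes x: "x \<in> V" shows "A x a b c d = frame4 x (nabla_tor \<Gamma> x) a b c d"
  unfolding A_def dT_frl[OF x] frl.simps cov_deriv_tors[OF x] lower[OF x] frame4_def ..

lemma A_skew3: assumes x: "x \<in> V" shows "skew3 (A x a)"
proof -
  have "dT x i c b d = - dT x i b c d" "dT x i b d c = - dT x i b c d" for i b c d
  proof -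
    have p: "pd i (\<lambda>y. T y c b d) x = - pd i (\<lambda>y. T y b c d) x" "pd i (\<lambda>y. T y b d c) x = - pd i (\<lambda>y. T y b c d) x"
      unfolding pd_minus[OF smooth_on_differentiable[OF smooth_T x], symmetric]
      by (rule pd_cong_open[OF V x], erule skew3_12[OF T_skew3] skew3_23[OF T_skew3])+
    note T12 = skew3_12[OF T_skew3[OF x]] and T23 = skew3_23[OF T_skew3[OF x]]
    have s12: "(\<Sum>\<^sub>7m. W x i u m * T x v m w) = - (\<Sum>\<^sub>7m. W x i u m * T x m v w)"
      and s23: "(\<Sum>\<^sub>7m. W x i u m * T x w v m) = - (\<Sum>\<^sub>7m. W x i u m * T x w m v)"
      and s12': "(\<Sum>\<^sub>7m. W x i u m * T x v w m) = - (\<Sum>\<^sub>7m. W x i u m * T x w v m)"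
      and s23': "(\<Sum>\<^sub>7m. W x i u m * T x m v w) = - (\<Sum>\<^sub>7m. W x i u m * T x m w v)" for u v w
      by (rule sum_mult_neg, rule T12, rule sum_mult_neg, rule T23, rule sum_mult_neg, rule T12, rule sum_mult_neg, rule T23)
    show "dT x i c b d = - dT x i b c d"
      unfolding dT_def act3_def p using s12[of c b d] s12[of b c d] s12'[of d c b] by simp
    show "dT x i b d c = - dT x i b c d"
      unfolding dT_def act3_def p using s23'[of b d c] s23[of d b c] s23[of c b d] by simp
  qed
  then show ?thesis unfolding skew3_def A_def by (intro conjI allI sum_mult_neg)
qed

lemma frame4_rot: "frame4 x (\<lambda>i j k l. X j k i l) a b c d = frame4 x X b c a d"
  unfolding frame4_def by (rule sum_rot3)

lemma frame4_add: "frame4 x (\<lambda>i j k l. X i j k l + Y i j k l) a b c d = frame4 x X a b c d + frame4 x Y a b c d"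
  unfolding frame4_def distrib_right distrib_left sum.distrib ..

lemma frame4_contr: assumes x: "x \<in> V"
  shows "frame4 x (\<lambda>i j k l. \<Sum>\<^sub>7m. tor \<Gamma> x i j m * tor \<Gamma> x m k l) a b c d = (\<Sum>\<^sub>7n. T x a b n * T x n c d)"
proof -
  let ?t = "tor \<Gamma> x"
  define u where "u m = (\<Sum>\<^sub>7i. E x a i * (\<Sum>\<^sub>7j. E x b j * ?t i j m))" for m
  define v where "v m = (\<Sum>\<^sub>7k. E x c k * (\<Sum>\<^sub>7l. ?t m k l * e d x [l]))" for m
  have out: "(\<Sum>\<^sub>7k. h k * (\<Sum>\<^sub>7m. f m * q m k)) = (\<Sum>\<^sub>7m. f m * (\<Sum>\<^sub>7k. h k * q m k))" for h f and q :: "7 \<Rightarrow> 7 \<Rightarrow> real"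
    by (rule sum_swap2)
  have "(\<Sum>\<^sub>7l. (\<Sum>\<^sub>7m. ?t i j m * ?t m k l) * e d x [l]) = (\<Sum>\<^sub>7m. ?t i j m * (\<Sum>\<^sub>7l. ?t m k l * e d x [l]))" for i j k
    unfolding sum7_assoc ..
  then have "frame4 x (\<lambda>i j k l. \<Sum>\<^sub>7m. ?t i j m * ?t m k l) a b c d = (\<Sum>\<^sub>7i. E x a i * (\<Sum>\<^sub>7j. E x b j * (\<Sum>\<^sub>7m. ?t i j m * v m)))"
    unfolding frame4_def v_def by (simp only: out[of "E x c"])
  also have "\<dots> = (\<Sum>\<^sub>7m. u m * v m)"
    unfolding u_def sum7_assoc ..
  finally have 1: "frame4 x (\<lambda>i j k l. \<Sum>\<^sub>7m. ?t i j m * ?t m k l) a b c d = (\<Sum>\<^sub>7m. u m * v m)" .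
  have Tu: "T x a b n = (\<Sum>\<^sub>7m. u m * e n x [m])" for n
    unfolding T_eq[OF x] u_def sum7_assoc ..
  have Tv: "T x n c d = (\<Sum>\<^sub>7m. E x n m * v m)" for n
    unfolding T_eq[OF x] v_def ..
  have "(\<Sum>\<^sub>7n. T x a b n * T x n c d) = (\<Sum>\<^sub>7m. (\<Sum>\<^sub>7n. (\<Sum>\<^sub>7p. u p * e n x [p]) * E x n m) * v m)"
    unfolding Tu Tv by (rule sum7_assoc)
  also have "\<dots> = (\<Sum>\<^sub>7m. (\<Sum>\<^sub>7p. u p * (\<Sum>\<^sub>7n. e n x [p] * E x n m)) * v m)"
    unfolding sum7_assoc ..
  finally show ?thesis unfolding 1 E_e[OF x] by simp
qed

lemma Bianchi_frame: assumes x: "x \<in> V"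
  shows "R x a b c d + R x b c a d + R x c a b d = A x a b c d + A x b c a d + A x c a b d + sigma4 (T x) a b c d"
proof -
  let ?c = "curvature_op \<Gamma> x" and ?n = "nabla_tor \<Gamma> x" and ?t = "tor \<Gamma> x"
  let ?q = "\<lambda>i j k l. \<Sum>\<^sub>7m. ?t i j m * ?t m k l"
  have r2: "frame4 x (\<lambda>i j k l. X k i j l) a b c d = frame4 x X c a b d" for X
    using frame4_rot[of x "\<lambda>i j k l. X j k i l" a b c d] frame4_rot[of x X b c a d] by simp
  have "frame4 x (\<lambda>i j k l. ?c i j k l + ?c j k i l + ?c k i j l) a b c d =
    frame4 x (\<lambda>i j k l. ?n i j k l + ?n j k i l + ?n k i j l + (?q i j k l + ?q j k i l + ?q k i j l)) a b c d"
    using first_Bianchi[OF smooth_on_differentiable[OF \<Gamma>_smooth x]] by simp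
  then show ?thesis
    unfolding frame4_add frame4_rot[of x ?c] frame4_rot[of x ?n] frame4_rot[of x ?q] r2[of ?c] r2[of ?n] r2[of ?q]
      frame4_contr[OF x] R_def A_frame4[OF x] sigma4_def by simp
qed

lemma R_skew12: "R x b a c d = - R x a b c d"
proof -
  have c: "curvature_op \<Gamma> x j i k l = - curvature_op \<Gamma> x i j k l" for i j k l
    unfolding curvature_op_def sum_subtractf by simp
  have "R x b a c d = (\<Sum>\<^sub>7i. E x a i * (\<Sum>\<^sub>7j. E x b j * Rf x j i c d))"
    unfolding R_Rf by (rule sum_swap2)
  also have "\<dots> = - R x a b c d"
    unfolding R_Rf
  proof (intro sum_mult_neg)
    fix i j
    show "Rf x j i c d = - Rf x i j c d"
      unfolding Rf_def c[of j i] by (simp only: mult_minus_left mult_minus_right sum_negf)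
  qed
  finally show ?thesis .
qed

lemma Rf_derl: assumes x: "x \<in> V"
  shows "derl (Rf x i j) (frl (E x) S) J = frl (E x) (derl (curvature_op \<Gamma> x i j) S) J"
proof (rule derl_frl)
  fix a l
  have "(\<Sum>\<^sub>7b. Rf x i j a b * E x b l) = (\<Sum>\<^sub>7b. (\<Sum>\<^sub>7m. (\<Sum>\<^sub>7k. E x a k * curvature_op \<Gamma> x i j k m) * e b x [m]) * E x b l)"
    unfolding Rf_def sum7_assoc ..
  also have "\<dots> = (\<Sum>\<^sub>7m. (\<Sum>\<^sub>7k. E x a k * curvature_op \<Gamma> x i j k m) * (\<Sum>\<^sub>7b. e b x [m] * E x b l))"
    by (simp only: sum7_assoc)
  finally show "(\<Sum>\<^sub>7b. Rf x i j a b * E x b l) = (\<Sum>\<^sub>7k. E x a k * curvature_op \<Gamma> x i j k l)"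
    unfolding E_e[OF x] by simp
qed

text \<open>For a parallel field the left-hand side of the Ricci identity is zero. Applied to the
  metric and to \<open>\<phi>\<close>, this places the second pair of curvature indices in
  g2.\<close>

lemma parallel_curvature:
  assumes x: "x \<in> V" and S: "\<And>J. length J = length I \<Longrightarrow> smooth_on V (\<lambda>y. S y J)"
    and p: "\<And>y i J. y \<in> V \<Longrightarrow> length J = length I \<Longrightarrow> cov_deriv \<Gamma> S y i J = 0"
  shows "derl (curvature_op \<Gamma> x i j) (S x) I = 0"
proof -
  have "cov_deriv \<Gamma> (\<lambda>y. cov_deriv \<Gamma> S y j) x i I = cov_deriv \<Gamma> (\<lambda>y J. 0) x i I" for i j
    by (rule cov_deriv_cong[OF V x]) (rule p)
  then have "cov_deriv \<Gamma> (\<lambda>y. cov_deriv \<Gamma> S y j) x i I = 0" for i j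
    unfolding cov_deriv_derl by (simp add: derl_0)
  then show ?thesis using Ricci_identity[where \<Gamma> = \<Gamma> and I = I and S = S and i = i and j = j, OF V x \<Gamma>_smooth S] by simp
qed

lemma Rf_skew: assumes x: "x \<in> V" shows "Rf x i j d c = - Rf x i j c d"
proof -
  have "0 = frl (E x) (derl (curvature_op \<Gamma> x i j) (g x)) [c, d]"
  proof (rule frl_eq_0[symmetric], rule parallel_curvature[OF x])
    show "smooth_on V (\<lambda>y. g y J)" if "length (I :: 7 list) = length [c, d]" "length J = length I" for I J
      using that smooth_metric by (auto simp: length_Suc_conv)
  qed (simp add: metric_parallel)
  also have "\<dots> = derl (Rf x i j) (frl (E x) (g x)) [c, d]" unfolding Rf_derl[OF x] ..
  also have "\<dots> = derl (Rf x i j) (\<lambda>J. kd (J ! 0) (J ! 1)) [c, d]"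
    by (rule derl_cong) (auto simp: length_Suc_conv frl_metric[OF x] simp del: frl.simps)
  also have "\<dots> = Rf x i j c d + Rf x i j d c" by simp
  finally show ?thesis by simp
qed

lemma Rf_g2: assumes x: "x \<in> V" shows "(\<Sum>\<^sub>7c d. Rf x i j c d * ph k c d) = 0"
proof (rule stabilizer_ph)
  fix c d f
  have "0 = frl (E x) (derl (curvature_op \<Gamma> x i j) (\<phi> x)) [c, d, f]"
    by (rule frl_eq_0[symmetric], rule parallel_curvature[OF x]) (simp_all add: smooth_phi phi_parallel)
  also have "\<dots> = derl (Rf x i j) (frl (E x) (\<phi> x)) [c, d, f]" unfolding Rf_derl[OF x] ..
  also have "\<dots> = derl (Rf x i j) (\<lambda>J. ph (J ! 0) (J ! 1) (J ! 2)) [c, d, f]"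
    by (rule derl_cong) (auto simp: length_Suc_conv frl_phi[OF x] simp del: frl.simps)
  finally show "(\<Sum>\<^sub>7a. Rf x i j c a * ph a d f) + (\<Sum>\<^sub>7a. Rf x i j d a * ph c a f) + (\<Sum>\<^sub>7a. Rf x i j f a * ph c d a) = 0"
    by (simp add: nth_Cons')
qed

lemma R_skew34: assumes x: "x \<in> V" shows "R x a b d c = - R x a b c d"
  unfolding R_Rf by (subst Rf_skew[OF x]) (simp only: mult_minus_right sum_negf)

lemma R_g2: assumes x: "x \<in> V" shows "(\<Sum>\<^sub>7c d. R x a b c d * ph k c d) = 0"
proof -
  have *: "(\<Sum>\<^sub>7c d. (\<Sum>\<^sub>7i. f i * X i c d) * ph k c d) = (\<Sum>\<^sub>7i. f i * (\<Sum>\<^sub>7c d. X i c d * ph k c d))" for f and X :: "7 \<Rightarrow> 7 \<Rightarrow> 7 \<Rightarrow> real"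
    by (rule sum7_out)
  show ?thesis unfolding R_Rf * Rf_g2[OF x] by simp
qed

end

section \<open>Exterior derivatives of parallel forms\<close>

text \<open>\<open>frl_permute\<close> for a permutation given as a list of positions, the form in
  which the terms of an exterior derivative are written.\<close>

lemma frl_index_permute:
  assumes "length J = n" "distinct is" "length is = n" "list_all (\<lambda>i. i < n) is"
  shows "frl M (\<lambda>I. S (map ((!) I) is)) J = frl M S (map ((!) J) is)"
proof -
  note l = assms(3)
  have set: "set is = {..<n}"
    by (rule card_subset_eq) (use assms in \<open>auto simp: list_all_iff distinct_card\<close>)
  define \<pi> where "\<pi> k = (if k < n then is ! k else k)" for k
  have b: "bij_betw \<pi> {..<n} {..<n}"
  proof (rule bij_betw_imageI)
    show "inj_on \<pi> {..<n}"
      unfolding \<pi>_def inj_on_def using nth_eq_iff_index_eq[OF assms(2)] l by auto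
    show "\<pi> ` {..<n} = {..<n}"
    proof -
      have "\<pi> ` {..<n} = set is" unfolding \<pi>_def by (auto simp: in_set_conv_nth l image_iff)
      then show ?thesis using set by simp
    qed
  qed
  have \<pi>: "\<pi> permutes {..<n}"
    by (rule bij_imp_permutes[OF b]) (simp add: \<pi>_def)
  have m: "map (\<lambda>k. I ! \<pi> k) [0..<n] = map ((!) I) is" for I :: "7 list"
    using l by (intro nth_equalityI) (auto simp: \<pi>_def)
  show ?thesis using frl_permute[OF \<pi> assms(1), of M S] unfolding m .
qed

lemma alternating_frl:
  assumes S: "alternating n S"
  shows "alternating n (frl M S)"
  unfolding alternating_def
proof (intro allI impI)
  fix I :: "7 list" and j k assume *: "length I = n \<and> j < k \<and> k < n"
  let ?\<tau> = "Transposition.transpose j k"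
  have t: "?\<tau> permutes {..<n}" using * by (intro permutes_swap_id) auto
  have m: "map (\<lambda>i. L ! ?\<tau> i) [0..<n] = L[j := L ! k, k := L ! j]" if "length L = n" for L :: "7 list"
    using * that by (intro nth_equalityI) (auto simp: nth_transpose)
  have "frl M S (I[j := I ! k, k := I ! j]) = frl M (\<lambda>L. S (map (\<lambda>i. L ! ?\<tau> i) [0..<n])) I"
    using frl_permute[OF t, of I M S] m[of I] * by simp
  also have "\<dots> = frl M (\<lambda>L. -1 * S L) I"
    by (rule frl_cong) (use alternating_swap[OF S] m * in auto)
  finally show "frl M S (I[j := I ! k, k := I ! j]) = - frl M S I" unfolding frl_cmult by simp
qed

lemma alternating_cong:
  assumes "\<And>I. length I = n \<Longrightarrow> S I = S' I" shows "alternating n S \<longleftrightarrow> alternating n S'"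
  unfolding alternating_def using assms by simp

lemma alternating_4_front:
  assumes s: "alternating 4 s"
  shows "s [j, n, k, l] = - s [n, j, k, l]" "s [j, k, n, l] = s [n, j, k, l]" "s [j, k, l, n] = - s [n, j, k, l]"
  using alternating_swap[OF s, of "[j, n, k, l]" 0 1] alternating_swap[OF s, of "[j, k, n, l]" 0 2]
    alternating_swap[OF s, of "[n, k, j, l]" 1 2] alternating_swap[OF s, of "[j, k, l, n]" 2 3]
    alternating_swap[OF s, of "[j, k, n, l]" 1 2] alternating_swap[OF s, of "[j, n, k, l]" 0 1]
  by (simp_all add: eval_nat_numeral)

lemma alternating_3_front:
  assumes s: "alternating 3 s"
  shows "s [j, n, k] = - s [n, j, k]" "s [j, k, n] = s [n, j, k]"
  using alternating_swap[OF s, of "[j, n, k]" 0 1] alternating_swap[OF s, of "[j, k, n]" 0 2]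
    alternating_swap[OF s, of "[n, k, j]" 1 2]
  by (simp_all add: eval_nat_numeral)

definition tor_contr :: "(7 \<Rightarrow> 7 \<Rightarrow> 7 \<Rightarrow> real) \<Rightarrow> tensor \<Rightarrow> tensor" where
  "tor_contr t S I = (\<Sum>\<^sub>7n. t (I ! 0) (I ! 1) n * S (n # drop 2 I))"

text \<open>Parallelism replaces partial derivatives by Christoffel terms. Skew symmetry brings the
  summed index to the front, and the terms with \<open>\<Gamma> x i j\<close> and
  \<open>\<Gamma> x j i\<close> combine to torsion, once for each of the ten pairs of slots.\<close>

lemma ext_d_parallel_4:
  assumes s: "alternating 4 (S x)" and p: "\<And>i I. length I = 4 \<Longrightarrow> cov_deriv \<Gamma> S x i I = 0"
  defines "X \<equiv> tor_contr (tor \<Gamma> x) (S x)"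
  shows "ext_d S x [i, j, k, l, m] = X [i, j, k, l, m] - X [i, k, j, l, m] + X [i, l, j, k, m]
    - X [i, m, j, k, l] + X [j, k, i, l, m] - X [j, l, i, k, m] + X [j, m, i, k, l] + X [k, l, i, j, m]
    - X [k, m, i, j, l] + X [l, m, i, j, k]"
proof -
  define c where "c i j L = (\<Sum>\<^sub>7n. \<Gamma> x i j n * S x (n # L))" for i j L
  have c2: "(\<Sum>\<^sub>7n. \<Gamma> x i k n * S x [j, n, l, m]) = - c i k [j, l, m]" for i j k l m
    unfolding c_def by (rule sum_mult_neg) (rule alternating_4_front[OF s])
  have c3: "(\<Sum>\<^sub>7n. \<Gamma> x i k n * S x [j, l, n, m]) = c i k [j, l, m]" for i j k l m
    unfolding c_def alternating_4_front(2)[OF s, of j l _ m] ..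
  have c4: "(\<Sum>\<^sub>7n. \<Gamma> x i k n * S x [j, l, m, n]) = - c i k [j, l, m]" for i j k l m
    unfolding c_def by (rule sum_mult_neg) (rule alternating_4_front[OF s])
  have pd: "pd i (\<lambda>y. S y [j, k, l, m]) x = c i j [k, l, m] - c i k [j, l, m] + c i l [j, k, m] - c i m [j, k, l]" for i j k l m
    using p[of "[j, k, l, m]" i] unfolding cov_deriv_derl derl.simps c2 c3 c4 by (simp add: c_def)
  have X: "X (i # j # L) = c i j L - c j i L" for i j L
    unfolding X_def tor_contr_def tor_def c_def by (simp add: left_diff_distrib sum_subtractf)
  show ?thesis
    unfolding X ext_d_def by (simp add: pd)
qed

lemma ext_d_parallel_3:
  assumes s: "alternating 3 (S x)" and p: "\<And>i I. length I = 3 \<Longrightarrow> cov_deriv \<Gamma> S x i I = 0"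
  defines "X \<equiv> tor_contr (tor \<Gamma> x) (S x)"
  shows "ext_d S x [i, j, k, l] = X [i, j, k, l] - X [i, k, j, l] + X [i, l, j, k]
    + X [j, k, i, l] - X [j, l, i, k] + X [k, l, i, j]"
proof -
  define c where "c i j L = (\<Sum>\<^sub>7n. \<Gamma> x i j n * S x (n # L))" for i j L
  have c2: "(\<Sum>\<^sub>7n. \<Gamma> x i k n * S x [j, n, l]) = - c i k [j, l]" for i j k l
    unfolding c_def by (rule sum_mult_neg) (rule alternating_3_front[OF s])
  have c3: "(\<Sum>\<^sub>7n. \<Gamma> x i k n * S x [j, l, n]) = c i k [j, l]" for i j k l
    unfolding c_def alternating_3_front(2)[OF s, of j l] ..
  have pd: "pd i (\<lambda>y. S y [j, k, l]) x = c i j [k, l] - c i k [j, l] + c i l [j, k]" for i j k l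
    using p[of "[j, k, l]" i] unfolding cov_deriv_derl derl.simps c2 c3 by (simp add: c_def)
  have X: "X (i # j # L) = c i j L - c j i L" for i j L
    unfolding X_def tor_contr_def tor_def c_def by (simp add: left_diff_distrib sum_subtractf)
  show ?thesis
    unfolding X ext_d_def by (simp add: pd)
qed

lemma ps_skew14: "ps d b c a = - ps a b c d"
  using ps_skew12[of d b c a] ps_skew13[of b d c a] ps_skew34[of c d b a] ps_rot[of c a b d]
    ps_rot[of d b c a] ps_cyc[of b c a d] ps_pair[of c d a b] by simp

lemma alternating_ps: "alternating 4 (\<lambda>J. ps (J ! 0) (J ! 1) (J ! 2) (J ! 3))"
  unfolding alternating_def
proof (intro allI impI)
  fix I :: "7 list" and j k :: nat assume *: "length I = 4 \<and> j < k \<and> k < 4"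
  then obtain a b c d where I: "I = [a, b, c, d]" by (auto simp: length_Suc_conv eval_nat_numeral)
  consider "j = 0" "k = 1" | "j = 0" "k = 2" | "j = 0" "k = 3" | "j = 1" "k = 2" | "j = 1" "k = 3" | "j = 2" "k = 3"
    using * by linarith
  then show "ps (I[j := I ! k, k := I ! j] ! 0) (I[j := I ! k, k := I ! j] ! 1) (I[j := I ! k, k := I ! j] ! 2)
      (I[j := I ! k, k := I ! j] ! 3) = - ps (I ! 0) (I ! 1) (I ! 2) (I ! 3)"
    unfolding I by cases (simp_all add: ps_skew12[of b a] ps_skew13[of c b a] ps_skew14[of d b c a]
      ps_skew23[of a c b] ps_skew24[of a d c b] ps_skew34[of a b d c] eval_nat_numeral)
qed

lemma alternating_ph: "alternating 3 (\<lambda>J. ph (J ! 0) (J ! 1) (J ! 2))"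
  unfolding alternating_def
proof (intro allI impI)
  fix I :: "7 list" and j k :: nat assume *: "length I = 3 \<and> j < k \<and> k < 3"
  then obtain a b c where I: "I = [a, b, c]" by (auto simp: length_Suc_conv eval_nat_numeral)
  consider "j = 0" "k = 1" | "j = 0" "k = 2" | "j = 1" "k = 2" using * by linarith
  then show "ph (I[j := I ! k, k := I ! j] ! 0) (I[j := I ! k, k := I ! j] ! 1) (I[j := I ! k, k := I ! j] ! 2) =
      - ph (I ! 0) (I ! 1) (I ! 2)"
    unfolding I by cases (simp_all add: ph_skew12[of b a] ph_skew13[of c b a] ph_skew23[of a c b] eval_nat_numeral)
qed

context adapted_frame
begin

lemma frl_tor_contr: assumes x: "x \<in> V"
  shows "frl (E x) (tor_contr (tor \<Gamma> x) S) (a # b # J) = (\<Sum>\<^sub>7n. T x a b n * frl (E x) S (n # J))"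
proof -
  let ?t = "tor \<Gamma> x"
  define u where "u m = (\<Sum>\<^sub>7i. E x a i * (\<Sum>\<^sub>7j. E x b j * ?t i j m))" for m
  define v where "v m = frl (E x) (\<lambda>I. S (m # I)) J" for m
  have "frl (E x) (\<lambda>I. tor_contr ?t S (i # j # I)) J = (\<Sum>\<^sub>7m. ?t i j m * v m)" for i j
    unfolding tor_contr_def v_def by (simp add: frl_sum frl_cmult)
  then have "frl (E x) (tor_contr ?t S) (a # b # J) = (\<Sum>\<^sub>7i. E x a i * (\<Sum>\<^sub>7j. E x b j * (\<Sum>\<^sub>7m. ?t i j m * v m)))"
    by (simp only: frl.simps)
  also have "\<dots> = (\<Sum>\<^sub>7m. u m * v m)"
    unfolding u_def sum7_assoc ..
  finally have 1: "frl (E x) (tor_contr ?t S) (a # b # J) = (\<Sum>\<^sub>7m. u m * v m)" .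
  have Tu: "T x a b n = (\<Sum>\<^sub>7m. u m * e n x [m])" for n
    unfolding T_eq[OF x] u_def sum7_assoc ..
  have "(\<Sum>\<^sub>7n. T x a b n * frl (E x) S (n # J)) = (\<Sum>\<^sub>7m. (\<Sum>\<^sub>7n. (\<Sum>\<^sub>7p. u p * e n x [p]) * E x n m) * v m)"
    unfolding Tu frl.simps v_def[symmetric] by (rule sum7_assoc)
  also have "\<dots> = (\<Sum>\<^sub>7m. (\<Sum>\<^sub>7p. u p * (\<Sum>\<^sub>7n. e n x [p] * E x n m)) * v m)"
    unfolding sum7_assoc ..
  finally show ?thesis unfolding 1 E_e[OF x] by simp
qed

lemma alternating_star: assumes x: "x \<in> V" shows "alternating 4 (star x)"
proof -
  have "star x I = frl (\<lambda>i a. e a x [i]) (\<lambda>J. ps (J ! 0) (J ! 1) (J ! 2) (J ! 3)) I" if "length I = 4" for I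
    unfolding coframe_frl[OF x, of "star x" I, symmetric]
    by (rule frl_cong) (use that in \<open>auto simp: frl_star[OF x] length_Suc_conv eval_nat_numeral simp del: frl.simps\<close>)
  from alternating_cong[of 4, OF this] show ?thesis using alternating_frl[OF alternating_ps] by simp
qed

lemma alternating_phi: assumes x: "x \<in> V" shows "alternating 3 (\<phi> x)"
proof -
  have "\<phi> x I = frl (\<lambda>i a. e a x [i]) (\<lambda>J. ph (J ! 0) (J ! 1) (J ! 2)) I" if "length I = 3" for I
    unfolding coframe_frl[OF x, of "\<phi> x" I, symmetric]
    by (rule frl_cong) (use that in \<open>auto simp: frl_phi[OF x] length_Suc_conv eval_nat_numeral simp del: frl.simps\<close>)
  from alternating_cong[of 3, OF this] show ?thesis using alternating_frl[OF alternating_ph] by simp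
qed

lemma star_parallel: assumes x: "x \<in> V" and I: "length I = 4" shows "cov_deriv \<Gamma> star x i I = 0"
proof (rule frl_eq_0_imp[OF x])
  fix J :: "7 list" assume "length J = length I"
  then obtain a b c d where J: "J = [a, b, c, d]" using I by (auto simp: length_Suc_conv eval_nat_numeral)
  interpret w: g2_element "W x i" by (rule W_g2[OF x])
  have "frl (E x) (cov_deriv \<Gamma> star x i) J = cov_deriv W (\<lambda>y. frl (E y) (star y)) x i J"
    by (rule cov_deriv_frame[OF x, symmetric]) (simp add: smooth_star J)
  also have "\<dots> = cov_deriv W (\<lambda>y J. ps (J ! 0) (J ! 1) (J ! 2) (J ! 3)) x i J"
    unfolding J by (rule cov_deriv_cong[OF V x]) (auto simp: length_Suc_conv frl_star simp del: frl.simps)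
  also have "\<dots> = - act4 (W x i) ps a b c d"
    unfolding cov_deriv_derl act4_def J by simp
  finally show "frl (E x) (cov_deriv \<Gamma> star x i) J = 0" unfolding w.ps_act by simp
qed

lemma frl_ext_d_star: assumes x: "x \<in> V"
  defines "X \<equiv> \<lambda>i j k l m. \<Sum>\<^sub>7n. T x i j n * ps n k l m"
  shows "frl (E x) (ext_d star x) [i, j, k, l, m] = X i j k l m - X i k j l m + X i l j k m - X i m j k l
     + X j k i l m - X j l i k m + X j m i k l + X k l i j m - X k m i j l + X l m i j k"
proof -
  let ?X = "tor_contr (tor \<Gamma> x) (star x)"
  \<comment> \<open>The first two positions in the list are the slots that the torsion
    occupies.\<close>
  let ?P = "\<lambda>is I. ?X (map ((!) I) is)"
  have "frl (E x) (ext_d star x) [i, j, k, l, m] = frl (E x) (\<lambda>I. ?P [0, 1, 2, 3, 4] I - ?P [0, 2, 1, 3, 4] I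
    + ?P [0, 3, 1, 2, 4] I - ?P [0, 4, 1, 2, 3] I + ?P [1, 2, 0, 3, 4] I - ?P [1, 3, 0, 2, 4] I + ?P [1, 4, 0, 2, 3] I
    + ?P [2, 3, 0, 1, 4] I - ?P [2, 4, 0, 1, 3] I + ?P [3, 4, 0, 1, 2] I) [i, j, k, l, m]"
  proof (rule frl_cong)
    fix I :: "7 list" assume "length I = length [i, j, k, l, m]"
    then obtain a b c d f where I: "I = [a, b, c, d, f]" by (auto simp: length_Suc_conv)
    show "ext_d star x I = ?P [0, 1, 2, 3, 4] I - ?P [0, 2, 1, 3, 4] I
    + ?P [0, 3, 1, 2, 4] I - ?P [0, 4, 1, 2, 3] I + ?P [1, 2, 0, 3, 4] I - ?P [1, 3, 0, 2, 4] I + ?P [1, 4, 0, 2, 3] I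
    + ?P [2, 3, 0, 1, 4] I - ?P [2, 4, 0, 1, 3] I + ?P [3, 4, 0, 1, 2] I"
      unfolding I using ext_d_parallel_4[OF alternating_star[OF x] star_parallel[OF x]] by simp
  qed
  moreover have "frl (E x) (?P is) [i, j, k, l, m] = frl (E x) ?X (map ((!) [i, j, k, l, m]) is)"
    if "distinct is" "length is = 5" "list_all (\<lambda>i. i < 5) is" for "is"
    by (rule frl_index_permute[OF _ that]) simp
  moreover have "frl (E x) ?X [a, b, c, d, f] = X a b c d f" for a b c d f
    unfolding frl_tor_contr[OF x] frl_star[OF x] X_def ..
  ultimately show ?thesis
    unfolding frl_add frl_diff by (simp del: frl.simps list.map) (simp del: frl.simps)
qed

lemma frl_ext_d_3: assumes x: "x \<in> V" and S: "alternating 3 (S x)" "\<And>i I. length I = 3 \<Longrightarrow> cov_deriv \<Gamma> S x i I = 0"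
  defines "X \<equiv> \<lambda>i j k l. \<Sum>\<^sub>7n. T x i j n * frl (E x) (S x) [n, k, l]"
  shows "frl (E x) (ext_d S x) [i, j, k, l] = X i j k l - X i k j l + X i l j k
     + X j k i l - X j l i k + X k l i j"
proof -
  let ?X = "tor_contr (tor \<Gamma> x) (S x)"
  let ?P = "\<lambda>is I. ?X (map ((!) I) is)"
  have "frl (E x) (ext_d S x) [i, j, k, l] = frl (E x) (\<lambda>I. ?P [0, 1, 2, 3] I - ?P [0, 2, 1, 3] I
    + ?P [0, 3, 1, 2] I + ?P [1, 2, 0, 3] I - ?P [1, 3, 0, 2] I + ?P [2, 3, 0, 1] I) [i, j, k, l]"
  proof (rule frl_cong)
    fix I :: "7 list" assume "length I = length [i, j, k, l]"
    then obtain a b c d where I: "I = [a, b, c, d]" by (auto simp: length_Suc_conv)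
    show "ext_d S x I = ?P [0, 1, 2, 3] I - ?P [0, 2, 1, 3] I
    + ?P [0, 3, 1, 2] I + ?P [1, 2, 0, 3] I - ?P [1, 3, 0, 2] I + ?P [2, 3, 0, 1] I"
      unfolding I using ext_d_parallel_3[OF S] by simp
  qed
  moreover have "frl (E x) (?P is) [i, j, k, l] = frl (E x) ?X (map ((!) [i, j, k, l]) is)"
    if "distinct is" "length is = 4" "list_all (\<lambda>i. i < 4) is" for "is"
    by (rule frl_index_permute[OF _ that]) simp
  moreover have "frl (E x) ?X [a, b, c, d] = X a b c d" for a b c d
    unfolding frl_tor_contr[OF x] X_def ..
  ultimately show ?thesis
    unfolding frl_add frl_diff by (simp del: frl.simps list.map) (simp del: frl.simps)
qed

end

section \<open>Parallel torsion\<close>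

lemma sum_out: "(\<Sum>\<^sub>7k. h k * (\<Sum>\<^sub>7a. F a k)) = (\<Sum>\<^sub>7a. \<Sum>\<^sub>7k. h k * F a k)"
  unfolding sum_distrib_left by (rule sum.swap)

lemma phc_comb: "phc (\<lambda>b c d. \<Sum>\<^sub>7i. h i * F i b c d) b c = (\<Sum>\<^sub>7i. h i * phc (F i) b c)"
  unfolding phc_def by (rule sum7_out)

locale adapted_instanton = adapted_frame +
  assumes integrable: "\<And>x I. x \<in> V \<Longrightarrow> length I = 5 \<Longrightarrow>
      ext_d (star_phi g vol \<phi>) x I = wedge 1 4 (lee_form g vol \<phi> x) (star_phi g vol \<phi> x) I"
    and lee_parallel: "\<And>x i j. x \<in> V \<Longrightarrow> cov_deriv \<Gamma> (lee_form g vol \<phi>) x i [j] = 0"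
    and instanton: "\<And>x i j k. x \<in> V \<Longrightarrow>
      (\<Sum>\<^sub>7a b p q. inv_metric (g x) a p * inv_metric (g x) b q * curvature g \<Gamma> x a b i j * \<phi> x [p, q, k]) = 0"
begin

abbreviation "lee \<equiv> lee_form g vol \<phi>"

definition th :: "real^7 \<Rightarrow> 7 \<Rightarrow> real" where
  "th x a = frl (E x) (lee x) [a]"

text \<open>Since \<open>*\<phi>\<close> is parallel, \<open>d*\<phi>\<close> is algebraic in \<open>T\<close>, and \<open>d*\<phi> = \<theta> \<and> *\<phi>\<close> becomes linear in \<open>T\<close>.\<close>

lemma phcT_skew: assumes x: "x \<in> V"
  shows "phc (T x) i j - phc (T x) j i = - 2 * (\<Sum>\<^sub>7k. th x k * ph k i j)"
proof (rule skew_part_phc[OF T_skew3[OF x]])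
  fix i j k l m
  let ?ps = "\<lambda>J. ps (J ! 0) (J ! 1) (J ! 2) (J ! 3)"
  have "frl (E x) (ext_d star x) [i, j, k, l, m] = frl (E x) (wedge 1 4 (lee x) (star x)) [i, j, k, l, m]"
    by (rule frl_cong) (simp add: integrable[OF x])
  also have "\<dots> = wedge 1 4 (frl (E x) (lee x)) (frl (E x) (star x)) [i, j, k, l, m]"
    by (rule frl_wedge) simp
  also have "\<dots> = wedge 1 4 (frl (E x) (lee x)) ?ps [i, j, k, l, m]"
    by (rule wedge_cong) (auto simp: frl_star[OF x] length_Suc_conv eval_nat_numeral simp del: frl.simps)
  also have "\<dots> = th x i * ps j k l m - (th x j * ps i k l m + th x k * ps j i l m + th x l * ps j k i m + th x m * ps j k l i)"
    unfolding th_def by (subst wedge_1[OF alternating_ps]) (simp_all add: eval_nat_numeral del: frl.simps)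
  finally have F: "frl (E x) (ext_d star x) [i, j, k, l, m] =
      th x i * ps j k l m - th x j * ps i k l m + th x k * ps i j l m - th x l * ps i j k m + th x m * ps i j k l"
    using ps_skew12[of j i l m] ps_cyc[of j k i m] ps_rot[of j k l i] by simp
  show "(\<Sum>\<^sub>7a. T x i j a * ps a k l m) - (\<Sum>\<^sub>7a. T x i k a * ps a j l m) + (\<Sum>\<^sub>7a. T x i l a * ps a j k m)
     - (\<Sum>\<^sub>7a. T x i m a * ps a j k l) + (\<Sum>\<^sub>7a. T x j k a * ps a i l m) - (\<Sum>\<^sub>7a. T x j l a * ps a i k m)
     + (\<Sum>\<^sub>7a. T x j m a * ps a i k l) + (\<Sum>\<^sub>7a. T x k l a * ps a i j m) - (\<Sum>\<^sub>7a. T x k m a * ps a i j l)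
     + (\<Sum>\<^sub>7a. T x l m a * ps a i j k) =
     th x i * ps j k l m - th x j * ps i k l m + th x k * ps i j l m - th x l * ps i j k m + th x m * ps i j k l"
    using F unfolding frl_ext_d_star[OF x] .
qed

text \<open>The hypothesis lives in coordinates. Its free indices are converted first; the double
  contraction with the inverse metric then becomes a frame sum by
  \<open>orthonormal_contract\<close> for lists of length two.\<close>

lemma R_instanton: assumes x: "x \<in> V" shows "(\<Sum>\<^sub>7a b. R x a b c d * ph f a b) = 0"
proof -
  let ?I = "inv_metric (g x)"
  let ?K = "curvature g \<Gamma> x"
  have Rf: "Rf x a b c d = (\<Sum>\<^sub>7i. E x c i * (\<Sum>\<^sub>7j. E x d j * ?K a b i j))" for a b
    unfolding Rf_def curvature_def lower[OF x] ..
  have "(\<Sum>\<^sub>7i. E x c i * (\<Sum>\<^sub>7j. E x d j * (\<Sum>\<^sub>7k. E x f k *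
      (\<Sum>\<^sub>7a b p q. ?I a p * ?I b q * ?K a b i j * \<phi> x [p, q, k])))) = 0"
    unfolding instanton[OF x] by simp
  then have "(\<Sum>\<^sub>7a b p q. \<Sum>\<^sub>7i. E x c i * (\<Sum>\<^sub>7j. E x d j * (\<Sum>\<^sub>7k. E x f k *
      (?I a p * ?I b q * ?K a b i j * \<phi> x [p, q, k])))) = 0"
    by (simp only: sum_out)
  moreover have "(\<Sum>\<^sub>7i. E x c i * (\<Sum>\<^sub>7j. E x d j * (\<Sum>\<^sub>7k. E x f k *
      (?I a p * ?I b q * ?K a b i j * \<phi> x [p, q, k])))) =
      ?I a p * ?I b q * Rf x a b c d * (\<Sum>\<^sub>7k. E x f k * \<phi> x [p, q, k])" for a b p q
    unfolding Rf by (simp add: sum_distrib_left sum_distrib_right mult_ac)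
  ultimately have "(\<Sum>\<^sub>7a b p q. ?I a p * ?I b q * Rf x a b c d * (\<Sum>\<^sub>7k. E x f k * \<phi> x [p, q, k])) = 0"
    by simp
  moreover have "{..<2::nat} = {0, 1}" by auto
  ultimately have "(\<Sum>I | length I = 2. \<Sum>K | length K = 2. (\<Prod>k<2. ?I (I ! k) (K ! k)) * Rf x (I ! 0) (I ! 1) c d *
      (\<Sum>\<^sub>7k. E x f k * \<phi> x [K ! 0, K ! 1, k])) = 0"
    unfolding sum_length_2 by simp
  then have "(\<Sum>L | length L = 2. frl (E x) (\<lambda>I. Rf x (I ! 0) (I ! 1) c d) L *
      frl (E x) (\<lambda>K. \<Sum>\<^sub>7k. E x f k * \<phi> x [K ! 0, K ! 1, k]) L) = 0"
    using orthonormal_contract[of ?I "E x" 2 "\<lambda>I. Rf x (I ! 0) (I ! 1) c d"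
      "\<lambda>K. \<Sum>\<^sub>7k. E x f k * \<phi> x [K ! 0, K ! 1, k]", OF inv_metric[OF x]] by simp
  moreover have "frl (E x) (\<lambda>I. Rf x (I ! 0) (I ! 1) c d) [a, b] = R x a b c d" for a b
    unfolding R_Rf by simp
  moreover have "frl (E x) (\<lambda>K. \<Sum>\<^sub>7k. E x f k * \<phi> x [K ! 0, K ! 1, k]) [a, b] = ph f a b" for a b
    using frl_phi[OF x, of a b f] ph_cyc[of a b f] by simp
  ultimately show ?thesis unfolding sum_length_2 by simp
qed

lemma point: assumes x: "x \<in> V" shows "skew_torsion_curvature (T x) (R x) (A x)"
  by unfold_locales
    (rule T_skew3[OF x] A_skew3[OF x] R_skew12 R_skew34[OF x] Bianchi_frame[OF x] R_instanton[OF x] R_g2[OF x])+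

lemma smooth_phc: "smooth_on V (\<lambda>x. phc (T x) a b)"
  unfolding phc_def by (intro smooth_on_sum smooth_on_mult V smooth_T smooth_on_const)

lemma phc_dT: assumes x: "x \<in> V"
  shows "phc (dT x i) a b = pd i (\<lambda>y. phc (T y) a b) x - act2 (W x i) (phc (T x)) a b"
proof -
  interpret w: g2_element "W x i" by (rule W_g2[OF x])
  have "pd i (\<lambda>y. \<Sum>\<^sub>7j k. T y a j k * ph b j k) x = (\<Sum>\<^sub>7j k. pd i (\<lambda>y. T y a j k) x * ph b j k)"
    using smooth_on_differentiable[OF smooth_T x]
    by (subst pd_sum, simp, intro differentiable_sum_fun differentiable_mult, simp_all)
      (subst pd_sum, simp, intro differentiable_mult, simp_all add: pd_mult)
  then show ?thesis
    unfolding w.phc_act3[symmetric] phc_def[of "T _"] phc_def[of "dT x i"] phc_def[of "act3 _ _"] dT_def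
      left_diff_distrib sum_subtractf by simp
qed

text \<open>By \<open>phcT_skew\<close> the Lee form is algebraic in the torsion, so the Hodge
  expression defining it need not be differentiated. The constant is the inverse of -2 times the 6
  of \<open>ph_norm\<close>.\<close>

lemma smooth_th: "smooth_on V (\<lambda>x. th x q)"
proof -
  have eq: "th x q = - 1/12 * (\<Sum>\<^sub>7i j. (phc (T x) i j - phc (T x) j i) * ph q i j)" if x: "x \<in> V" for x
  proof -
    have "(\<Sum>\<^sub>7i j. (\<Sum>\<^sub>7k. th x k * ph k i j) * ph q i j) = 6 * th x q"
      unfolding sum7_out ph_norm by (simp add: mult.left_commute[of _ 6] flip: sum_distrib_left)
    then show ?thesis
      unfolding phcT_skew[OF x] mult.assoc sum_distrib_left[symmetric] by simp
  qed
  have "smooth_on V (\<lambda>x. - 1/12 * (\<Sum>\<^sub>7i j. (phc (T x) i j - phc (T x) j i) * ph q i j))"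
    by (intro smooth_on_mult smooth_on_sum smooth_on_diff smooth_phc smooth_on_const V)
  then show ?thesis by (rule iffD2[OF smooth_on_cong[OF V eq], rotated])
qed

lemma pd_th: assumes x: "x \<in> V" shows "pd i (\<lambda>y. th y a) x = act1 (W x i) (th x) a"
proof -
  have s: "smooth_on V (\<lambda>y. lee y I)" if I: "length I = length [a]" for I
  proof (rule smooth_from_frame)
    fix J :: "7 list" assume "length J = length I"
    then obtain b where J: "J = [b]" using I by (auto simp: length_Suc_conv)
    show "smooth_on V (\<lambda>x. frl (E x) (lee x) J)" using smooth_th[of b] unfolding J th_def .
  qed
  have "cov_deriv W (\<lambda>y. frl (E y) (lee y)) x i [a] = frl (E x) (cov_deriv \<Gamma> lee x i) [a]"
    using cov_deriv_frame[OF x, of "[a]" lee i] s by blast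
  also have "\<dots> = 0" by (simp add: lee_parallel[OF x])
  finally show ?thesis unfolding cov_deriv_derl derl.simps th_def act1_def by simp
qed

text \<open>The skew part of \<open>phc T\<close> is built from the Lee form and
  \<open>\<phi>\<close>, which are both parallel; hence its covariant derivative vanishes.\<close>

lemma phc_dT_sym: assumes x: "x \<in> V" shows "phc (dT x i) b a = phc (dT x i) a b"
proof -
  interpret w: g2_element "W x i" by (rule W_g2[OF x])
  let ?N = "\<lambda>y i j. phc (T y) i j - phc (T y) j i"
  have d: "(\<lambda>y. th y k) differentiable (at x)" for k
    by (rule smooth_on_differentiable[OF smooth_th x])
  have "pd i (\<lambda>y. ?N y a b) x = pd i (\<lambda>y. - 2 * (\<Sum>\<^sub>7k. th y k * ph k a b)) x"
    by (rule pd_cong_open[OF V x]) (rule phcT_skew)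
  also have "\<dots> = - 2 * (\<Sum>\<^sub>7k. pd i (\<lambda>y. th y k) x * ph k a b)"
    by (subst pd_mult, simp, intro differentiable_sum_fun differentiable_mult d, simp)
      (subst pd_sum, simp, intro differentiable_mult d, simp_all add: pd_mult d)
  also have "\<dots> = - 2 * act2 (W x i) (\<lambda>a b. \<Sum>\<^sub>7k. th x k * ph k a b) a b"
    unfolding pd_th[OF x] w.vector_ph_act ..
  also have "\<dots> = act2 (W x i) (?N x) a b"
    unfolding phcT_skew[OF x] act2_def distrib_left by (simp add: sum_distrib_left mult.left_commute)
  also have "\<dots> = act2 (W x i) (phc (T x)) a b - act2 (W x i) (phc (T x)) b a"
    unfolding act2_def right_diff_distrib sum_subtractf by simp
  finally show ?thesis
    unfolding phc_dT[OF x] pd_diff[OF smooth_on_differentiable[OF smooth_phc x] smooth_on_differentiable[OF smooth_phc x]]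
    by simp
qed

section \<open>The symmetric part of the torsion matrix and its covariant derivatives\<close>

definition H :: "real^7 \<Rightarrow> 7 \<Rightarrow> 7 \<Rightarrow> real" where
  "H x = (\<lambda>a b. phc (T x) a b + phc (T x) b a)"

text \<open>The direction \<open>i\<close> refers to the coordinates here and in \<open>dB\<close>;
  \<open>B\<close> and \<open>C\<close> convert it to the frame.\<close>

definition dH :: "real^7 \<Rightarrow> 7 \<Rightarrow> 7 \<Rightarrow> 7 \<Rightarrow> real" where
  "dH x i a b = pd i (\<lambda>y. H y a b) x - act2 (W x i) (H x) a b"

definition B :: "real^7 \<Rightarrow> 7 \<Rightarrow> 7 \<Rightarrow> 7 \<Rightarrow> real" where
  "B x a b c = (\<Sum>\<^sub>7i. E x a i * dH x i b c)"

definition dB :: "real^7 \<Rightarrow> 7 \<Rightarrow> 7 \<Rightarrow> 7 \<Rightarrow> 7 \<Rightarrow> real" where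
  "dB x i a b c = pd i (\<lambda>y. B y a b c) x - act3 (W x i) (B x) a b c"

definition C :: "real^7 \<Rightarrow> 7 \<Rightarrow> 7 \<Rightarrow> 7 \<Rightarrow> 7 \<Rightarrow> real" where
  "C x d a b c = (\<Sum>\<^sub>7i. E x d i * dB x i a b c)"

lemma smooth_H: "smooth_on V (\<lambda>x. H x a b)"
  unfolding H_def by (intro smooth_on_add smooth_phc V)

lemma smooth_B: "smooth_on V (\<lambda>x. B x a b c)"
  unfolding B_def dH_def act2_def
  by (intro smooth_on_sum smooth_on_mult smooth_on_diff smooth_on_add smooth_on_pd V E_smooth W_smooth smooth_H)

lemma dH_eq: assumes x: "x \<in> V" shows "dH x i a b = 2 * phc (dT x i) a b"
proof -
  have "dH x i a b = phc (dT x i) a b + phc (dT x i) b a"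
    unfolding dH_def H_def phc_dT[OF x] act2_def
      pd_add[OF smooth_on_differentiable[OF smooth_phc x] smooth_on_differentiable[OF smooth_phc x]]
    by (simp add: distrib_left sum.distrib)
  then show ?thesis using phc_dT_sym[OF x, of i b a] by simp
qed

lemma B_eq: assumes x: "x \<in> V" shows "B x a b c = 2 * phc (A x a) b c"
proof -
  have "phc (A x a) b c = (\<Sum>\<^sub>7i. E x a i * phc (dT x i) b c)"
    unfolding A_def[abs_def] by (rule phc_comb)
  then show ?thesis unfolding B_def dH_eq[OF x] by (simp add: sum_distrib_left mult.left_commute)
qed

lemma B_facts: assumes x: "x \<in> V"
  shows "B x b a c = B x a b c" "B x a c b = B x a b c" "(\<Sum>\<^sub>7j. B x a j j) = 0"
proof -
  interpret skew_torsion_curvature "T x" "R x" "A x" by (rule point[OF x])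
  have sym: "phc (A x a) c b = phc (A x a) b c" for a b c
    unfolding A_def[abs_def] phc_comb using phc_dT_sym[OF x, of _ c b] by simp
  note s = symmetric_derivative[of "A x", OF A sym A_contr]
  show "B x b a c = B x a b c" "B x a c b = B x a b c" "(\<Sum>\<^sub>7j. B x a j j) = 0"
    unfolding B_eq[OF x] using s(1)[of b a c] s(2)[of a] sym[of a c b] by (simp_all flip: sum_distrib_left)
qed

text \<open>The identities of \<open>B_facts\<close> hold throughout \<open>V\<close> and may be
  differentiated. The action of \<open>W x i\<close> respects symmetry and trace, so they pass to
  \<open>dB\<close>.\<close>

lemma C_facts: assumes x: "x \<in> V"
  shows "C x d b a c = C x d a b c" "C x d a c b = C x d a b c" "(\<Sum>\<^sub>7j. C x d a j j) = 0"
proof -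
  have d: "(\<lambda>y. B y a b c) differentiable (at x)" for a b c
    by (rule smooth_on_differentiable[OF smooth_B x])
  have p: "pd i (\<lambda>y. B y b a c) x = pd i (\<lambda>y. B y a b c) x" "pd i (\<lambda>y. B y a c b) x = pd i (\<lambda>y. B y a b c) x" for i a b c
    by (rule pd_cong_open[OF V x], rule B_facts, assumption)+
  have "pd i (\<lambda>y. \<Sum>\<^sub>7j. B y a j j) x = pd i (\<lambda>y. 0) x" for i a
    by (rule pd_cong_open[OF V x], rule B_facts)
  then have t: "(\<Sum>\<^sub>7j. pd i (\<lambda>y. B y a j j) x) = 0" for i a
    using pd_sum[of UNIV "\<lambda>j y. B y a j j" x i] d[of a] by simp
  have "dB x i b a c = dB x i a b c" "dB x i a c b = dB x i a b c" "(\<Sum>\<^sub>7j. dB x i a j j) = 0" for i a b c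
  proof -
    interpret w: g2_element "W x i" by (rule W_g2[OF x])
    have a: "(\<Sum>\<^sub>7m. W x i u m * B x v m w) = (\<Sum>\<^sub>7m. W x i u m * B x m v w)"
       "(\<Sum>\<^sub>7m. W x i u m * B x v w m) = (\<Sum>\<^sub>7m. W x i u m * B x m v w)"
       "(\<Sum>\<^sub>7m. W x i u m * B x m w v) = (\<Sum>\<^sub>7m. W x i u m * B x m v w)" for u v w
    proof -
      have "B x v m w = B x m v w" for m by (rule B_facts[OF x])
      moreover have "B x v w m = B x m v w" for m
        using B_facts(2)[OF x, of v w m] B_facts(1)[OF x, of v m w] by simp
      moreover have "B x m w v = B x m v w" for m by (rule B_facts[OF x])
      ultimately show "(\<Sum>\<^sub>7m. W x i u m * B x v m w) = (\<Sum>\<^sub>7m. W x i u m * B x m v w)"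
       "(\<Sum>\<^sub>7m. W x i u m * B x v w m) = (\<Sum>\<^sub>7m. W x i u m * B x m v w)"
       "(\<Sum>\<^sub>7m. W x i u m * B x m w v) = (\<Sum>\<^sub>7m. W x i u m * B x m v w)"
        by (simp_all only:)
    qed
    show "dB x i b a c = dB x i a b c"
      unfolding dB_def act3_def p(1)[of i b a c] a(1) a(2) using a(3)[of c b a] by simp
    show "dB x i a c b = dB x i a b c"
      unfolding dB_def act3_def p(2)[of i a c b] a(1) a(2) using a(3)[of a b c] by simp
    show "(\<Sum>\<^sub>7j. dB x i a j j) = 0"
      unfolding dB_def sum_subtractf t w.trace_act3 B_facts(3)[OF x] by (simp add: act1_def)
  qed
  note dB = this
  show "C x d b a c = C x d a b c" unfolding C_def dB(1)[of _ b a c] ..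
  show "C x d a c b = C x d a b c" unfolding C_def dB(2)[of _ a c b] ..
  have "(\<Sum>\<^sub>7j. C x d a j j) = (\<Sum>\<^sub>7i. E x d i * (\<Sum>\<^sub>7j. dB x i a j j))"
    unfolding C_def sum_out ..
  then show "(\<Sum>\<^sub>7j. C x d a j j) = 0" unfolding dB(3) by simp
qed

end

lemma derl_comb: "derl (\<lambda>k l. \<Sum>\<^sub>7i. c i * m i k l) S J = (\<Sum>\<^sub>7i. c i * derl (m i) S J)"
proof (induction J arbitrary: S)
  case (Cons k J)
  have "(\<Sum>\<^sub>7l. (\<Sum>\<^sub>7i. c i * m i k l) * S (l # J)) = (\<Sum>\<^sub>7i. c i * (\<Sum>\<^sub>7l. m i k l * S (l # J)))"
    by (rule sum7_assoc[symmetric])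
  then show ?case unfolding derl.simps Cons.IH distrib_left sum.distrib by simp
qed simp

context adapted_frame
begin

text \<open>The Ricci identity in frame components, where \<open>D\<close> is \<open>\<nabla>S\<close> with the direction of differentiation
  first.\<close>

lemma frame_commutator:
  assumes x: "x \<in> V" and S: "\<And>I. smooth_on V (\<lambda>y. S y I)"
    and D: "\<And>y a J. y \<in> V \<Longrightarrow> D y (a # J) = (\<Sum>\<^sub>7i. E y a i * cov_deriv W (\<lambda>y. frl (E y) (S y)) y i J)"
  shows "(\<Sum>\<^sub>7i. E x d i * cov_deriv W D x i (a # J)) - (\<Sum>\<^sub>7i. E x a i * cov_deriv W D x i (d # J)) =
    - derl (R x d a) (frl (E x) (S x)) J - (\<Sum>\<^sub>7n. T x d a n * D x (n # J))"
proof -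
  \<comment> \<open>Here the direction of differentiation is a genuine slot, so differentiating
    \<open>N\<close> yields Christoffel terms for it as well; their skew part is the torsion
    term.\<close>
  define N where "N y I = cov_deriv \<Gamma> S y (hd I) (tl I)" for y I
  define Y where "Y i j I = cov_deriv \<Gamma> N x i (j # I)" for i j I
  have N: "smooth_on V (\<lambda>y. N y I)" for I
    unfolding N_def by (rule smooth_cov_deriv[OF V \<Gamma>_smooth S])
  have DN: "D y (b # K) = frl (E y) (N y) (b # K)" if y: "y \<in> V" for y b K
    unfolding D[OF y] using cov_deriv_frame[where S = S and J = K, OF y S] by (simp add: N_def)
  have "cov_deriv W D x i (b # J) = (\<Sum>\<^sub>7j. E x b j * frl (E x) (Y i j) J)" for b i
  proof -
    have "cov_deriv W D x i (b # J) = cov_deriv W (\<lambda>y. frl (E y) (N y)) x i (b # J)"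
      by (rule cov_deriv_cong[OF V x]) (auto simp: length_Suc_conv DN simp del: frl.simps)
    also have "\<dots> = frl (E x) (cov_deriv \<Gamma> N x i) (b # J)"
      by (rule cov_deriv_frame[OF x N])
    finally show ?thesis by (simp add: Y_def[abs_def])
  qed
  then have "(\<Sum>\<^sub>7i. E x d i * cov_deriv W D x i (a # J)) - (\<Sum>\<^sub>7i. E x a i * cov_deriv W D x i (d # J)) =
    (\<Sum>\<^sub>7i. E x d i * (\<Sum>\<^sub>7j. E x a j * frl (E x) (Y i j) J)) - (\<Sum>\<^sub>7i. E x a i * (\<Sum>\<^sub>7j. E x d j * frl (E x) (Y i j) J))"
    by simp
  also have "\<dots> = (\<Sum>\<^sub>7i. E x d i * (\<Sum>\<^sub>7j. E x a j * frl (E x) (Y i j) J)) - (\<Sum>\<^sub>7i. E x d i * (\<Sum>\<^sub>7j. E x a j * frl (E x) (Y j i) J))"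
    by (rule arg_cong[OF sum_swap2])
  also have "\<dots> = (\<Sum>\<^sub>7i. E x d i * (\<Sum>\<^sub>7j. E x a j * frl (E x) (\<lambda>I. Y i j I - Y j i I) J))"
    unfolding frl_diff right_diff_distrib sum_subtractf ..
  also have "\<dots> = (\<Sum>\<^sub>7i. E x d i * (\<Sum>\<^sub>7j. E x a j * frl (E x) (\<lambda>I. - 1 * derl (curvature_op \<Gamma> x i j) (S x) I
      - tor_contr (tor \<Gamma> x) (N x) (i # j # I)) J))"
  proof -
    have "Y i j I - Y j i I = - 1 * derl (curvature_op \<Gamma> x i j) (S x) I - tor_contr (tor \<Gamma> x) (N x) (i # j # I)" for i j I
      using Ricci_identity[where \<Gamma> = \<Gamma> and I = I and S = S and i = i and j = j, OF V x \<Gamma>_smooth S]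
      unfolding Y_def cov_deriv_Cons tor_contr_def tor_def N_def
      by (simp add: left_diff_distrib sum_subtractf)
    then show ?thesis by simp
  qed
  also have "\<dots> = - (\<Sum>\<^sub>7i. E x d i * (\<Sum>\<^sub>7j. E x a j * derl (Rf x i j) (frl (E x) (S x)) J))
      - frl (E x) (tor_contr (tor \<Gamma> x) (N x)) (d # a # J)"
    unfolding frl_diff frl_cmult right_diff_distrib sum_subtractf Rf_derl[OF x] frl.simps
    by (simp add: sum_negf)
  also have "(\<Sum>\<^sub>7i. E x d i * (\<Sum>\<^sub>7j. E x a j * derl (Rf x i j) (frl (E x) (S x)) J)) = derl (R x d a) (frl (E x) (S x)) J"
    unfolding R_Rf[abs_def] derl_comb ..
  finally show ?thesis unfolding frl_tor_contr[OF x] DN[OF x] .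
qed

end

context adapted_instanton
begin

lemma C_commute: assumes x: "x \<in> V"
  shows "C x i j k l - C x j i k l = - (\<Sum>\<^sub>7m. R x i j k m * H x m l) - (\<Sum>\<^sub>7m. R x i j l m * H x k m)
    - (\<Sum>\<^sub>7m. T x i j m * B x m k l)"
proof -
  \<comment> \<open>A field in coordinates whose frame components are \<open>H\<close>, so that
    \<open>frame_commutator\<close> applies.\<close>
  define S where "S y = frl (\<lambda>i a. e a y [i]) (\<lambda>J. H y (J ! 0) (J ! 1))" for y
  define D where "D y I = B y (I ! 0) (I ! 1) (I ! 2)" for y I
  \<comment> \<open>\<open>frame_commutator\<close> asks for its \<open>D\<close> on nonempty lists
    of every length; on those of length three \<open>D'\<close> has the components
    \<open>B\<close>.\<close>
  define D' where "D' y I = (\<Sum>\<^sub>7i. E y (hd I) i * cov_deriv W (\<lambda>y. frl (E y) (S y)) y i (tl I))" for y I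
  have ES: "frl (E y) (S y) J = H y (J ! 0) (J ! 1)" if "y \<in> V" for y J
    unfolding S_def by (rule frl_coframe[OF that])
  have S: "smooth_on V (\<lambda>y. S y I)" for I
    unfolding S_def by (rule smooth_frl[OF V e_smooth smooth_H])
  have D': "D' y [a, b, c] = B y a b c" if y: "y \<in> V" for y a b c
  proof -
    have "cov_deriv W (\<lambda>y. frl (E y) (S y)) y i [b, c] = dH y i b c" for i
    proof -
      have "cov_deriv W (\<lambda>y. frl (E y) (S y)) y i [b, c] = cov_deriv W (\<lambda>y J. H y (J ! 0) (J ! 1)) y i [b, c]"
        by (rule cov_deriv_cong[OF V y ES])
      then show ?thesis unfolding cov_deriv_derl dH_def act2_def by simp
    qed
    then show ?thesis unfolding D'_def B_def by simp
  qed
  have dB: "cov_deriv W D' x i [a, b, c] = dB x i a b c" for i a b c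
  proof -
    have "cov_deriv W D' x i [a, b, c] = cov_deriv W D x i [a, b, c]"
      by (rule cov_deriv_cong[OF V x]) (auto simp: D_def D' length_Suc_conv)
    then show ?thesis unfolding cov_deriv_derl dB_def act3_def D_def by simp
  qed
  have "derl (R x i j) (frl (E x) (S x)) [k, l] = (\<Sum>\<^sub>7m. R x i j k m * H x m l) + (\<Sum>\<^sub>7m. R x i j l m * H x k m)"
    by (simp add: ES[OF x] del: frl.simps)
  then show ?thesis
    using frame_commutator[where S = S and D = D' and d = i and a = j and J = "[k, l]", OF x S] unfolding dB D'[OF x] C_def[symmetric] by (simp add: D'_def)
qed

lemma pd_H: assumes x: "x \<in> V" shows "pd i (\<lambda>y. H y a b) x = dH x i a b + act2 (W x i) (H x) a b"
  unfolding dH_def by simp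

lemma pd_B: assumes x: "x \<in> V" shows "pd i (\<lambda>y. B y a b c) x = dB x i a b c + act3 (W x i) (B x) a b c"
  unfolding dB_def by simp

lemma H_B_eq: assumes x: "x \<in> V" shows "(\<Sum>\<^sub>7m k. H x m k * B x m k l) = 0"
proof -
  interpret skew_torsion_curvature "T x" "R x" "A x" by (rule point[OF x])
  show ?thesis
    by (rule H_B[of "H x" "B x" "C x"]) (rule H_def B_facts[OF x] C_facts[OF x] C_commute[OF x])+
qed

text \<open>\<open>H_B_eq\<close> differentiated. By \<open>contr_act\<close> the terms with
  \<open>W\<close> assemble to the action on the differentiated expression, which is itself
  zero.\<close>

lemma dH_B: assumes x: "x \<in> V" shows "(\<Sum>\<^sub>7m k. dH x i m k * B x m k l + H x m k * dB x i m k l) = 0"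
proof -
  interpret w: g2_element "W x i" by (rule W_g2[OF x])
  have d: "(\<lambda>y. H y a b) differentiable (at x)" "(\<lambda>y. B y a b c) differentiable (at x)" for a b c
    by (rule smooth_on_differentiable[OF smooth_H x] smooth_on_differentiable[OF smooth_B x])+
  have "pd i (\<lambda>y. \<Sum>\<^sub>7m k. H y m k * B y m k l) x = pd i (\<lambda>y. 0) x"
    by (rule pd_cong_open[OF V x]) (rule H_B_eq)
  moreover have "pd i (\<lambda>y. \<Sum>\<^sub>7m k. H y m k * B y m k l) x =
      (\<Sum>\<^sub>7m k. pd i (\<lambda>y. H y m k) x * B x m k l + H x m k * pd i (\<lambda>y. B y m k l) x)"
    using d by (simp add: pd_sum pd_mult differentiable_mult differentiable_sum_fun)
  ultimately have "(\<Sum>\<^sub>7m k. (dH x i m k * B x m k l + H x m k * dB x i m k l)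
      + (act2 (W x i) (H x) m k * B x m k l + H x m k * act3 (W x i) (B x) m k l)) = 0"
    unfolding pd_H[OF x] pd_B[OF x] by (simp add: algebra_simps)
  moreover have "(\<Sum>\<^sub>7m k. act2 (W x i) (H x) m k * B x m k l + H x m k * act3 (W x i) (B x) m k l) = 0"
    unfolding w.contr_act H_B_eq[OF x] act1_def by simp
  ultimately show ?thesis by (simp add: sum.distrib)
qed

text \<open>Contracting the direction in \<open>dH_B\<close> with the free index \<open>l\<close>
  gives the divergence that \<open>B_eq_0\<close> needs. From \<open>B = 0\<close> the 3-form
  follows by injectivity of \<open>phc\<close>.\<close>

lemma A_eq_0: assumes x: "x \<in> V" shows "A x a b c d = 0"
proof -
  interpret skew_torsion_curvature "T x" "R x" "A x" by (rule point[OF x])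
  have "(\<Sum>\<^sub>7m k. B x l m k * B x m k l + H x m k * C x l m k l) =
      (\<Sum>\<^sub>7i. E x l i * (\<Sum>\<^sub>7m k. dH x i m k * B x m k l + H x m k * dB x i m k l))" for l
  proof -
    have "B x l m k * B x m k l + H x m k * C x l m k l = (\<Sum>\<^sub>7i. E x l i * (dH x i m k * B x m k l + H x m k * dB x i m k l))" for m k
      unfolding B_def[of x l m k] C_def sum_distrib_left sum_distrib_right distrib_left sum.distrib by (simp only: mult_ac)
    moreover have "(\<Sum>\<^sub>7m k. \<Sum>\<^sub>7i. E x l i * F i m k) = (\<Sum>\<^sub>7i. E x l i * (\<Sum>\<^sub>7m k. F i m k))" for F :: "7 \<Rightarrow> 7 \<Rightarrow> 7 \<Rightarrow> real"
      unfolding sum_distrib_left by (rule sum7_swap3[symmetric])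
    ultimately show ?thesis by simp
  qed
  then have D: "(\<Sum>\<^sub>7l m k. B x l m k * B x m k l + H x m k * C x l m k l) = 0"
    unfolding dH_B[OF x] by simp
  have "B x a b c = 0" for a b c
    by (rule B_eq_0[of "H x" "B x" "C x", OF _ _ _ _ _ _ _ _ phcT_skew[OF x] D])
      (rule H_def B_facts[OF x] C_facts[OF x] C_commute[OF x])+
  then have "phc (A x a) b c = 0" for b c using B_eq[OF x, of a b c] by simp
  then show ?thesis by (rule phc_eq_0[OF A_skew3[OF x]])
qed

end

section \<open>Consequences of parallel torsion\<close>

lemma sum_length_4: "(\<Sum>L | length L = 4. f L) = (\<Sum>\<^sub>7a b c d. f [a, b, c, d])"
proof -
  have "4 = Suc (Suc (Suc (Suc 0)))" by simp
  then show ?thesis by (simp only: sum_length_Suc sum_length_0)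
qed

lemma ps_trace_swap:
  "(\<Sum>\<^sub>7i j k l. Y j i k l * ps i j k l) = - (\<Sum>\<^sub>7i j k l. Y i j k l * ps i j k l)"
  "(\<Sum>\<^sub>7i j k l. Y i k j l * ps i j k l) = - (\<Sum>\<^sub>7i j k l. Y i j k l * ps i j k l)"
  "(\<Sum>\<^sub>7i j k l. Y i j l k * ps i j k l) = - (\<Sum>\<^sub>7i j k l. Y i j k l * ps i j k l)"
proof -
  have "(\<Sum>\<^sub>7i j k l. Y j i k l * ps i j k l) = (\<Sum>\<^sub>7i j k l. Y i j k l * ps j i k l)" by (rule sum.swap)
  also have "\<dots> = (\<Sum>\<^sub>7i j k l. - (Y i j k l * ps i j k l))"
    by (intro sum.cong refl) (metis ps_skew12 mult_minus_right)
  finally show "(\<Sum>\<^sub>7i j k l. Y j i k l * ps i j k l) = - (\<Sum>\<^sub>7i j k l. Y i j k l * ps i j k l)"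
    by (simp add: sum_negf)
  have "(\<Sum>\<^sub>7i j k l. Y i k j l * ps i j k l) = (\<Sum>\<^sub>7i j k l. Y i j k l * ps i k j l)"
    by (rule sum.cong, rule refl, rule sum.swap)
  also have "\<dots> = (\<Sum>\<^sub>7i j k l. - (Y i j k l * ps i j k l))"
    by (intro sum.cong refl) (metis ps_skew23 mult_minus_right)
  finally show "(\<Sum>\<^sub>7i j k l. Y i k j l * ps i j k l) = - (\<Sum>\<^sub>7i j k l. Y i j k l * ps i j k l)"
    by (simp add: sum_negf)
  have "(\<Sum>\<^sub>7i j k l. Y i j l k * ps i j k l) = (\<Sum>\<^sub>7i j k l. Y i j k l * ps i j l k)"
    by (rule sum.cong, rule refl, rule sum.cong, rule refl, rule sum.swap)
  also have "\<dots> = (\<Sum>\<^sub>7i j k l. - (Y i j k l * ps i j k l))"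
    by (intro sum.cong refl) (metis ps_skew34 mult_minus_right)
  finally show "(\<Sum>\<^sub>7i j k l. Y i j l k * ps i j k l) = - (\<Sum>\<^sub>7i j k l. Y i j k l * ps i j k l)"
    by (simp add: sum_negf)
qed

text \<open>Against the skew \<open>ps\<close> the six terms contribute equally, each 4 times the
  trace. The product 24 cancels the \<open>fact 4\<close> in \<open>form_inner\<close>.\<close>

lemma skew3_trace_ps:
  assumes T: "skew3 T"
  defines "X \<equiv> \<lambda>i j k l. \<Sum>\<^sub>7n. T i j n * ph n k l"
  shows "(\<Sum>\<^sub>7i j k l. (X i j k l - X i k j l + X i l j k + X j k i l - X j l i k + X k l i j) * ps i j k l)
    = 24 * (\<Sum>\<^sub>7n. phc T n n)"
proof -
  let ?S = "\<lambda>Y. \<Sum>\<^sub>7i j k l. Y i j k l * ps i j k l"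
  note s = ps_trace_swap
  have 2: "?S (\<lambda>i j k l. X i k j l) = - ?S X" by (rule s(2))
  have 3: "?S (\<lambda>i j k l. X i l j k) = ?S X" using s(3)[of "\<lambda>i j k l. X i k j l"] 2 by simp
  have 4: "?S (\<lambda>i j k l. X j k i l) = ?S X" using s(1)[of "\<lambda>i j k l. X i k j l"] 2 by simp
  have 5: "?S (\<lambda>i j k l. X j l i k) = - ?S X" using s(3)[of "\<lambda>i j k l. X j k i l"] 4 by simp
  have 6: "?S (\<lambda>i j k l. X k l i j) = ?S X" using s(2)[of "\<lambda>i j k l. X j l i k"] 5 by simp
  have "?S X = (\<Sum>\<^sub>7i j. \<Sum>\<^sub>7n. T i j n * (\<Sum>\<^sub>7k l. ph n k l * ps i j k l))"
    unfolding X_def by (simp only: sum7_out)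
  also have "\<dots> = 4 * (\<Sum>\<^sub>7i j n. T i j n * ph n i j)"
    unfolding ph_ps' by (simp add: sum_distrib_left mult.left_commute)
  also have "(\<Sum>\<^sub>7i j n. T i j n * ph n i j) = (\<Sum>\<^sub>7n i j. T i j n * ph n i j)"
    by (rule sum7_swap3[symmetric])
  also have "\<dots> = (\<Sum>\<^sub>7n. phc T n n)"
  proof -
    have "T i j n = T n i j" for i j n by (rule skew3_cyc[OF T])
    then show ?thesis unfolding phc_def by simp
  qed
  finally show ?thesis
    unfolding left_diff_distrib distrib_right sum.distrib sum_subtractf 2 3 4 5 6 by simp
qed

context adapted_frame
begin

lemma form_inner_ext_d_phi: assumes x: "x \<in> V"
  shows "form_inner (g x) 4 (ext_d \<phi> x) (star x) = (\<Sum>\<^sub>7n. phc (T x) n n)"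
proof -
  have f: "frl (E x) (ext_d \<phi> x) [i, j, k, l] * frl (E x) (star x) [i, j, k, l] =
    ((\<Sum>\<^sub>7n. T x i j n * ph n k l) - (\<Sum>\<^sub>7n. T x i k n * ph n j l) + (\<Sum>\<^sub>7n. T x i l n * ph n j k)
     + (\<Sum>\<^sub>7n. T x j k n * ph n i l) - (\<Sum>\<^sub>7n. T x j l n * ph n i k) + (\<Sum>\<^sub>7n. T x k l n * ph n i j)) * ps i j k l" for i j k l
    using frl_ext_d_3[where S = \<phi> and i = i and j = j and k = k and l = l, OF x alternating_phi[OF x] phi_parallel[OF x]]
    unfolding frl_star[OF x] frl_phi[OF x] by simp
  show ?thesis
    unfolding form_inner_frl[of "g x" "E x", OF inv_metric[OF x]] sum_length_4 f skew3_trace_ps[OF T_skew3[OF x]]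
    by (simp add: eval_nat_numeral)
qed

lemma frl_ricci: assumes x: "x \<in> V"
  shows "frl (E x) (ricci g \<Gamma> x) [b, c] = (\<Sum>\<^sub>7a. R x a b c a)"
proof -
  define K where "K p i j a = (\<Sum>\<^sub>7l. curvature_op \<Gamma> x p i j l * e a x [l])" for p i j a
  have r: "ricci g \<Gamma> x [i, j] = (\<Sum>\<^sub>7a p. E x a p * K p i j a)" for i j
  proof -
    have "ricci g \<Gamma> x [i, j] = (\<Sum>\<^sub>7p q a. E x a p * (E x a q * curvature g \<Gamma> x p i j q))"
      unfolding ricci_def inv_metric[OF x] by (simp add: sum_distrib_right mult.assoc)
    also have "\<dots> = (\<Sum>\<^sub>7a p q. E x a p * (E x a q * curvature g \<Gamma> x p i j q))"
      by (rule sum7_swap3[symmetric])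
    also have "\<dots> = (\<Sum>\<^sub>7a p. E x a p * K p i j a)"
      unfolding sum_distrib_left[symmetric] curvature_def lower[OF x] K_def ..
    finally show ?thesis .
  qed
  have "frl (E x) (ricci g \<Gamma> x) [b, c] = (\<Sum>\<^sub>7i j a p. E x a p * (E x b i * (E x c j * K p i j a)))"
    unfolding frl.simps r sum_distrib_left by (simp only: mult_ac)
  also have "\<dots> = (\<Sum>\<^sub>7a p i j. E x a p * (E x b i * (E x c j * K p i j a)))"
    by (rule sum7_swap4)
  finally show ?thesis unfolding R_def frame4_def K_def[symmetric] sum_distrib_left[symmetric] .
qed

end


context adapted_instanton
begin

lemma dT_eq_0: assumes x: "x \<in> V" shows "dT x i b c d = 0"
proof -
  have "dT x i b c d = (\<Sum>\<^sub>7j. (\<Sum>\<^sub>7a. e a x [i] * E x a j) * dT x j b c d)"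
    unfolding E_e[OF x] by simp
  also have "\<dots> = (\<Sum>\<^sub>7a. e a x [i] * A x a b c d)"
    unfolding A_def by (rule sum7_assoc[symmetric])
  finally show ?thesis by (simp add: A_eq_0[OF x])
qed

lemma torsion_parallel: assumes x: "x \<in> V" and I: "length I = 3" shows "cov_deriv \<Gamma> tors x i I = 0"
proof (rule frl_eq_0_imp[OF x])
  fix J :: "7 list" assume "length J = length I"
  then obtain a b c where J: "J = [a, b, c]" using I by (auto simp: length_Suc_conv numeral_3_eq_3)
  show "frl (E x) (cov_deriv \<Gamma> tors x i) J = 0"
    unfolding J dT_frl[OF x, symmetric] by (rule dT_eq_0[OF x])
qed

lemma pd_T: assumes x: "x \<in> V" shows "pd i (\<lambda>y. T y a b c) x = act3 (W x i) (T x) a b c"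
  using dT_eq_0[OF x, of i a b c] unfolding dT_def by simp

lemma pd_trace: assumes x: "x \<in> V" shows "pd i (\<lambda>y. \<Sum>\<^sub>7n. phc (T y) n n) x = 0"
proof -
  interpret w: g2_element "W x i" by (rule W_g2[OF x])
  have "pd i (\<lambda>y. phc (T y) a b) x = act2 (W x i) (phc (T x)) a b" for a b
    using phc_dT[OF x, of i a b] dT_eq_0[OF x] by (simp add: phc_def)
  then show ?thesis
    using smooth_on_differentiable[OF smooth_phc x] by (simp add: pd_sum w.trace_act2)
qed

lemma smooth_sigma4: "smooth_on V (\<lambda>x. sigma4 (T x) a b c d)"
  unfolding sigma4_def by (intro smooth_on_add smooth_on_sum smooth_on_mult V smooth_T)

lemma pd_sigma4: assumes x: "x \<in> V"
  shows "pd i (\<lambda>y. sigma4 (T y) a b c d) x = act4 (W x i) (sigma4 (T x)) a b c d"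
proof -
  interpret w: g2_element "W x i" by (rule W_g2[OF x])
  have d: "(\<lambda>y. T y a b c) differentiable (at x)" for a b c
    by (rule smooth_on_differentiable[OF smooth_T x])
  have "pd i (\<lambda>y. \<Sum>\<^sub>7m. T y a b m * T y m c d) x =
      (\<Sum>\<^sub>7m. act3 (W x i) (T x) a b m * T x m c d + T x a b m * act3 (W x i) (T x) m c d)" for a b c d
    using d by (simp add: pd_sum pd_mult differentiable_mult pd_T[OF x])
  then show ?thesis
    unfolding w.sigma4_act unfolding sigma4_def
    using d by (simp add: pd_add differentiable_mult differentiable_sum_fun differentiable_add)
qed

text \<open>For parallel torsion the derivative is quadratic in \<open>T\<close>. Its six terms
  coincide in pairs, because \<open>P\<close> is symmetric under exchange of its index
  pairs.\<close>

lemma frl_dtors: assumes x: "x \<in> V" shows "frl (E x) (ext_d tors x) [i, j, k, l] = 2 * sigma4 (T x) i j k l"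
proof -
  define P where "P i j k l = (\<Sum>\<^sub>7n. T x i j n * T x n k l)" for i j k l
  have P12: "P j i k l = - P i j k l" for i j k l
    unfolding P_def by (subst skew3_12[OF T_skew3[OF x]]) (simp add: sum_negf)
  have Pp: "P k l i j = P i j k l" for i j k l
  proof -
    have "T x k l a * T x a i j = T x i j a * T x a k l" for a
      using skew3_cyc[OF T_skew3[OF x], of k l a] skew3_cyc[OF T_skew3[OF x], of i j a] by simp
    then show ?thesis unfolding P_def by simp
  qed
  have "frl (E x) (ext_d tors x) [i, j, k, l] = P i j k l - P i k j l + P i l j k + P j k i l - P j l i k + P k l i j"
    unfolding P_def T_def by (rule frl_ext_d_3[OF x torsion_alternating[OF x] torsion_parallel[OF x], unfolded T_def])
  moreover have "sigma4 (T x) i j k l = P i j k l + P j k i l + P k i j l"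
    unfolding sigma4_def P_def ..
  ultimately show ?thesis
    using P12[of k i j l] Pp[of i k j l] Pp[of i j k l] Pp[of j k i l] by simp
qed

lemma smooth_dtors: "smooth_on V (\<lambda>x. ext_d tors x I)"
  unfolding ext_d_def by (intro smooth_on_sum smooth_on_mult smooth_on_const smooth_on_pd smooth_tors V)

lemma dtors_parallel: assumes x: "x \<in> V" and I: "length I = 4" shows "cov_deriv \<Gamma> (ext_d tors) x i I = 0"
proof (rule frl_eq_0_imp[OF x])
  fix J :: "7 list" assume "length J = length I"
  then obtain a b c d where J: "J = [a, b, c, d]" using I by (auto simp: length_Suc_conv eval_nat_numeral)
  have "frl (E x) (cov_deriv \<Gamma> (ext_d tors) x i) J = cov_deriv W (\<lambda>y. frl (E y) (ext_d tors y)) x i J"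
    by (rule cov_deriv_frame[OF x smooth_dtors, symmetric])
  also have "\<dots> = cov_deriv W (\<lambda>y J. 2 * sigma4 (T y) (J ! 0) (J ! 1) (J ! 2) (J ! 3)) x i J"
    unfolding J by (rule cov_deriv_cong[OF V x]) (auto simp: length_Suc_conv frl_dtors simp del: frl.simps)
  also have "\<dots> = 0"
    unfolding cov_deriv_derl derl_cmult using pd_sigma4[OF x, of i a b c d] smooth_on_differentiable[OF smooth_sigma4 x]
    by (simp add: J pd_mult act4_def)
  finally show "frl (E x) (cov_deriv \<Gamma> (ext_d tors) x i) J = 0" .
qed

definition ric :: "real^7 \<Rightarrow> 7 \<Rightarrow> 7 \<Rightarrow> real" where
  "ric x p l = tr3 (\<lambda>i j k. ps i j k p) (\<lambda>i j k. sigma4 (T x) i j k l)"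

lemma frl_ricci_ric: assumes x: "x \<in> V"
  shows "frl (E x) (ricci g \<Gamma> x) [p, l] = 1/6 * ric x p l" "ric x l p = ric x p l"
proof -
  interpret skew_torsion_curvature "T x" "R x" "A x" by (rule point[OF x])
  have r: "6 * (\<Sum>\<^sub>7a. R x a p l a) = ric x p l" for p l
    unfolding ric_def by (rule ricci_sigma4(1)[OF A_eq_0[OF x]])
  show "frl (E x) (ricci g \<Gamma> x) [p, l] = 1/6 * ric x p l"
    unfolding frl_ricci[OF x] r[symmetric] by simp
  show "ric x l p = ric x p l"
    unfolding r[symmetric] ricci_sigma4(2)[OF A_eq_0[OF x], of l p] ..
qed

lemma smooth_ric: "smooth_on V (\<lambda>x. ric x p l)"
  unfolding ric_def tr3_def by (intro smooth_on_sum smooth_on_mult smooth_on_const smooth_sigma4 V)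

lemma smooth_ricci: assumes "length I = 2" shows "smooth_on V (\<lambda>x. ricci g \<Gamma> x I)"
proof (rule smooth_from_frame)
  fix J :: "7 list" assume "length J = length I"
  then obtain a b where J: "J = [a, b]" using assms by (auto simp: length_Suc_conv eval_nat_numeral)
  show "smooth_on V (\<lambda>x. frl (E x) (ricci g \<Gamma> x) J)"
    unfolding J
    by (rule iffD2[OF smooth_on_cong[OF V frl_ricci_ric(1)]])
      (assumption, intro smooth_on_mult smooth_on_const smooth_ric V)
qed

lemma ricci_symmetric: assumes x: "x \<in> V" shows "ricci g \<Gamma> x [i, j] = ricci g \<Gamma> x [j, i]"
proof -
  let ?S = "\<lambda>I. ricci g \<Gamma> x I - ricci g \<Gamma> x (map ((!) I) [1, 0])"
  have "frl (E x) ?S J = 0" if l: "length J = length [i, j]" for J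
  proof -
    obtain a b where J: "J = [a, b]" using l by (auto simp: length_Suc_conv)
    have "frl (E x) (\<lambda>I. ricci g \<Gamma> x (map ((!) I) [1, 0])) [a, b] = frl (E x) (ricci g \<Gamma> x) (map ((!) [a, b]) [1, 0])"
      by (rule frl_index_permute) auto
    then show ?thesis
      unfolding J frl_diff using frl_ricci_ric[OF x, of a b] frl_ricci_ric(1)[OF x, of b a] by (simp del: frl.simps)
  qed
  then show ?thesis using frl_eq_0_imp[OF x, of "[i, j]" ?S] by simp
qed

lemma ricci_parallel: assumes x: "x \<in> V" and I: "length I = 2" shows "cov_deriv \<Gamma> (ricci g \<Gamma>) x i I = 0"
proof (rule frl_eq_0_imp[OF x])
  fix J :: "7 list" assume "length J = length I"
  then obtain a b where J: "J = [a, b]" using I by (auto simp: length_Suc_conv eval_nat_numeral)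
  interpret w: g2_element "W x i" by (rule W_g2[OF x])
  have "(\<lambda>y. sigma4 (T y) a b c d) differentiable (at x)" for a b c d
    by (rule smooth_on_differentiable[OF smooth_sigma4 x])
  then have pd: "pd i (\<lambda>y. ric y a b) x = act2 (W x i) (ric x) a b"
    unfolding ric_def[abs_def] w.tr3_ps_act unfolding tr3_def pd_sigma4[OF x, symmetric]
    by (simp add: pd_sum pd_mult differentiable_mult differentiable_sum_fun)
  have "frl (E x) (cov_deriv \<Gamma> (ricci g \<Gamma>) x i) J = cov_deriv W (\<lambda>y. frl (E y) (ricci g \<Gamma> y)) x i J"
    by (rule cov_deriv_frame[OF x smooth_ricci, symmetric]) (simp add: J)
  also have "\<dots> = cov_deriv W (\<lambda>y J. 1/6 * ric y (J ! 0) (J ! 1)) x i J"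
    unfolding J by (rule cov_deriv_cong[OF V x]) (auto simp: length_Suc_conv frl_ricci_ric(1) simp del: frl.simps)
  also have "\<dots> = 0"
    unfolding cov_deriv_derl derl_cmult pd_mult[OF differentiable_const smooth_on_differentiable[OF smooth_ric x]]
    using pd by (simp add: J act2_def)
  finally show "frl (E x) (cov_deriv \<Gamma> (ricci g \<Gamma>) x i) J = 0" .
qed

end

section \<open>Change of charts\<close>

lemma Ck_on_sum:
  "open S \<Longrightarrow> (\<And>a. a \<in> A \<Longrightarrow> Ck_on k S (f a)) \<Longrightarrow> Ck_on k S (\<lambda>x. \<Sum>a\<in>A. f a x)"
  by (induction A rule: infinite_finite_induct) (auto intro: Ck_on_add Ck_on_const)

section \<open>Chain rule in coordinates\<close>

lemma frechet_derivative_pd: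
  assumes f: "f differentiable (at x)"
  shows "frechet_derivative f (at x) h = (\<Sum>\<^sub>7p. h $ p * pd p f x)"
proof -
  let ?D = "frechet_derivative f (at x)"
  have lin: "linear ?D"
    using f by (simp add: frechet_derivative_works has_derivative_linear)
  have "?D h = ?D (\<Sum>p\<in>UNIV. h $ p *\<^sub>R axis p 1)"
    using basis_expansion[of h] by (simp add: scalar_mult_eq_scaleR)
  then show ?thesis
    unfolding linear_sum[OF lin] pd_def by (simp add: linear_cmul[OF lin])
qed

lemma chain_rule_has_derivative:
  fixes \<tau> :: "real^7 \<Rightarrow> real^7"
  assumes t: "\<And>p. (\<lambda>y. \<tau> y $ p) differentiable (at x)" and f: "f differentiable (at (\<tau> x))"
  shows "((\<lambda>y. f (\<tau> y)) has_derivative (\<lambda>h. \<Sum>\<^sub>7p. frechet_derivative (\<lambda>y. \<tau> y $ p) (at x) h * pd p f (\<tau> x))) (at x)"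
proof -
  let ?D = "\<lambda>h. \<Sum>p\<in>UNIV. frechet_derivative (\<lambda>y. \<tau> y $ p) (at x) h *\<^sub>R axis p (1::real)"
  have "((\<lambda>y. \<Sum>p\<in>UNIV. \<tau> y $ p *\<^sub>R axis p (1::real)) has_derivative ?D) (at x)"
    by (intro has_derivative_sum has_derivative_scaleR_left t[unfolded frechet_derivative_works])
  then have "(\<tau> has_derivative ?D) (at x)"
    using basis_expansion[of "\<tau> _"] by (simp add: scalar_mult_eq_scaleR)
  then have "(f \<circ> \<tau> has_derivative frechet_derivative f (at (\<tau> x)) \<circ> ?D) (at x)"
    by (rule diff_chain_at) (rule f[unfolded frechet_derivative_works])
  moreover have "?D h $ p = frechet_derivative (\<lambda>y. \<tau> y $ p) (at x) h" for h p
    by (simp add: axis_def if_distrib cong: if_cong)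
  ultimately show ?thesis
    unfolding comp_def frechet_derivative_pd[OF f] by simp
qed

lemma
  fixes \<tau> :: "real^7 \<Rightarrow> real^7"
  assumes "\<And>p. (\<lambda>y. \<tau> y $ p) differentiable (at x)" "f differentiable (at (\<tau> x))"
  shows pd_compose: "pd i (\<lambda>y. f (\<tau> y)) x = (\<Sum>\<^sub>7p. pd i (\<lambda>y. \<tau> y $ p) x * pd p f (\<tau> x))"
    and differentiable_compose: "(\<lambda>y. f (\<tau> y)) differentiable (at x)"
  using pd_eq[OF chain_rule_has_derivative[OF assms]] chain_rule_has_derivative[OF assms]
  unfolding pd_def[of _ "\<lambda>y. \<tau> y $ _"] differentiable_def by auto

lemma smooth_on_compose:
  fixes \<tau> :: "real^7 \<Rightarrow> real^7"
  assumes U: "open U" and \<tau>: "\<And>p. smooth_on U (\<lambda>x. \<tau> x $ p)" "\<And>x. x \<in> U \<Longrightarrow> \<tau> x \<in> S"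
    and f: "smooth_on S f"
  shows "smooth_on U (\<lambda>x. f (\<tau> x))"
proof -
  have d: "(\<lambda>y. \<tau> y $ p) differentiable (at x)" if "x \<in> U" for x p
    by (rule smooth_on_differentiable[OF \<tau>(1) that])
  have "Ck_on k U (\<lambda>x. f (\<tau> x))" if "smooth_on S f" for k f
    using that
  proof (induction k arbitrary: f)
    case 0
    have "(\<lambda>y. f (\<tau> y)) differentiable (at x)" if "x \<in> U" for x
      using d[OF that] smooth_on_differentiable[OF 0 \<tau>(2)[OF that]] by (rule differentiable_compose)
    then show ?case
      by (auto intro!: continuous_at_imp_continuous_on differentiable_imp_continuous_within)
  next
    case (Suc k)
    have df: "f differentiable (at (\<tau> x))" if "x \<in> U" for x
      by (rule smooth_on_differentiable[OF Suc.prems \<tau>(2)[OF that]])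
    have "Ck_on k U (\<lambda>x. \<Sum>\<^sub>7p. pd i (\<lambda>y. \<tau> y $ p) x * pd p f (\<tau> x))" for i
    proof (rule Ck_on_sum[OF U], rule Ck_on_mult[OF U])
      fix p
      show "Ck_on k U (pd i (\<lambda>y. \<tau> y $ p))" using smooth_on_pd[OF \<tau>(1)] unfolding smooth_on_def by blast
      show "Ck_on k U (\<lambda>x. pd p f (\<tau> x))" by (rule Suc.IH[OF smooth_on_pd[OF Suc.prems]])
    qed
    moreover have "Ck_on k U (pd i (\<lambda>x. f (\<tau> x))) = Ck_on k U (\<lambda>x. \<Sum>\<^sub>7p. pd i (\<lambda>y. \<tau> y $ p) x * pd p f (\<tau> x))" for i
      by (rule Ck_on_cong[OF U]) (rule pd_compose[OF d df])
    ultimately show ?case using differentiable_compose[OF d df] by simp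
  qed
  then show ?thesis using f unfolding smooth_on_def by blast
qed

lemma pd_eq_0_imp_const:
  assumes "\<And>y. y \<in> ball x r \<Longrightarrow> f differentiable (at y)" "\<And>i y. y \<in> ball x r \<Longrightarrow> pd i f y = 0"
    and y: "y \<in> ball x r"
  shows "f y = f x"
proof -
  have "(f has_derivative (\<lambda>h. 0)) (at y within ball x r)" if y: "y \<in> ball x r" for y
  proof -
    have "frechet_derivative f (at y) = (\<lambda>h. 0)"
      by (rule ext) (simp add: frechet_derivative_pd[OF assms(1)[OF y]] assms(2)[OF y])
    then have "(f has_derivative (\<lambda>h. 0)) (at y)"
      using assms(1)[OF y, unfolded frechet_derivative_works] by simp
    then show ?thesis by (rule has_derivative_at_withinI)
  qed
  then have "\<exists>c. \<forall>y\<in>ball x r. f y = c"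
    by (rule has_derivative_zero_constant[OF convex_ball])
  moreover have "0 < r" using y zero_le_dist[of x y] unfolding mem_ball by linarith
  then have "x \<in> ball x r" by simp
  ultimately show ?thesis using y by metis
qed

lemma pd_component: "pd i (\<lambda>y. y $ j) x = kd i j"
  using pd_eq[OF bounded_linear_imp_has_derivative[OF bounded_linear_vec_nth], of i j x] by (simp add: axis_def kd_def)

lemma frl_std_phi:
  assumes "length I = 3" shows "frl M (std_phi e) I = std_phi (\<lambda>a. frl M (e a)) I"
proof -
  have w: "frl M (wedge_list [e i, e j, e k]) I = wedge_list [frl M (e i), frl M (e j), frl M (e k)] I" for i j k
    using frl_wedge_list[of I "[e i, e j, e k]" M] assms by (simp del: frl.simps wedge_list.simps)
  show ?thesis unfolding std_phi_def Let_def frl_add frl_diff w ..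
qed

locale parallel_lee_instanton =
  fixes A :: "('m::{t2_space,second_countable_topology}) chart set"
    and \<phi> g vol :: "'m manifold_tensor"
    and \<Gamma> :: "'m chart \<Rightarrow> christoffel"
  assumes manifold: "smooth_manifold7 A"
    and g2: "g2_structure A \<phi>"
    and metric_vol: "induced_metric_vol A \<phi> g vol"
    and integrable: "integrable_g2 A \<phi> g vol"
    and connection: "characteristic_connection A \<phi> g \<Gamma>"
    and lee_parallel: "parallel A \<Gamma> 1 (\<lambda>c. lee_form (g c) (vol c) (\<phi> c))"
    and instanton: "g2_instanton A \<phi> g \<Gamma>"
begin

lemma adapted:
  assumes c: "c \<in> A" and e: "adapted_coframe c \<phi> V e"
  shows "adapted_instanton V e (g c) (vol c) (\<phi> c) (\<Gamma> c)"
proof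
  have V: "V \<subseteq> chart_img c" using e unfolding adapted_coframe_def by blast
  show "open V" "smooth_on V (\<lambda>x. e a x [i])" for a i
    using e unfolding adapted_coframe_def coframe_on_def by blast+
  show "det (\<chi> a i. e a x [i]) \<noteq> 0" if "x \<in> V" for x
    using e that unfolding adapted_coframe_def coframe_on_def by blast
  show "\<phi> c x I = std_phi (\<lambda>a. e a x) I" if "x \<in> V" "length I = 3" for x I
    using e that unfolding adapted_coframe_def by blast
  show "g c x [i, j] = (\<Sum>\<^sub>7a. e a x [i] * e a x [j])" if "x \<in> V" for x i j
    using metric_vol c e that unfolding induced_metric_vol_def by blast
  show "vol c x I = wedge_list (map (\<lambda>a. e a x) [1, 2, 3, 4, 5, 6, 7]) I" if "x \<in> V" "length I = 7" for x I
    using metric_vol c e that unfolding induced_metric_vol_def by blast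
  show "smooth_on V (\<lambda>x. \<Gamma> c x i j l)" for i j l
    using connection c V unfolding characteristic_connection_def connection_on_def by (meson smooth_on_subset)
  show "cov_deriv (\<Gamma> c) (g c) x i I = 0" if "x \<in> V" "length I = 2" for x i I
    using connection c V that unfolding characteristic_connection_def parallel_def by blast
  show "cov_deriv (\<Gamma> c) (\<phi> c) x i I = 0" if "x \<in> V" "length I = 3" for x i I
    using connection c V that unfolding characteristic_connection_def parallel_def by blast
  show "alternating 3 (torsion (g c) (\<Gamma> c) x)" if "x \<in> V" for x
    using connection c V that unfolding characteristic_connection_def by blast
  show "ext_d (star_phi (g c) (vol c) (\<phi> c)) x I =
      wedge 1 4 (lee_form (g c) (vol c) (\<phi> c) x) (star_phi (g c) (vol c) (\<phi> c) x) I" if "x \<in> V" "length I = 5" for x I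
    using integrable c V that unfolding integrable_g2_def by blast
  show "cov_deriv (\<Gamma> c) (lee_form (g c) (vol c) (\<phi> c)) x i [j] = 0" if "x \<in> V" for x i j
  proof -
    have "x \<in> chart_img c" using V that by blast
    moreover have "length [j] = 1" by simp
    ultimately show ?thesis using lee_parallel c unfolding parallel_def by blast
  qed
  show "(\<Sum>\<^sub>7a b p q. inv_metric (g c x) a p * inv_metric (g c x) b q * curvature (g c) (\<Gamma> c) x a b i j * \<phi> c x [p, q, k]) = 0"
    if "x \<in> V" for x i j k
    using instanton c V that unfolding g2_instanton_def by blast
qed

lemma adapted_at:
  assumes "c \<in> A" "x \<in> chart_img c"
  obtains V e where "x \<in> V" "adapted_coframe c \<phi> V e" "adapted_instanton V e (g c) (vol c) (\<phi> c) (\<Gamma> c)"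
proof -
  have "\<exists>V e. x \<in> V \<and> adapted_coframe c \<phi> V e" using g2 assms unfolding g2_structure_def by blast
  then show ?thesis using that adapted[OF assms(1)] by blast
qed

section \<open>Transition maps and pulled-back coframes\<close>

lemma chart_inv: "c \<in> A \<Longrightarrow> m \<in> chart_dom c \<Longrightarrow> chart_inv c (snd c m) = m"
  using manifold unfolding smooth_manifold7_def homeomorphism_def by blast

lemma overlap_transition:
  assumes c: "c \<in> A" "d \<in> A" and x: "x \<in> overlap c d"
  shows "x \<in> chart_img c" "transition c d x \<in> overlap d c" "transition d c (transition c d x) = x"
proof -
  obtain m where m: "m \<in> chart_dom c" "m \<in> chart_dom d" "x = snd c m" using x unfolding overlap_def by blast
  then have t: "transition c d x = snd d m"
    unfolding transition_def using chart_inv[OF c(1)] by simp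
  show "x \<in> chart_img c" using m unfolding chart_img_def by blast
  show "transition c d x \<in> overlap d c" using m unfolding t overlap_def by blast
  show "transition d c (transition c d x) = x"
    unfolding t using m chart_inv[OF c(2)] unfolding transition_def by simp
qed

lemma open_overlap: assumes c: "c \<in> A" "d \<in> A" shows "open (overlap c d)"
proof -
  have o: "open (chart_dom c)" "open (chart_dom d)" "open (chart_img c)"
    and h: "homeomorphism (chart_dom c) (chart_img c) (snd c) (chart_inv c)"
    using manifold c unfolding smooth_manifold7_def by blast+
  have "openin (top_of_set (chart_dom c)) (chart_dom c \<inter> chart_dom d)"
    using o by (simp add: openin_open_Int)
  from homeomorphism_imp_open_map[OF h this] show ?thesis
    unfolding overlap_def using o(3) by (meson openin_open_trans)
qed

lemma smooth_transition: "c \<in> A \<Longrightarrow> d \<in> A \<Longrightarrow> smooth_on (overlap c d) (\<lambda>x. transition c d x $ i)"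
  using manifold unfolding smooth_manifold7_def by blast

definition jac :: "'m chart \<Rightarrow> 'm chart \<Rightarrow> real^7 \<Rightarrow> 7 \<Rightarrow> 7 \<Rightarrow> real" where
  "jac c d x i p = pd i (\<lambda>y. transition c d y $ p) x"

lemma jac_inverse:
  assumes c: "c \<in> A" "d \<in> A" and x: "x \<in> overlap c d"
  shows "(\<Sum>\<^sub>7p. jac c d x i p * jac d c (transition c d x) p r) = kd i r"
proof -
  note o = overlap_transition[OF c]
  have "pd i (\<lambda>y. transition d c (transition c d y) $ r) x = pd i (\<lambda>y. y $ r) x"
    by (rule pd_cong_open[OF open_overlap[OF c] x]) (simp add: o(3))
  moreover have "pd i (\<lambda>y. transition d c (transition c d y) $ r) x =
      (\<Sum>\<^sub>7p. jac c d x i p * jac d c (transition c d x) p r)"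
    unfolding jac_def
    by (rule pd_compose[of "transition c d" x "\<lambda>z. transition d c z $ r"])
      (rule smooth_on_differentiable[OF smooth_transition[OF c] x]
        smooth_on_differentiable[OF smooth_transition[OF c(2,1)] o(2)[OF x]])+
  ultimately show ?thesis unfolding pd_component by simp
qed

text \<open>The transformation law of \<open>\<phi>\<close> makes the pulled-back coframe adapted in
  the other chart. The domain is the part of the overlap that the transition map sends into
  \<open>V\<close>.\<close>

lemma pullback_coframe:
  assumes c: "c \<in> A" "d \<in> A" and x: "x \<in> overlap c d"
    and V: "transition c d x \<in> V" and e: "adapted_coframe d \<phi> V e"
  obtains V' where "x \<in> V'" "V' \<subseteq> overlap c d"
    "adapted_coframe c \<phi> V' (\<lambda>a x. frl (jac c d x) (e a (transition c d x)))"
proof -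
  let ?t = "transition c d" and ?U = "overlap c d"
  define V' where "V' = ?U \<inter> ?t -` V"
  have V'U: "V' \<subseteq> ?U" and V'V: "\<And>y. y \<in> V' \<Longrightarrow> ?t y \<in> V" unfolding V'_def by auto
  have oV: "open V" and sV: "\<And>a i. smooth_on V (\<lambda>x. e a x [i])"
    and dV: "\<And>y. y \<in> V \<Longrightarrow> det (\<chi> a i. e a y [i]) \<noteq> 0"
    and pV: "\<And>y I. y \<in> V \<Longrightarrow> length I = 3 \<Longrightarrow> \<phi> d y I = std_phi (\<lambda>a. e a y) I"
    using e unfolding adapted_coframe_def coframe_on_def by blast+
  have "continuous_on ?U (\<lambda>y. \<chi> i. ?t y $ i)"
    by (intro continuous_intros smooth_on_continuous smooth_transition c)
  then have cont: "continuous_on ?U ?t" by simp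
  have oV': "open V'"
    unfolding V'_def by (rule continuous_open_preimage[OF cont open_overlap[OF c] oV])
  have smt: "smooth_on V' (\<lambda>y. ?t y $ p)" for p
    by (rule smooth_on_subset[OF smooth_transition[OF c] V'U])
  have "smooth_on V' (\<lambda>y. frl (jac c d y) (e a (?t y)) [i])" for a i
  proof -
    have "smooth_on V' (\<lambda>y. \<Sum>\<^sub>7p. jac c d y i p * e a (?t y) [p])"
      unfolding jac_def
      by (intro smooth_on_sum smooth_on_mult smooth_on_pd oV' smt smooth_on_compose[OF oV' smt V'V sV])
    then show ?thesis by simp
  qed
  moreover have "det (\<chi> a i. frl (jac c d y) (e a (?t y)) [i]) \<noteq> 0" if y: "y \<in> V'" for y
  proof -
    let ?e = "(\<chi> a i. e a (?t y) [i]) :: real^7^7" and ?J = "(\<chi> p i. jac c d y i p) :: real^7^7"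
      and ?K = "(\<chi> r p. jac d c (?t y) p r) :: real^7^7"
    have "?K ** ?J = mat 1"
      using jac_inverse[OF c, of y] y V'U by (auto simp: matrix_matrix_mult_def mat_def vec_eq_iff kd_def mult.commute)
    then have "det ?K * det ?J = 1" unfolding det_mul[symmetric] by simp
    then have "det ?J \<noteq> 0" by auto
    moreover have "(\<chi> a i. frl (jac c d y) (e a (?t y)) [i]) = ?e ** ?J"
      by (simp add: matrix_matrix_mult_def vec_eq_iff mult.commute)
    ultimately show ?thesis using dV[OF V'V[OF y]] by (simp add: det_mul)
  qed
  moreover have "\<phi> c y I = std_phi (\<lambda>a. frl (jac c d y) (e a (?t y))) I" if y: "y \<in> V'" and I: "length I = 3" for y I
  proof -
    have "\<phi> c y I = (\<Sum>J | length J = 3. \<phi> d (?t y) J * (\<Prod>k<3. pd (I ! k) (\<lambda>y. ?t y $ (J ! k)) y))"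
      using g2 c y V'U I unfolding g2_structure_def form_on_def tensor_on_def by blast
    also have "\<dots> = frl (jac c d y) (\<phi> d (?t y)) I"
      unfolding sum_prod_frl[OF I, symmetric] jac_def by (simp only: mult.commute)
    also have "\<dots> = frl (jac c d y) (std_phi (\<lambda>a. e a (?t y))) I"
      by (rule frl_cong) (simp add: pV[OF V'V[OF y]] I)
    also have "\<dots> = std_phi (\<lambda>a. frl (jac c d y) (e a (?t y))) I"
      by (rule frl_std_phi[OF I])
    finally show ?thesis .
  qed
  moreover have "V' \<subseteq> chart_img c" using V'U overlap_transition(1)[OF c] by blast
  ultimately have "adapted_coframe c \<phi> V' (\<lambda>a x. frl (jac c d x) (e a (transition c d x)))"
    unfolding adapted_coframe_def coframe_on_def using oV' by blast
  moreover have "x \<in> V'" unfolding V'_def using x V by blast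
  ultimately show ?thesis using that V'U by blast
qed

text \<open>The inhomogeneous term in the transformation law of \<open>\<Gamma>\<close> is a second
  derivative, symmetric in \<open>i\<close> and \<open>j\<close>, and cancels.\<close>

lemma tor_transition:
  assumes c: "c \<in> A" "d \<in> A" and x: "x \<in> overlap c d"
  shows "(\<Sum>\<^sub>7l. tor (\<Gamma> c) x i j l * jac c d x l r) =
    (\<Sum>\<^sub>7p. jac c d x i p * (\<Sum>\<^sub>7q. jac c d x j q * tor (\<Gamma> d) (transition c d x) p q r))"
proof -
  let ?G = "\<Gamma> d (transition c d x)" and ?J = "jac c d x"
  have t: "(\<Sum>\<^sub>7l. \<Gamma> c x i j l * ?J l r) = pd i (pd j (\<lambda>y. transition c d y $ r)) x + (\<Sum>\<^sub>7p q. ?G p q r * ?J i p * ?J j q)" for i j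
    using connection c x unfolding characteristic_connection_def connection_on_def Let_def jac_def by blast
  have "(\<Sum>\<^sub>7l. tor (\<Gamma> c) x i j l * ?J l r) = (\<Sum>\<^sub>7p q. ?G p q r * ?J i p * ?J j q) - (\<Sum>\<^sub>7p q. ?G p q r * ?J j p * ?J i q)"
    unfolding tor_def left_diff_distrib sum_subtractf t
    using pd_commute[OF open_overlap[OF c] x smooth_transition[OF c], of i j r] by simp
  also have "(\<Sum>\<^sub>7p q. ?G p q r * ?J j p * ?J i q) = (\<Sum>\<^sub>7p q. ?G q p r * ?J j q * ?J i p)"
    by (rule sum.swap)
  finally show ?thesis
    unfolding tor_def right_diff_distrib sum_subtractf sum_distrib_left
    by (simp only: mult.commute[of "?G _ _ _"] mult.assoc mult.left_commute[of "?J j _"])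
qed

text \<open>Exterior derivative and Hodge star are not transformed separately: by
  \<open>form_inner_ext_d_phi\<close> the function is the trace of \<open>phc T\<close> in any
  adapted frame. For a coframe and its pullback the frame components of the torsion agree.\<close>

lemma form_inner_transition:
  assumes c: "c \<in> A" "d \<in> A" and x: "x \<in> overlap c d"
  defines "F \<equiv> \<lambda>c x. form_inner (g c x) 4 (ext_d (\<phi> c) x) (star_phi (g c) (vol c) (\<phi> c) x)"
  shows "F c x = F d (transition c d x)"
proof -
  let ?y = "transition c d x"
  have "?y \<in> chart_img d" using overlap_transition(1)[OF c(2,1) overlap_transition(2)[OF c x]] .
  then obtain V e where V: "?y \<in> V" and e: "adapted_coframe d \<phi> V e" and i: "adapted_instanton V e (g d) (vol d) (\<phi> d) (\<Gamma> d)"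
    using adapted_at[OF c(2)] by blast
  define e' where "e' = (\<lambda>a x. frl (jac c d x) (e a (transition c d x)))"
  obtain V' where V': "x \<in> V'" "adapted_coframe c \<phi> V' e'"
    unfolding e'_def by (rule pullback_coframe[OF c x V e])
  interpret d: adapted_instanton V e "g d" "vol d" "\<phi> d" "\<Gamma> d" by (rule i)
  interpret c: adapted_instanton V' e' "g c" "vol c" "\<phi> c" "\<Gamma> c" by (rule adapted[OF c(1) V'(2)])
  let ?J = "jac c d x"
  have e': "e' a x [i] = (\<Sum>\<^sub>7p. ?J i p * e a ?y [p])" for a i
    unfolding e'_def by simp
  \<comment> \<open>Both sides are the vector dual to the coframe \<open>e\<close> at the image
    point.\<close>
  have EJ: "(\<Sum>\<^sub>7i. c.E x a i * ?J i p) = d.E ?y a p" for a p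
  proof -
    define f where "f p = (\<Sum>\<^sub>7i. c.E x a i * ?J i p)" for p
    have fe: "(\<Sum>\<^sub>7q. f q * e b ?y [q]) = kd a b" for b
    proof -
      have "(\<Sum>\<^sub>7q. f q * e b ?y [q]) = (\<Sum>\<^sub>7i. c.E x a i * e' b x [i])"
        unfolding f_def e' by (rule sum7_assoc[symmetric])
      then show ?thesis using c.e_E[OF V'(1), of b a] by (simp add: mult.commute kd_commute)
    qed
    have "f p = (\<Sum>\<^sub>7q. f q * (\<Sum>\<^sub>7b. e b ?y [q] * d.E ?y b p))" unfolding d.E_e[OF V] by simp
    also have "\<dots> = (\<Sum>\<^sub>7b. (\<Sum>\<^sub>7q. f q * e b ?y [q]) * d.E ?y b p)" by (rule sum7_assoc)
    also have "\<dots> = d.E ?y a p" unfolding fe by simp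
    finally show ?thesis unfolding f_def .
  qed
  have "c.T x a b n = d.T ?y a b n" for a b n
  proof -
    let ?t = "tor (\<Gamma> d) ?y"
    have "(\<Sum>\<^sub>7l. tor (\<Gamma> c) x i j l * e' n x [l]) = (\<Sum>\<^sub>7r. (\<Sum>\<^sub>7p. ?J i p * (\<Sum>\<^sub>7q. ?J j q * ?t p q r)) * e n ?y [r])" for i j
      unfolding e' sum7_assoc tor_transition[OF c x] ..
    also have "\<dots> i j = (\<Sum>\<^sub>7p. ?J i p * (\<Sum>\<^sub>7q. ?J j q * (\<Sum>\<^sub>7r. ?t p q r * e n ?y [r])))" for i j
      unfolding sum7_assoc ..
    finally have 1: "(\<Sum>\<^sub>7l. tor (\<Gamma> c) x i j l * e' n x [l]) = (\<Sum>\<^sub>7p. ?J i p * (\<Sum>\<^sub>7q. ?J j q * (\<Sum>\<^sub>7r. ?t p q r * e n ?y [r])))" for i j .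
    have "c.T x a b n = (\<Sum>\<^sub>7i. c.E x a i * (\<Sum>\<^sub>7p. ?J i p * (\<Sum>\<^sub>7j. c.E x b j * (\<Sum>\<^sub>7q. ?J j q * (\<Sum>\<^sub>7r. ?t p q r * e n ?y [r])))))"
      unfolding c.T_eq[OF V'(1)] 1 sum_swap2[of "c.E x b"] ..
    also have "\<dots> = d.T ?y a b n"
      unfolding sum7_assoc[of "c.E x _"] EJ unfolding d.T_eq[OF V] ..
    finally show ?thesis .
  qed
  then have "c.T x = d.T ?y" by blast
  then show ?thesis
    unfolding F_def c.form_inner_ext_d_phi[OF V'(1)] d.form_inner_ext_d_phi[OF V] by simp
qed

definition type_fun :: "'m chart \<Rightarrow> real^7 \<Rightarrow> real" where
  "type_fun c x = form_inner (g c x) 4 (ext_d (\<phi> c) x) (star_phi (g c) (vol c) (\<phi> c) x)"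

lemma type_fun_locally_constant:
  assumes c: "c \<in> A" and x: "x \<in> chart_img c"
  obtains r where "0 < r" "ball x r \<subseteq> chart_img c" "\<And>y. y \<in> ball x r \<Longrightarrow> type_fun c y = type_fun c x"
proof -
  obtain V e where xV: "x \<in> V" and e: "adapted_coframe c \<phi> V e"
    and i: "adapted_instanton V e (g c) (vol c) (\<phi> c) (\<Gamma> c)"
    using adapted_at[OF c x] by blast
  interpret adapted_instanton V e "g c" "vol c" "\<phi> c" "\<Gamma> c" by (rule i)
  obtain r where r: "0 < r" "ball x r \<subseteq> V" using V xV by (meson openE)
  then have rV: "y \<in> V" if "y \<in> ball x r" for y using that by blast
  have d: "(\<lambda>y. \<Sum>\<^sub>7n. phc (T y) n n) differentiable (at y)" if "y \<in> V" for y
    using smooth_on_differentiable[OF smooth_phc that] by (intro differentiable_sum_fun)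
  have "(\<Sum>\<^sub>7n. phc (T y) n n) = (\<Sum>\<^sub>7n. phc (T x) n n)" if y: "y \<in> ball x r" for y
    by (rule pd_eq_0_imp_const[of x r "\<lambda>y. \<Sum>\<^sub>7n. phc (T y) n n", OF d[OF rV] pd_trace[OF rV] y])
  then have "type_fun c y = type_fun c x" if "y \<in> ball x r" for y
    unfolding type_fun_def form_inner_ext_d_phi[OF xV] form_inner_ext_d_phi[OF rV[OF that]] using that by blast
  moreover have "V \<subseteq> chart_img c" using e unfolding adapted_coframe_def by blast
  ultimately show ?thesis using that r by blast
qed

lemma type_fun_constant: "\<exists>\<kappa>. \<forall>c\<in>A. \<forall>x\<in>chart_img c. type_fun c x = \<kappa>"
proof -
  define M where "M = (\<Union>c\<in>A. chart_dom c)"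
  \<comment> \<open>The type function on the manifold itself, through an arbitrary chart around
    \<open>m\<close>; by \<open>form_inner_transition\<close> the choice is immaterial.\<close>
  define f where "f m = type_fun (SOME c. c \<in> A \<and> m \<in> chart_dom c) (snd (SOME c. c \<in> A \<and> m \<in> chart_dom c) m)" for m
  have f: "f m = type_fun c (snd c m)" if c: "c \<in> A" "m \<in> chart_dom c" for c m
  proof -
    define d where "d = (SOME c. c \<in> A \<and> m \<in> chart_dom c)"
    have d: "d \<in> A \<and> m \<in> chart_dom d" unfolding d_def by (rule someI[of _ c]) (use c in blast)
    have "snd c m \<in> overlap c d" unfolding overlap_def using c d by blast
    moreover have "transition c d (snd c m) = snd d m"
      unfolding transition_def using chart_inv[OF c] by simp
    ultimately have "type_fun c (snd c m) = type_fun d (snd d m)"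
      using form_inner_transition[of c d "snd c m"] c d unfolding type_fun_def by simp
    then show ?thesis unfolding f_def d_def ..
  qed
  have const: "f a = f b" if "a \<in> M" "b \<in> M" for a b
  proof (rule connected_local_const[OF _ that])
    show "connected M" using manifold unfolding smooth_manifold7_def M_def by blast
    show "\<forall>a\<in>M. eventually (\<lambda>b. f a = f b) (at a within M)"
    proof
      fix a assume "a \<in> M"
      then obtain c where c: "c \<in> A" "a \<in> chart_dom c" unfolding M_def by blast
      then have "snd c a \<in> chart_img c" unfolding chart_img_def by blast
      then obtain r where r: "0 < r" "\<And>y. y \<in> ball (snd c a) r \<Longrightarrow> type_fun c y = type_fun c (snd c a)"
        using type_fun_locally_constant[OF c(1)] by blast
      let ?S = "chart_dom c \<inter> snd c -` ball (snd c a) r"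
      have "open (chart_dom c)" "continuous_on (chart_dom c) (snd c)"
        using manifold c(1) unfolding smooth_manifold7_def homeomorphism_def by blast+
      then have "open ?S" by (intro continuous_open_preimage open_ball)
      moreover have "a \<in> ?S" using c r by simp
      moreover have "f a = f b" if "b \<in> ?S" for b
        using that f[OF c] f[OF c(1), of b] r(2)[of "snd c b"] by simp
      ultimately show "eventually (\<lambda>b. f a = f b) (at a within M)"
        unfolding eventually_at_topological by blast
    qed
  qed
  show ?thesis
  proof (cases "M = {}")
    case True
    then show ?thesis unfolding M_def chart_img_def by auto
  next
    case False
    then obtain a where a: "a \<in> M" by blast
    have "type_fun c x = f a" if c: "c \<in> A" and x: "x \<in> chart_img c" for c x
    proof -
      obtain m where m: "m \<in> chart_dom c" "x = snd c m" using x unfolding chart_img_def by blast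
      then have "m \<in> M" using c unfolding M_def by blast
      then show ?thesis using f[OF c m(1)] const[OF a] m by simp
    qed
    then show ?thesis by blast
  qed
qed

lemma parallel_tensors:
  assumes c: "c \<in> A" and x: "x \<in> chart_img c"
  shows "length I = 3 \<Longrightarrow> cov_deriv (\<Gamma> c) (torsion (g c) (\<Gamma> c)) x i I = 0"
    and "ricci (g c) (\<Gamma> c) x [j, k] = ricci (g c) (\<Gamma> c) x [k, j]"
    and "length I = 2 \<Longrightarrow> cov_deriv (\<Gamma> c) (ricci (g c) (\<Gamma> c)) x i I = 0"
    and "length I = 4 \<Longrightarrow> cov_deriv (\<Gamma> c) (ext_d (torsion (g c) (\<Gamma> c))) x i I = 0"
proof -
  obtain V e where xV: "x \<in> V" and i: "adapted_instanton V e (g c) (vol c) (\<phi> c) (\<Gamma> c)"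
    using adapted_at[OF c x] by blast
  interpret adapted_instanton V e "g c" "vol c" "\<phi> c" "\<Gamma> c" by (rule i)
  show "length I = 3 \<Longrightarrow> cov_deriv (\<Gamma> c) (torsion (g c) (\<Gamma> c)) x i I = 0"
    "ricci (g c) (\<Gamma> c) x [j, k] = ricci (g c) (\<Gamma> c) x [k, j]"
    "length I = 2 \<Longrightarrow> cov_deriv (\<Gamma> c) (ricci (g c) (\<Gamma> c)) x i I = 0"
    "length I = 4 \<Longrightarrow> cov_deriv (\<Gamma> c) (ext_d (torsion (g c) (\<Gamma> c))) x i I = 0"
    by (rule torsion_parallel[OF xV] ricci_symmetric[OF xV] ricci_parallel[OF xV] dtors_parallel[OF xV], assumption?)+
qed

end

theorem theorem1p1:
  fixes A :: "('m::{t2_space,second_countable_topology}) chart set"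
    and \<phi> g vol :: "'m manifold_tensor"
    and \<Gamma> :: "'m chart \<Rightarrow> christoffel"
  assumes "smooth_manifold7 A"
    and "g2_structure A \<phi>"
    and "induced_metric_vol A \<phi> g vol"
    and "integrable_g2 A \<phi> g vol"
    and "characteristic_connection A \<phi> g \<Gamma>"
    and "parallel A \<Gamma> 1 (\<lambda>c. lee_form (g c) (vol c) (\<phi> c))"
    and "g2_instanton A \<phi> g \<Gamma>"
  shows "parallel A \<Gamma> 3 (\<lambda>c. torsion (g c) (\<Gamma> c)) \<and>
         constant_type A \<phi> g vol \<and>
         symmetric2 A (\<lambda>c. ricci (g c) (\<Gamma> c)) \<and>
         parallel A \<Gamma> 2 (\<lambda>c. ricci (g c) (\<Gamma> c)) \<and>
         parallel A \<Gamma> 4 (\<lambda>c. ext_d (torsion (g c) (\<Gamma> c)))"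
proof -
  interpret parallel_lee_instanton A \<phi> g vol \<Gamma> by unfold_locales (rule assms)+
  show ?thesis
    unfolding constant_type_def parallel_def symmetric2_def
    using parallel_tensors type_fun_constant integrable unfolding type_fun_def by blast
qed

end
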